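(* Let $n,m,N\in\mathbb N_0$, let $q\in\mathbb C$ with $0<|q|<1$, let $\alpha,a,b,c,d\in\mathbb C\setminus\{0\}$, and suppose $n,m\le N$ and $|abcd|<|q|^{2N-1}$. For $\beta\in\mathbb C\setminus\{0\}$ define $$\Psi_{m,n}(\beta):=\sum_{k=-\infty}^\infty(1+q^{2k}\beta^2)\,\mathsf p_n[q^k\beta;a,b,c,d|q]\,\mathsf p_m[q^k\beta;a,b,c,d|q]\,\prod_{t\in\{a,b,c,d\}}\Big(-q^{k+1}\beta t,\frac{q^{1-k}t}{\beta};q\Big)_\infty\; q^{2k^2-k}\beta^{4k},$$ where $\{a,b,c,d\}$ is a multiset (so the product has one factor for each of the four parameters), and put $$h_n:=\frac{q^{-6\binom n2}(-a^2b^2c^2d^2)^n\,(q,-\frac1{ab},-\frac1{ac},-\frac1{ad},-\frac1{bc},-\frac1{bd},-\frac1{cd};q)_n\,(\frac1{qabcd};q)_{2n}}{(\frac1{qabcd};q)_n(\frac1{abcd};q)_{2n}}.$$ Then $$\Psi_{m,n}(\alpha)=\frac{(q,-\alpha^2,-\frac q{\alpha^2},-qab,-qac,-qad,-qbc,-qbd,-qcd;q)_\infty}{(qabcd;q)_\infty}\,h_n\,\delta_{m,n},$$ and $$\int_{-\infty}^\infty(1+q^{2x}\alpha^2)\,\mathsf p_n[q^x\alpha;a,b,c,d|q]\,\mathsf p_m[q^x\alpha;a,b,c,d|q]\prod_{t\in\{a,b,c,d\}}\Big(-q^{x+1}\alpha t,\frac{q^{1-x}t}{\alpha};q\Big)_\infty\;q^{2x^2-x}\alpha^{4x}\,dx$$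 $$=\int_0^1\Psi_{m,n}(q^x\alpha)\,q^{2x^2-x}\alpha^{4x}\,dx$$ $$=\frac{\sqrt{2\pi}\,\alpha\,\exp\left(\frac{2(\log\alpha)^2}{\log q^{-1}}\right)(-qab,-qac,-qad,-qbc,-qbd,-qcd;q)_\infty}{q^{1/8}\sqrt{\log q^{-1}}\,(qabcd;q)_\infty}\,h_n\,\delta_{m,n}.$$
   Context: Notation: $\mathbb N_0=\{0,1,2,\dots\}$. For $n\in\mathbb N_0$, $(y;q)_n=\prod_{j=0}^{n-1}(1-yq^j)$, $(y;q)_\infty=\prod_{j\ge0}(1-yq^j)$, and $(y_1,\dots,y_r;q)_k=\prod_i(y_i;q)_k$, also for $k=\infty$. $\delta_{m,n}$ is the Kronecker delta. Powers are $q^s=\exp(s\log q)$, $\alpha^{s}=\exp(s\log\alpha)$ with principal logarithms, $\log q^{-1}=-\log q$ (which has positive real part), and $\sqrt{\log q^{-1}}$ is the principal square root. The $q^{-1}$-Askey--Wilson polynomials are polynomials of degree $n$ in $x=\frac12(z-z^{-1})$, defined by $\mathsf p_n[z;a,b,c,d|q]=i^{-n}p_n[iz;ia,ib,ic,id|q^{-1}]$, where $p_n$ is the Askey--Wilson polynomial in standard normalization, written as a function of $w$ with argument $\frac12(w+w^{-1})$. Explicitly, $$\mathsf p_n[z;a,b,c,d|q]=q^{-3\binom n2}(-a^2bcd)^n\sum_{k=0}^n\frac{(q^{-n},\frac{q^{n-1}}{abcd},\frac za,-\frac1{az};q)_k}{(q;q)_k}\,q^k\,\Big(-\frac{q^k}{ab},-\frac{q^k}{ac},-\frac{q^k}{ad};q\Big)_{n-k}.$$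 *)

theory Defs
  imports "HOL-Analysis.Analysis" "HOL-Library.Multiset"
begin

definition qpoch :: "complex \<Rightarrow> complex \<Rightarrow> nat \<Rightarrow> complex" where
  "qpoch y q n = (\<Prod>j<n. 1 - y * q ^ j)"

text \<open>The infinite product \<^const>\<open>prodinf\<close> is also correct when finitely many factors vanish.\<close>

definition qpoch_inf :: "complex \<Rightarrow> complex \<Rightarrow> complex" where
  "qpoch_inf y q = (\<Prod>j. 1 - y * q ^ j)"

definition qpochs :: "complex list \<Rightarrow> complex \<Rightarrow> nat \<Rightarrow> complex" where
  "qpochs ys q n = (\<Prod>y\<leftarrow>ys. qpoch y q n)"

definition qpochs_inf :: "complex list \<Rightarrow> complex \<Rightarrow> complex" where
  "qpochs_inf ys q = (\<Prod>y\<leftarrow>ys. qpoch_inf y q)"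

text \<open>
  The Askey--Wilson polynomial in standard normalization
  \<open>(ab,ac,ad;q)\<^sub>n a\<^sup>-\<^sup>n \<^sub>4\<phi>\<^sub>3(q\<^sup>-\<^sup>n, abcd q\<^sup>n\<^sup>-\<^sup>1, aw, a/w; ab, ac, ad; q, q)\<close>,
  as a function of \<open>w\<close>; it is a polynomial in \<open>(w + 1/w)/2\<close>.
  The quotients \<open>(ab;q)\<^sub>n / (ab;q)\<^sub>k\<close> are written as \<open>(ab q\<^sup>k;q)\<^sub>n\<^sub>-\<^sub>k\<close>, so that the
  definition is also correct when some \<open>(ab;q)\<^sub>k\<close> vanishes.
  The sum is finite, and \<open>q\<close> may have modulus greater than 1.
\<close>

definition askey_wilson ::
  "nat \<Rightarrow> complex \<Rightarrow> complex \<Rightarrow> complex \<Rightarrow> complex \<Rightarrow> complex \<Rightarrow> complex \<Rightarrow> complex" where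
  "askey_wilson n w a b c d q =
     (1 / a ^ n) *
     (\<Sum>k\<le>n. qpochs [q powi (- int n), a * b * c * d * q powi (int n - 1), a * w, a / w] q k
             / qpoch q q k * q ^ k
             * qpochs [a * b * q ^ k, a * c * q ^ k, a * d * q ^ k] q (n - k))"

definition qinv_askey_wilson ::
  "nat \<Rightarrow> complex \<Rightarrow> complex \<Rightarrow> complex \<Rightarrow> complex \<Rightarrow> complex \<Rightarrow> complex \<Rightarrow> complex" where
  "qinv_askey_wilson n z a b c d q =
     \<i> powi (- int n) *
     askey_wilson n (\<i> * z) (\<i> * a) (\<i> * b) (\<i> * c) (\<i> * d) (1 / q)"

definition Psi_summand ::
  "nat \<Rightarrow> nat \<Rightarrow> complex \<Rightarrow> complex \<Rightarrow> complex \<Rightarrow> complex \<Rightarrow> complex \<Rightarrow> complex \<Rightarrow> int \<Rightarrow> complex" where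
  "Psi_summand m n a b c d q \<beta> k =
     (1 + q powi (2 * k) * \<beta>\<^sup>2)
     * qinv_askey_wilson n (q powi k * \<beta>) a b c d q
     * qinv_askey_wilson m (q powi k * \<beta>) a b c d q
     * (\<Prod>t\<in>#{#a, b, c, d#}. qpochs_inf [- (q powi (k + 1)) * \<beta> * t, q powi (1 - k) * t / \<beta>] q)
     * q powi (2 * k\<^sup>2 - k) * \<beta> powi (4 * k)"

definition Psi ::
  "nat \<Rightarrow> nat \<Rightarrow> complex \<Rightarrow> complex \<Rightarrow> complex \<Rightarrow> complex \<Rightarrow> complex \<Rightarrow> complex \<Rightarrow> complex" where
  "Psi m n a b c d q \<beta> = (\<Sum>\<^sub>\<infinity>k. Psi_summand m n a b c d q \<beta> k)"

text \<open>
  On the complex numbers, \<open>powr\<close> uses the principal logarithm: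
  \<open>z powr w = exp (w * ln z)\<close> for \<open>z \<noteq> 0\<close>.
\<close>

definition Psi_integrand ::
  "nat \<Rightarrow> nat \<Rightarrow> complex \<Rightarrow> complex \<Rightarrow> complex \<Rightarrow> complex \<Rightarrow> complex \<Rightarrow> complex \<Rightarrow> real \<Rightarrow> complex" where
  "Psi_integrand m n a b c d q \<alpha> x =
     (1 + q powr (2 * of_real x) * \<alpha>\<^sup>2)
     * qinv_askey_wilson n (q powr of_real x * \<alpha>) a b c d q
     * qinv_askey_wilson m (q powr of_real x * \<alpha>) a b c d q
     * (\<Prod>t\<in>#{#a, b, c, d#}. qpochs_inf [- (q powr (of_real x + 1)) * \<alpha> * t,
                                  q powr (1 - of_real x) * t / \<alpha>] q)
     * q powr (2 * (of_real x)\<^sup>2 - of_real x) * \<alpha> powr (4 * of_real x)"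

definition hnorm ::
  "nat \<Rightarrow> complex \<Rightarrow> complex \<Rightarrow> complex \<Rightarrow> complex \<Rightarrow> complex \<Rightarrow> complex" where
  "hnorm n a b c d q =
     q powi (- 6 * int (n choose 2)) * (- (a\<^sup>2 * b\<^sup>2 * c\<^sup>2 * d\<^sup>2)) ^ n
     * qpochs [q, - 1 / (a * b), - 1 / (a * c), - 1 / (a * d),
               - 1 / (b * c), - 1 / (b * d), - 1 / (c * d)] q n
     * qpoch (1 / (q * a * b * c * d)) q (2 * n)
     / (qpoch (1 / (q * a * b * c * d)) q n * qpoch (1 / (a * b * c * d)) q (2 * n))"

text \<open>The explicit form of the \<open>q\<^sup>-\<^sup>1\<close>-Askey--Wilson polynomials.\<close>

lemma qpoch_inverse_base:
  assumes "q \<noteq> 0" "y \<noteq> 0"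
  shows "qpoch y (1 / q) k = qpoch (1 / y) q k * (- y) ^ k / q ^ (k choose 2)"
proof (induction k)
  case 0
  then show ?case by (simp add: qpoch_def numeral_2_eq_2)
next
  case (Suc k)
  have ch: "Suc k choose 2 = (k choose 2) + k"
    by (simp add: numeral_2_eq_2)
  have "1 - y * (1 / q) ^ k = (1 - (1 / y) * q ^ k) * (- y) / q ^ k"
    using assms by (simp add: field_simps power_divide)
  moreover have "qpoch y (1 / q) (Suc k) = qpoch y (1 / q) k * (1 - y * (1 / q) ^ k)"
    "qpoch (1 / y) q (Suc k) = qpoch (1 / y) q k * (1 - (1 / y) * q ^ k)"
    by (simp_all add: qpoch_def)
  ultimately show ?case
    by (simp add: Suc ch power_add)
qed

lemma choose_2_split:
  assumes "k \<le> n"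
  shows "(k choose 2) + (n - k choose 2) + k * (n - k) = (n choose 2)"
proof -
  obtain l where l: "n = k + l" using assms le_Suc_ex by blast
  have "((k + l) choose 2) = (k choose 2) + (l choose 2) + k * l"
    by (induction l) (auto simp: numeral_2_eq_2)
  then show ?thesis using l by simp
qed

lemma collect_powers:
  fixes E F :: complex
  assumes "E \<noteq> 0" "F \<noteq> 0"
  shows "A1 * x1 ^ k / E * (A2 * x2 ^ k / E) * (A4 * x4 ^ k / E) * (A3 * x3 ^ k / E)
        / (Q * x5 ^ k / E) * x6 ^ k
        * ((B1 * y1 ^ l / F) * (B2 * y2 ^ l / F) * (B3 * y3 ^ l / F))
      = (x1 * x2 * x4 * x3 / x5 * x6) ^ k / E ^ 3 * ((y1 * y2 * y3) ^ l / F ^ 3)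
        * (A1 * A2 * A3 * A4 / Q * (B1 * B2 * B3))"
  using assms by (simp add: power_mult_distrib power_divide power3_eq_cube ac_simps)

lemma qinv_askey_wilson_explicit:
  assumes "q \<noteq> 0" "a \<noteq> 0" "b \<noteq> 0" "c \<noteq> 0" "d \<noteq> 0" "z \<noteq> 0"
  shows "qinv_askey_wilson n z a b c d q =
     q powi (- 3 * int (n choose 2)) * (- (a\<^sup>2 * b * c * d)) ^ n *
     (\<Sum>k\<le>n. qpochs [q powi (- int n), q powi (int n - 1) / (a * b * c * d), z / a, - 1 / (a * z)] q k
             / qpoch q q k * q ^ k
             * qpochs [- (q ^ k) / (a * b), - (q ^ k) / (a * c), - (q ^ k) / (a * d)] q (n - k))"
proof -
  have pre: "\<i> powi (- int n) * (1 / (\<i> * a) ^ n) = (-1) ^ n / a ^ n"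
  proof -
    have "\<i> ^ n * (\<i> * a) ^ n = (- a) ^ n"
      by (simp flip: power_mult_distrib)
    then have "\<i> powi (- int n) * (1 / (\<i> * a) ^ n) = 1 / (- a) ^ n"
      by (simp add: power_int_minus field_simps)
    also have "\<dots> = (-1) ^ n / a ^ n"
      by (cases "even n") simp_all
    finally show ?thesis .
  qed
  have main: "qpochs [(1 / q) powi (- int n), (\<i> * a) * (\<i> * b) * (\<i> * c) * (\<i> * d) * (1 / q) powi (int n - 1),
        (\<i> * a) * (\<i> * z), (\<i> * a) / (\<i> * z)] (1 / q) k / qpoch (1 / q) (1 / q) k * (1 / q) ^ k
      * qpochs [(\<i> * a) * (\<i> * b) * (1 / q) ^ k, (\<i> * a) * (\<i> * c) * (1 / q) ^ k,
          (\<i> * a) * (\<i> * d) * (1 / q) ^ k] (1 / q) (n - k)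
    = (a ^ 3 * b * c * d) ^ n / q ^ (3 * (n choose 2)) *
      (qpochs [q powi (- int n), q powi (int n - 1) / (a * b * c * d), z / a, - 1 / (a * z)] q k
        / qpoch q q k * q ^ k
        * qpochs [- (q ^ k) / (a * b), - (q ^ k) / (a * c), - (q ^ k) / (a * d)] q (n - k))"
    (is "?L = ?R") if kn: "k \<le> n" for k
  proof -
    obtain l where n: "n = k + l" using kn le_Suc_ex by blast
    define e where "e = (k choose 2)"
    define f where "f = (l choose 2)"
    have ch: "(n choose 2) = e + f + k * l"
      using choose_2_split[OF kn] n by (simp add: e_def f_def)
    define A1 where "A1 = qpoch (q powi (- int n)) q k"
    define A2 where "A2 = qpoch (q powi (int n - 1) / (a * b * c * d)) q k"
    define A3 where "A3 = qpoch (z / a) q k"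
    define A4 where "A4 = qpoch (- 1 / (a * z)) q k"
    define Q where "Q = qpoch q q k"
    define B where "B = (\<lambda>t. qpoch (- (q ^ k) / (a * t)) q l)"
    have q1: "qpoch ((1 / q) powi (- int n)) (1 / q) k = A1 * (- (q ^ n)) ^ k / q ^ e"
      using assms by (subst qpoch_inverse_base) (simp_all add: A1_def e_def power_int_minus power_divide field_simps)
    have q2: "qpoch ((\<i> * a) * (\<i> * b) * (\<i> * c) * (\<i> * d) * (1 / q) powi (int n - 1)) (1 / q) k
        = A2 * (- (a * b * c * d * q / q ^ n)) ^ k / q ^ e"
    proof -
      have eq: "(\<i> * a) * (\<i> * b) * (\<i> * c) * (\<i> * d) * (1 / q) powi (int n - 1) = a * b * c * d * q / q ^ n"
        using assms by (simp add: power_int_diff power_divide field_simps)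
      have "1 / (a * b * c * d * q / q ^ n) = q powi (int n - 1) / (a * b * c * d)"
        using assms by (simp add: power_int_diff field_simps)
      then show ?thesis unfolding eq
        using assms by (subst qpoch_inverse_base) (simp_all add: A2_def e_def)
    qed
    have q3: "qpoch ((\<i> * a) * (\<i> * z)) (1 / q) k = A4 * (a * z) ^ k / q ^ e"
    proof -
      have eq: "(\<i> * a) * (\<i> * z) = - (a * z)"
        by (simp add: algebra_simps)
      show ?thesis unfolding eq
        using assms by (subst qpoch_inverse_base) (simp_all add: A4_def e_def)
    qed
    have q4: "qpoch ((\<i> * a) / (\<i> * z)) (1 / q) k = A3 * (- (a / z)) ^ k / q ^ e"
      using assms by (simp, subst qpoch_inverse_base) (simp_all add: A3_def e_def)
    have q5: "qpoch (1 / q) (1 / q) k = Q * (- (1 / q)) ^ k / q ^ e"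
      using assms by (subst qpoch_inverse_base) (simp_all add: Q_def e_def)
    have q6: "qpoch ((\<i> * a) * (\<i> * t) * (1 / q) ^ k) (1 / q) (n - k)
        = B t * (a * t / q ^ k) ^ l / q ^ f" if "t \<noteq> 0" for t
    proof -
      have eq: "(\<i> * a) * (\<i> * t) * (1 / q) ^ k = - (a * t / q ^ k)"
        by (simp add: power_divide algebra_simps)
      show ?thesis unfolding eq
        using assms that n by (subst qpoch_inverse_base) (simp_all add: B_def f_def)
    qed
    have L: "?L = A1 * (- (q ^ n)) ^ k / q ^ e * (A2 * (- (a * b * c * d * q / q ^ n)) ^ k / q ^ e)
        * (A4 * (a * z) ^ k / q ^ e) * (A3 * (- (a / z)) ^ k / q ^ e)
        / (Q * (- (1 / q)) ^ k / q ^ e) * (1 / q) ^ k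
        * ((B b * (a * b / q ^ k) ^ l / q ^ f) * (B c * (a * c / q ^ k) ^ l / q ^ f)
           * (B d * (a * d / q ^ k) ^ l / q ^ f))"
      unfolding qpochs_def list.map prod_list.Cons prod_list.Nil q1 q2 q3 q4 q5
        q6[OF assms(3)] q6[OF assms(4)] q6[OF assms(5)]
      by (simp only: mult_1_right mult.assoc)
    also have "\<dots> = ((- (q ^ n)) * (- (a * b * c * d * q / q ^ n)) * (a * z) * (- (a / z)) / (- (1 / q)) * (1 / q)) ^ k
          / (q ^ e) ^ 3 * (((a * b / q ^ k) * (a * c / q ^ k) * (a * d / q ^ k)) ^ l / (q ^ f) ^ 3)
        * (A1 * A2 * A3 * A4 / Q * (B b * B c * B d))"
      by (rule collect_powers) (use assms in simp_all)
    also have "(- (q ^ n)) * (- (a * b * c * d * q / q ^ n)) * (a * z) * (- (a / z)) / (- (1 / q)) * (1 / q)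
        = (a ^ 3 * b * c * d) * q"
      using assms by (simp add: power3_eq_cube)
    also have "(a * b / q ^ k) * (a * c / q ^ k) * (a * d / q ^ k) = (a ^ 3 * b * c * d) / (q ^ k) ^ 3"
      by (simp add: power3_eq_cube)
    also have "((a ^ 3 * b * c * d) * q) ^ k / (q ^ e) ^ 3
          * (((a ^ 3 * b * c * d) / (q ^ k) ^ 3) ^ l / (q ^ f) ^ 3)
          * (A1 * A2 * A3 * A4 / Q * (B b * B c * B d))
        = (a ^ 3 * b * c * d) ^ n / q ^ (3 * (n choose 2))
          * (A1 * A2 * A3 * A4 / Q * q ^ k * (B b * B c * B d))"
    proof -
      define u where "u = a ^ 3 * b * c * d"
      define R where "R = A1 * A2 * A3 * A4 / Q"
      define S where "S = B b * B c * B d"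
      have "q ^ (3 * (n choose 2)) = (q ^ e) ^ 3 * (((q ^ k) ^ 3) ^ l * (q ^ f) ^ 3)"
        unfolding ch power_mult[symmetric] power_add[symmetric]
        by (rule arg_cong[where f = "\<lambda>j. q ^ j"]) (simp add: algebra_simps)
      then show ?thesis
        unfolding u_def[symmetric] R_def[symmetric] S_def[symmetric]
        by (simp only: n power_add power_mult_distrib power_divide times_divide_eq_left
            times_divide_eq_right divide_divide_eq_left mult.assoc mult.commute mult.left_commute)
    qed
    also have "\<dots> = ?R"
      by (simp add: qpochs_def A1_def A2_def A3_def A4_def Q_def B_def n mult.assoc)
    finally show ?thesis .
  qed
  have "qinv_askey_wilson n z a b c d q = (-1) ^ n / a ^ n * ((a ^ 3 * b * c * d) ^ n / q ^ (3 * (n choose 2)))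
      * (\<Sum>k\<le>n. qpochs [q powi (- int n), q powi (int n - 1) / (a * b * c * d), z / a, - 1 / (a * z)] q k
             / qpoch q q k * q ^ k
             * qpochs [- (q ^ k) / (a * b), - (q ^ k) / (a * c), - (q ^ k) / (a * d)] q (n - k))"
    unfolding qinv_askey_wilson_def askey_wilson_def
    by (subst sum.cong[OF refl main])
       (simp, simp only: sum_distrib_left[symmetric] mult.assoc[symmetric] pre[unfolded mult.assoc[symmetric]],
        simp add: sum_distrib_left mult.assoc)
  moreover have "(-1) ^ n / a ^ n * ((a ^ 3 * b * c * d) ^ n / q ^ (3 * (n choose 2)))
      = q powi (- 3 * int (n choose 2)) * (- (a\<^sup>2 * b * c * d)) ^ n"
  proof -
    have "(-1) ^ n / a ^ n * (a ^ 3 * b * c * d) ^ n = ((-1) / a * (a ^ 3 * b * c * d)) ^ n"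
      by (simp only: power_mult_distrib power_divide)
    also have "(-1) / a * (a ^ 3 * b * c * d) = - (a\<^sup>2 * b * c * d)"
      using assms by (simp add: power3_eq_cube power2_eq_square)
    finally have 1: "(-1) ^ n / a ^ n * (a ^ 3 * b * c * d) ^ n = (- (a\<^sup>2 * b * c * d)) ^ n" .
    have "q powi (- 3 * int (n choose 2)) = q powi (- int (3 * (n choose 2)))"
      by simp
    then have "q powi (- 3 * int (n choose 2)) = 1 / q ^ (3 * (n choose 2))"
      by (simp only: power_int_minus power_int_of_nat inverse_eq_divide)
    with 1 show ?thesis by simp
  qed
  ultimately show ?thesis by (simp only:)
qed

end

theory Submission
  imports Defs "HOL-Complex_Analysis.Complex_Analysis" "HOL-Probability.Probability"
    "HOL-Real_Asymp.Real_Asymp"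
begin

text \<open>
  Put \<open>x = z - 1/z\<close> and write \<open>w(z;a,b,c,d)\<close> for the summand of \<open>\<Psi>\<close> without the two polynomials, at the node
  \<open>z = q\<^sup>k \<beta>\<close>.  Two facts about this weight carry the proof.

  First, replacing \<open>a\<close> by \<open>a/q\<close> multiplies \<open>w\<close> by \<open>(1 + za)(1 - a/z) = 1 - a\<^sup>2 + ax\<close>.  Hence the polynomials
  \<open>(z/a, -1/(az); q)\<^sub>i\<close>, in which the \<open>q\<^sup>-\<^sup>1\<close>-Askey--Wilson polynomials are expanded, are absorbed
  into the weight by a shift of a parameter, and all moments follow from the total mass
  \<open>M(a,b,c,d)\<close> (\<open>factorial_basis_weight\<close>).

  Second, \<open>((1 - abcd)x - (a + b + c + d + abc + abd + acd + bcd)) w\<close> is a forward difference in \<open>k\<close>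
  (\<open>weight_flux_telescopes\<close>), so that its bilateral sum is 0.  Together the two facts give
  \<open>(1 - qabcd) M(a,b,c,d) = (1 + qab)(1 + qac)(1 + qad) M(qa,b,c,d)\<close>.  Iterating, letting
  \<open>aq\<^sup>n \<rightarrow> 0\<close>, and treating the other parameters in the same way expresses \<open>M\<close> by infinite products and
  \<open>M(0,0,0,0)\<close>, which is a theta series in \<open>\<beta>\<close> (\<open>mass_eq_theta_mass\<close>).  The same identity yields the
  product form of the theta series, because for the parameters \<open>\<beta>, -1/\<beta>, 0, 0\<close> only one node
  carries mass (\<open>theta_mass\<close>).

  For the orthogonality the polynomial of degree \<open>n\<close> is expanded in the basis attached to \<open>a\<close> and integrated
  against the \<open>j\<close>-th element of the basis attached to \<open>b\<close>.  The resulting sum is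
  \<open>\<Sum>\<^sub>i (q\<^sup>-\<^sup>n;q)\<^sub>i/(q;q)\<^sub>i q\<^sup>i f(q\<^sup>i)\<close>, where \<open>f\<close> is a polynomial of degree at most \<open>n - 1\<close> if \<open>j < n\<close>, and has
  one additional simple pole if \<open>j = n\<close>.  The \<open>q\<close>-binomial theorem shows that the sum vanishes in
  the first case, and a partial fraction evaluates it in the second.  The moments that
  occur have parameters \<open>aq\<^sup>-\<^sup>i\<close>, \<open>bq\<^sup>-\<^sup>j\<close> with \<open>i, j \<le> N\<close>; they converge because of the bound on \<open>|abcd|\<close>.

  The integrand at \<open>x + k\<close> is \<open>q^(2x\<^sup>2 - x) \<alpha>^(4x)\<close> times the \<open>k\<close>-th summand of \<open>\<Psi>(q\<^sup>x \<alpha>)\<close>, so the integral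
  over the line unfolds into one over \<open>[0, 1]\<close>.  By the first part, \<open>\<Psi>\<close> is a constant multiple of the theta
  series \<open>M(0,0,0,0)\<close>, and the unfolding for zero parameters, read backwards, turns its
  integral into twice a complex Gaussian integral (\<open>theta_mass_integral\<close>).
\<close>

section \<open>Infinite q-shifted factorials\<close>

lemma qpoch_0 [simp]: "qpoch y q 0 = 1"
  by (simp add: qpoch_def)

lemma qpoch_Suc: "qpoch y q (Suc n) = qpoch y q n * (1 - y * q ^ n)"
  by (simp add: qpoch_def)

lemma qpoch_add: "qpoch y q (m + n) = qpoch y q m * qpoch (y * q ^ m) q n"
  by (induction n) (simp_all add: qpoch_Suc power_add mult.assoc)

lemma qpoch_factors_convergent:
  fixes y q :: complex
  assumes "norm q < 1"
  shows "convergent_prod (\<lambda>j. 1 - y * q ^ j)"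
proof (rule abs_convergent_prod_imp_convergent_prod)
  have "summable (\<lambda>j. norm y * norm q ^ j)"
    using assms by (intro summable_mult summable_geometric) auto
  then show "abs_convergent_prod (\<lambda>j. 1 - y * q ^ j)"
    by (simp add: abs_convergent_prod_conv_summable norm_mult norm_power)
qed

lemma qpoch_LIMSEQ:
  assumes "norm q < 1"
  shows "(\<lambda>n. qpoch y q n) \<longlonglongrightarrow> qpoch_inf y q"
proof -
  have "(\<lambda>n. \<Prod>j\<le>n. 1 - y * q ^ j) \<longlonglongrightarrow> qpoch_inf y q"
    unfolding qpoch_inf_def by (rule convergent_prod_LIMSEQ[OF qpoch_factors_convergent[OF assms]])
  then have "(\<lambda>n. qpoch y q (Suc n)) \<longlonglongrightarrow> qpoch_inf y q"
    by (simp add: qpoch_def lessThan_Suc_atMost)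
  then show ?thesis
    by (rule LIMSEQ_imp_Suc)
qed

lemma qpoch_inf_shift:
  assumes "norm q < 1"
  shows "qpoch_inf y q = (1 - y) * qpoch_inf (y * q) q"
proof (rule LIMSEQ_unique)
  show "(\<lambda>n. qpoch y q (Suc n)) \<longlonglongrightarrow> qpoch_inf y q"
    using qpoch_LIMSEQ[OF assms] by (rule LIMSEQ_Suc)
  have "(\<lambda>n. (1 - y) * qpoch (y * q) q n) \<longlonglongrightarrow> (1 - y) * qpoch_inf (y * q) q"
    by (intro tendsto_intros qpoch_LIMSEQ assms)
  moreover have "qpoch y q (Suc n) = (1 - y) * qpoch (y * q) q n" for n
    using qpoch_add[of y q 1 n] by (simp add: qpoch_def)
  ultimately show "(\<lambda>n. qpoch y q (Suc n)) \<longlonglongrightarrow> (1 - y) * qpoch_inf (y * q) q"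
    by simp
qed

lemma qpoch_inf_0 [simp]: "qpoch_inf 0 q = 1"
  by (simp add: qpoch_inf_def)

lemma qpoch_inf_1:
  assumes "norm q < 1"
  shows "qpoch_inf 1 q = 0"
  by (subst qpoch_inf_shift[OF assms]) simp

lemma qpoch_inf_nonzero:
  assumes "norm q < 1" "norm y < 1"
  shows "qpoch_inf y q \<noteq> 0"
proof -
  have "1 - y * q ^ j \<noteq> 0" for j
  proof
    assume "1 - y * q ^ j = 0"
    then have "norm (y * q ^ j) = 1" by (metis eq_iff_diff_eq_0 norm_one)
    moreover have "norm (y * q ^ j) \<le> norm y * 1"
      unfolding norm_mult norm_power
      using assms by (intro mult_left_mono power_le_one) auto
    ultimately show False using assms by simp
  qed
  then show ?thesis
    unfolding qpoch_inf_def
    using prodinf_nonzero qpoch_factors_convergent[OF assms(1)] by blast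
qed

lemma qpoch_inf_norm_le:
  assumes q: "norm q < 1" and "norm y \<le> r"
  shows "norm (qpoch_inf y q) \<le> exp (r / (1 - norm q))"
proof (rule LIMSEQ_le_const2)
  show "(\<lambda>n. norm (qpoch y q n)) \<longlonglongrightarrow> norm (qpoch_inf y q)"
    by (intro tendsto_intros qpoch_LIMSEQ assms)
  have "norm (qpoch y q n) \<le> exp (r / (1 - norm q))" for n
  proof -
    have "norm (qpoch y q n) = (\<Prod>j<n. norm (1 - y * q ^ j))"
      by (simp add: qpoch_def prod_norm)
    also have "\<dots> \<le> (\<Prod>j<n. 1 + r * norm q ^ j)"
    proof (rule prod_mono, safe)
      fix j
      have "norm (1 - y * q ^ j) \<le> 1 + norm y * norm q ^ j"
        using norm_triangle_ineq4[of 1 "y * q ^ j"] by (simp add: norm_mult norm_power)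
      also have "\<dots> \<le> 1 + r * norm q ^ j"
        using assms by (intro add_mono mult_right_mono) auto
      finally show "norm (1 - y * q ^ j) \<le> 1 + r * norm q ^ j" .
    qed simp
    also have "\<dots> \<le> exp (\<Sum>j<n. r * norm q ^ j)"
      using order_trans[OF norm_ge_zero assms(2)] by (intro prod_le_exp_sum) auto
    also have "(\<Sum>j<n. r * norm q ^ j) \<le> r / (1 - norm q)"
    proof -
      have "(\<Sum>j<n. norm q ^ j) \<le> (\<Sum>j. norm q ^ j)"
        using q by (intro sum_le_suminf summable_geometric) auto
      then have "(\<Sum>j<n. norm q ^ j) \<le> 1 / (1 - norm q)"
        using q by (simp add: suminf_geometric)
      then have "r * (\<Sum>j<n. norm q ^ j) \<le> r * (1 / (1 - norm q))"
        using order_trans[OF norm_ge_zero assms(2)] by (rule mult_left_mono)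
      then show ?thesis by (simp add: sum_distrib_left)
    qed
    finally show ?thesis by simp
  qed
  then show "\<exists>N. \<forall>n\<ge>N. norm (qpoch y q n) \<le> exp (r / (1 - norm q))" by blast
qed

lemma isCont_qpoch_inf:
  assumes q: "norm q < 1"
  shows "isCont (\<lambda>y. qpoch_inf y q) y0"
proof -
  define A where "A = cball (0::complex) (norm y0 + 1)"
  have "uniformly_convergent_on A (\<lambda>n y. \<Prod>j<n. 1 + (- y * q ^ j))"
  proof (rule uniformly_convergent_on_prod)
    show "uniformly_convergent_on A (\<lambda>N y. \<Sum>n<N. norm (- y * q ^ n))"
    proof (rule Weierstrass_m_test')
      show "norm (norm (- y * q ^ n)) \<le> (norm y0 + 1) * norm q ^ n" if "y \<in> A" for n y
        using that by (auto simp: A_def norm_mult norm_power intro!: mult_right_mono)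
      show "summable (\<lambda>n. (norm y0 + 1) * norm q ^ n)"
        using q by (intro summable_mult summable_geometric) auto
    qed
  qed (auto simp: A_def intro!: continuous_intros)
  then obtain l where l: "uniform_limit A (\<lambda>n y. qpoch y q n) l sequentially"
    by (auto simp: uniformly_convergent_on_def qpoch_def)
  have "l y = qpoch_inf y q" if "y \<in> A" for y
    using tendsto_uniform_limitI[OF l that] qpoch_LIMSEQ[OF q] LIMSEQ_unique by blast
  then have "uniform_limit A (\<lambda>n y. qpoch y q n) (\<lambda>y. qpoch_inf y q) sequentially"
    using l by (subst (asm) uniform_limit_cong'[OF refl]) auto
  then have "continuous_on A (\<lambda>y. qpoch_inf y q)"
    by (rule uniform_limit_theorem[rotated])
       (auto simp: qpoch_def intro!: always_eventually continuous_intros)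
  moreover have "y0 \<in> interior A"
    by (auto simp: A_def)
  ultimately show ?thesis
    by (rule continuous_on_interior)
qed

lemma continuous_on_qpoch_inf [continuous_intros]:
  assumes "norm q < 1" "continuous_on S f"
  shows "continuous_on S (\<lambda>x. qpoch_inf (f x) q)"
  by (rule continuous_on_compose2[OF _ assms(2)])
     (auto intro!: continuous_at_imp_continuous_on isCont_qpoch_inf assms)

lemma tendsto_qpoch_inf [tendsto_intros]:
  assumes "norm q < 1" "(f \<longlongrightarrow> y) F"
  shows "((\<lambda>x. qpoch_inf (f x) q) \<longlongrightarrow> qpoch_inf y q) F"
  using isCont_tendsto_compose[OF isCont_qpoch_inf[OF assms(1)] assms(2)] .

section \<open>The weight and its reflection and shift properties\<close>

text \<open>
  The part of the weight that belongs to one parameter \<open>t\<close>; the nodes are \<open>z = q\<^sup>k \<beta>\<close>.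
  The parameter \<open>t = 0\<close>, where the pair is 1, is a legitimate value: the evaluation of the total
  mass moves the parameters to it one after the other.
\<close>

definition wpair :: "complex \<Rightarrow> complex \<Rightarrow> complex \<Rightarrow> complex" where
  "wpair q t z = qpoch_inf (- q * z * t) q * qpoch_inf (q * t / z) q"

definition wcore where
  "wcore a b c d q \<beta> k =
     wpair q a (q powi k * \<beta>) * wpair q b (q powi k * \<beta>) *
     wpair q c (q powi k * \<beta>) * wpair q d (q powi k * \<beta>) *
     (q powi (2 * k\<^sup>2 - k) * \<beta> powi (4 * k))"

definition weight where
  "weight a b c d q \<beta> k = (1 + (q powi k * \<beta>)\<^sup>2) * wcore a b c d q \<beta> k"

text \<open>
  The weight has no closed antidifference, but its product with a suitable polynomial of degree one
  in \<open>z - 1/z\<close> is the forward difference of this function of \<open>k\<close>.  It is the \<open>k\<close>-th term of the weight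
  with all arguments \<open>qzt\<close> replaced by \<open>zt\<close>, with \<open>1/z\<close> in place of \<open>1 + z\<^sup>2\<close>.
\<close>

definition weight_flux where
  "weight_flux a b c d q \<beta> k =
     (1 + q powi k * \<beta> * a) * (1 + q powi k * \<beta> * b) * (1 + q powi k * \<beta> * c) *
     (1 + q powi k * \<beta> * d) / (q powi k * \<beta>) * wcore a b c d q \<beta> k"

text \<open>
  For \<open>k \<ge> 0\<close> the growing part of the weight has the consecutive quotients \<open>q (z - a)(z - b)(z - c)(z - d)\<close>;
  here \<open>|t| \<le> A\<close> and \<open>|z| \<le> B r\<^sup>k\<close>.  The common ratio \<open>s\<close> is kept
  apart from \<open>r\<close> because the antidifference loses one factor \<open>q\<^sup>k\<close> against the weight.
\<close>

definition majorant :: "real \<Rightarrow> real \<Rightarrow> real \<Rightarrow> real \<Rightarrow> real \<Rightarrow> real \<Rightarrow> real \<Rightarrow> nat \<Rightarrow> real" where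
  "majorant s r B A1 A2 A3 A4 k =
     s ^ k * (\<Prod>i<k. (A1 + B * r ^ i) * (A2 + B * r ^ i) * (A3 + B * r ^ i) * (A4 + B * r ^ i))"

locale q_base =
  fixes q :: complex
  assumes q_nonzero [simp]: "q \<noteq> 0" and norm_q: "norm q < 1"
begin

lemma wpair_shift:
  assumes "z \<noteq> 0"
  shows "(1 + q * z * t) * wpair q t (q * z) = (1 - t / z) * wpair q t z"
proof -
  have "qpoch_inf (- q * z * t) q = (1 + q * z * t) * qpoch_inf (- q * (q * z) * t) q"
    by (subst qpoch_inf_shift[OF norm_q]) (simp add: mult_ac)
  moreover have "qpoch_inf (q * t / (q * z)) q = (1 - t / z) * qpoch_inf (q * t / z) q"
    using assms by (subst qpoch_inf_shift[OF norm_q]) (simp add: mult_ac)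
  ultimately show ?thesis
    by (simp add: wpair_def)
qed

lemma wpair_scale_parameter:
  assumes "z \<noteq> 0"
  shows "wpair q t z = (1 + z * (q * t)) * (1 - q * t / z) * wpair q (q * t) z"
proof -
  have "qpoch_inf (- q * z * t) q = (1 + q * z * t) * qpoch_inf (- q * z * (q * t)) q"
    by (subst qpoch_inf_shift[OF norm_q]) (simp add: mult_ac)
  moreover have "qpoch_inf (q * t / z) q = (1 - q * t / z) * qpoch_inf (q * (q * t) / z) q"
    by (subst qpoch_inf_shift[OF norm_q]) (simp add: mult_ac)
  ultimately show ?thesis
    by (simp add: wpair_def mult_ac)
qed

lemma wpair_reflect:
  assumes "z \<noteq> 0"
  shows "wpair q t (- 1 / z) = wpair q t z"
  using assms by (simp add: wpair_def mult_ac)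

lemma gauss_factor_Suc:
  assumes "\<beta> \<noteq> 0"
  shows "q powi (2 * (k + 1)\<^sup>2 - (k + 1)) * \<beta> powi (4 * (k + 1)) =
         q * (q powi k * \<beta>) ^ 4 * (q powi (2 * k\<^sup>2 - k) * \<beta> powi (4 * k))"
proof -
  have e1: "2 * (k + 1)\<^sup>2 - (k + 1) = 1 + k * 4 + (2 * k\<^sup>2 - k)"
    by (simp add: power2_eq_square algebra_simps)
  have e2: "4 * (k + 1) = 4 + 4 * k" by simp
  have "q powi (k * 4) = (q powi k) ^ 4"
    using power_int_mult[of q k 4] by simp
  then have "q powi (1 + k * 4 + (2 * k\<^sup>2 - k)) = q * (q powi k) ^ 4 * q powi (2 * k\<^sup>2 - k)"
    by (simp only: power_int_add[OF disjI1[OF q_nonzero]] power_int_1_right)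
  moreover have "\<beta> powi (4 + 4 * k) = \<beta> ^ 4 * \<beta> powi (4 * k)"
    using assms by (simp add: power_int_add)
  ultimately show ?thesis
    unfolding e1 e2 by (simp add: power_mult_distrib mult_ac)
qed

lemma node_Suc: "q powi (k + 1) * \<beta> = q * (q powi k * \<beta>)"
  by (simp add: power_int_add)

text \<open>
  The Gaussian factor contributes \<open>q z\<^sup>4\<close> under \<open>k \<mapsto> k + 1\<close>, and one \<open>z\<close> for each parameter turns
  \<open>1 - t/z\<close> into \<open>z - t\<close>.
\<close>

lemma wcore_shift:
  assumes "\<beta> \<noteq> 0"
  defines "z \<equiv> \<lambda>k. q powi k * \<beta>"
  shows "(1 + z (k + 1) * a) * (1 + z (k + 1) * b) * (1 + z (k + 1) * c) * (1 + z (k + 1) * d)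
           * wcore a b c d q \<beta> (k + 1)
         = q * ((z k - a) * (z k - b) * (z k - c) * (z k - d)) * wcore a b c d q \<beta> k"
proof -
  define w where "w = z k"
  have w0: "w \<noteq> 0" using assms by (simp add: w_def)
  have zw: "z (k + 1) = q * w" by (simp add: z_def w_def node_Suc)
  define u where "u = q powi (2 * k\<^sup>2 - k) * \<beta> powi (4 * k)"
  have L: "wcore a b c d q \<beta> (k + 1) = wpair q a (q * w) * wpair q b (q * w) * wpair q c (q * w)
           * wpair q d (q * w) * (q * w ^ 4 * u)"
    by (simp only: wcore_def node_Suc gauss_factor_Suc[OF assms(1)] u_def w_def z_def)
  have R: "wcore a b c d q \<beta> k = wpair q a w * wpair q b w * wpair q c w * wpair q d w * u"
    by (simp add: wcore_def u_def w_def z_def)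
  have s: "(1 + q * w * t) * wpair q t (q * w) * w = (w - t) * wpair q t w" for t
    using wpair_shift[OF w0, of t] w0 by (simp add: field_simps)
  have "(1 + q * w * a) * (1 + q * w * b) * (1 + q * w * c) * (1 + q * w * d)
           * wcore a b c d q \<beta> (k + 1)
     = ((1 + q * w * a) * wpair q a (q * w) * w) * ((1 + q * w * b) * wpair q b (q * w) * w)
       * ((1 + q * w * c) * wpair q c (q * w) * w) * ((1 + q * w * d) * wpair q d (q * w) * w)
       * (q * u)"
    unfolding L by (simp add: power4_eq_xxxx mult_ac)
  also have "\<dots> = q * ((w - a) * (w - b) * (w - c) * (w - d)) * wcore a b c d q \<beta> k"
    unfolding s R by (simp add: mult_ac)
  finally show ?thesis by (simp add: zw w_def)
qed

lemma weight_flux_Suc: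
  assumes "\<beta> \<noteq> 0"
  shows "weight_flux a b c d q \<beta> (k + 1) =
    (q powi k * \<beta> - a) * (q powi k * \<beta> - b) * (q powi k * \<beta> - c) * (q powi k * \<beta> - d)
      / (q powi k * \<beta>) * wcore a b c d q \<beta> k"
proof -
  have "weight_flux a b c d q \<beta> (k + 1) =
    (1 + q powi (k + 1) * \<beta> * a) * (1 + q powi (k + 1) * \<beta> * b) * (1 + q powi (k + 1) * \<beta> * c) *
     (1 + q powi (k + 1) * \<beta> * d) * wcore a b c d q \<beta> (k + 1) / (q * (q powi k * \<beta>))"
    by (simp add: weight_flux_def node_Suc)
  also have "\<dots> = q * ((q powi k * \<beta> - a) * (q powi k * \<beta> - b) * (q powi k * \<beta> - c)
      * (q powi k * \<beta> - d)) * wcore a b c d q \<beta> k / (q * (q powi k * \<beta>))"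
    using wcore_shift[OF assms, of k a b c d] by simp
  also have "\<dots> = (q powi k * \<beta> - a) * (q powi k * \<beta> - b) * (q powi k * \<beta> - c)
      * (q powi k * \<beta> - d) / (q powi k * \<beta>) * wcore a b c d q \<beta> k"
    by simp
  finally show ?thesis .
qed

text \<open>
  With \<open>e\<^sub>i\<close> the elementary symmetric functions of the parameters, the difference of the products of the
  \<open>z - t\<close> and of the \<open>1 + zt\<close> is \<open>(1 - e\<^sub>4)(z\<^sup>4 - 1) - (e\<^sub>1 + e\<^sub>3) z (z\<^sup>2 + 1)\<close>.  It is
  divisible by \<open>1 + z\<^sup>2\<close>, which is the reason for this factor in the weight.
\<close>

lemma weight_flux_telescopes:
  assumes "\<beta> \<noteq> 0"
  defines "z \<equiv> \<lambda>k. q powi k * \<beta>"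
  shows "weight_flux a b c d q \<beta> (k + 1) - weight_flux a b c d q \<beta> k =
    ((1 - a * b * c * d) * (z k - 1 / z k)
      - (a + b + c + d + a * b * c + a * b * d + a * c * d + b * c * d)) * weight a b c d q \<beta> k"
proof -
  define w where "w = z k"
  have w0: "w \<noteq> 0" using assms by (simp add: w_def)
  define X where "X = (w - a) * (w - b) * (w - c) * (w - d)"
  define Y where "Y = (1 + w * a) * (1 + w * b) * (1 + w * c) * (1 + w * d)"
  define e13 where
    "e13 = a + b + c + d + a * b * c + a * b * d + a * c * d + b * c * d"
  define e4 where "e4 = a * b * c * d"
  define v where "v = wcore a b c d q \<beta> k"
  have XY: "X - Y = (1 + w\<^sup>2) * ((1 - e4) * (w * w - 1) - w * e13)"
    unfolding X_def Y_def e4_def e13_def by (simp add: algebra_simps power2_eq_square)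
  have "weight_flux a b c d q \<beta> (k + 1) = X / w * v"
    unfolding X_def v_def w_def z_def by (rule weight_flux_Suc[OF assms(1)])
  moreover have "weight_flux a b c d q \<beta> k = Y / w * v"
    unfolding Y_def v_def w_def z_def by (rule weight_flux_def)
  ultimately have "weight_flux a b c d q \<beta> (k + 1) - weight_flux a b c d q \<beta> k = (X - Y) / w * v"
    by (simp add: diff_divide_distrib left_diff_distrib)
  also have "(X - Y) / w = (1 + w\<^sup>2) * ((1 - e4) * (w - 1 / w) - e13)"
  proof -
    have "(w * w - 1) / w = w - 1 / w" using w0 by (simp add: field_simps)
    then have "((1 - e4) * (w * w - 1) - w * e13) / w = (1 - e4) * (w - 1 / w) - e13"
      unfolding diff_divide_distrib[of _ _ w] times_divide_eq_right[symmetric] using w0 by simp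
    then show ?thesis unfolding XY times_divide_eq_right[symmetric] by simp
  qed
  also have "\<dots> * v = ((1 - e4) * (w - 1 / w) - e13) * ((1 + w\<^sup>2) * v)"
    by (simp only: mult_ac)
  finally show ?thesis
    by (simp only: e4_def e13_def v_def w_def z_def weight_def)
qed

text \<open>
  The pairs are invariant under \<open>z \<mapsto> -1/z\<close>, which exchanges the two ends of the lattice.  This
  and its consequences for the weight and its antidifference reduce every estimate for \<open>k \<rightarrow> -\<infinity>\<close> to one for \<open>k \<rightarrow> \<infinity>\<close>.
\<close>

lemma wcore_reflect:
  assumes "\<beta> \<noteq> 0"
  shows "q powi (2 * k) * wcore a b c d q (- 1 / \<beta>) k = wcore a b c d q \<beta> (- k)"
proof -
  have z: "q powi k * (- 1 / \<beta>) = - 1 / (q powi (- k) * \<beta>)"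
    by (simp add: power_int_minus field_simps)
  have n: "q powi (- k) * \<beta> \<noteq> 0" using assms by simp
  have b: "(- 1 / \<beta>) powi (4 * k) = \<beta> powi (4 * - k)"
  proof -
    have "(- 1 / \<beta>) powi (4 * k) = ((- 1 / \<beta>) ^ 4) powi k"
      using power_int_mult[of "- 1 / \<beta>" 4 k] by simp
    also have "(- 1 / \<beta>) ^ 4 = \<beta> powi (- 4)"
      by (simp add: power_divide power_int_minus field_simps)
    also have "(\<beta> powi (- 4)) powi k = \<beta> powi (4 * - k)"
      by (simp flip: power_int_mult)
    finally show ?thesis .
  qed
  have e: "2 * (- k)\<^sup>2 - (- k) = 2 * k + (2 * k\<^sup>2 - k)" by simp
  have "q powi (2 * (- k)\<^sup>2 - (- k)) = q powi (2 * k) * q powi (2 * k\<^sup>2 - k)"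
    unfolding e by (subst power_int_add) auto
  then show ?thesis
    unfolding wcore_def z wpair_reflect[OF n] b by (simp only: mult_ac)
qed

lemma power_int_double: "q powi (2 * k) = (q powi k)\<^sup>2"
  using power_int_mult[of q k 2] by (simp add: mult.commute)

lemma weight_reflect:
  assumes "\<beta> \<noteq> 0"
  shows "\<beta>\<^sup>2 * weight a b c d q (- 1 / \<beta>) k = weight a b c d q \<beta> (- k)"
proof -
  define p where "p = q powi k"
  have p: "p \<noteq> 0" "q powi (- k) = 1 / p" "q powi (2 * k) = p\<^sup>2"
    by (auto simp: p_def power_int_minus power_int_double divide_inverse)
  define w where "w = wcore a b c d q (- 1 / \<beta>) k"
  have "\<beta>\<^sup>2 * (1 + (p * (- 1 / \<beta>))\<^sup>2) = \<beta>\<^sup>2 + p\<^sup>2"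
    using assms by (simp add: power_divide power_mult_distrib distrib_left)
  moreover have "(1 + (1 / p * \<beta>)\<^sup>2) * p\<^sup>2 = \<beta>\<^sup>2 + p\<^sup>2"
    using p(1) by (simp add: power_divide power_mult_distrib distrib_right)
  ultimately have "\<beta>\<^sup>2 * (1 + (p * (- 1 / \<beta>))\<^sup>2) * w = (1 + (1 / p * \<beta>)\<^sup>2) * p\<^sup>2 * w"
    by simp
  then show ?thesis
    unfolding weight_def wcore_reflect[OF assms, symmetric] p_def[symmetric] p(2,3) w_def
    by (simp only: mult.assoc)
qed

lemma weight_flux_reflect:
  assumes "\<beta> \<noteq> 0"
  shows "weight_flux a b c d q \<beta> (- k) = - (\<beta>\<^sup>2) * weight_flux a b c d q (- 1 / \<beta>) (k + 1)"
proof -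
  define w where "w = q powi (- k) * \<beta>"
  have w0: "w \<noteq> 0" using assms by (simp add: w_def)
  have z: "q powi k * (- 1 / \<beta>) = - 1 / w"
    by (simp add: w_def power_int_minus field_simps)
  have w2: "w\<^sup>2 * q powi (2 * k) = \<beta>\<^sup>2"
    by (simp add: w_def power_int_minus power_int_double power_mult_distrib divide_inverse power_inverse)
  have n: "- 1 / \<beta> \<noteq> 0" using assms by simp
  define v where "v = wcore a b c d q (- 1 / \<beta>) k"
  have "- (\<beta>\<^sup>2) * weight_flux a b c d q (- 1 / \<beta>) (k + 1) =
     - (w\<^sup>2 * q powi (2 * k)) * ((- 1 / w - a) * (- 1 / w - b) * (- 1 / w - c) * (- 1 / w - d)
          / (- 1 / w) * v)"
    unfolding weight_flux_Suc[OF n] z w2 v_def by simp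
  also have "\<dots> = ((1 + w * a) * (1 + w * b) * (1 + w * c) * (1 + w * d) / w)
      * (q powi (2 * k) * v)"
  proof -
    have "- 1 / w - t = - (1 + w * t) / w" for t using w0 by (simp add: field_simps)
    moreover have "- (w\<^sup>2 * P) * ((- x1 / w) * (- x2 / w) * (- x3 / w) * (- x4 / w) / (- 1 / w) * v)
        = x1 * x2 * x3 * x4 / w * (P * v)" for x1 x2 x3 x4 P
      using w0 by (simp add: power2_eq_square)
    ultimately show ?thesis by (simp only:)
  qed
  also have "\<dots> = weight_flux a b c d q \<beta> (- k)"
    unfolding v_def wcore_reflect[OF assms] weight_flux_def w_def by simp
  finally show ?thesis ..
qed

end

section \<open>Majorants and absolute summability\<close>

lemma majorant_nonneg:
  assumes "0 \<le> s" "0 \<le> r" "0 \<le> B" "0 \<le> A1" "0 \<le> A2" "0 \<le> A3" "0 \<le> A4"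
  shows "0 \<le> majorant s r B A1 A2 A3 A4 k"
  unfolding majorant_def using assms by (intro mult_nonneg_nonneg prod_nonneg) auto

lemma majorant_Suc:
  "majorant s r B A1 A2 A3 A4 (Suc k) =
     s * ((A1 + B * r ^ k) * (A2 + B * r ^ k) * (A3 + B * r ^ k) * (A4 + B * r ^ k))
       * majorant s r B A1 A2 A3 A4 k"
  by (simp add: majorant_def)

text \<open>
  Ratio test: the quotient of consecutive terms tends to \<open>s A1 A2 A3 A4\<close>.
\<close>

lemma majorant_summable:
  assumes nn: "0 \<le> s" "0 \<le> r" "0 \<le> B" "0 \<le> A1" "0 \<le> A2" "0 \<le> A3" "0 \<le> A4"
    and "r < 1" and lt: "s * (A1 * A2 * A3 * A4) < 1"
  shows "summable (majorant s r B A1 A2 A3 A4)"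
proof -
  define R where "R = (\<lambda>k. s * ((A1 + B * r ^ k) * (A2 + B * r ^ k) * (A3 + B * r ^ k) * (A4 + B * r ^ k)))"
  have "(\<lambda>k. r ^ k) \<longlonglongrightarrow> 0" using assms by (intro LIMSEQ_realpow_zero) auto
  then have "R \<longlonglongrightarrow> s * ((A1 + B * 0) * (A2 + B * 0) * (A3 + B * 0) * (A4 + B * 0))"
    unfolding R_def by (intro tendsto_intros) (use assms in auto)
  then have lim: "R \<longlonglongrightarrow> s * (A1 * A2 * A3 * A4)" by simp
  obtain e where e: "s * (A1 * A2 * A3 * A4) < e" "e < 1" using dense[OF lt] by blast
  from order_tendstoD(2)[OF lim e(1)] obtain N where N: "\<And>n. n \<ge> N \<Longrightarrow> R n < e"
    by (auto simp: eventually_sequentially)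
  show ?thesis
  proof (rule summable_ratio_test[OF e(2)])
    fix n assume "N \<le> n"
    have m0: "0 \<le> majorant s r B A1 A2 A3 A4 n" by (rule majorant_nonneg[OF nn])
    have "0 \<le> R n" using nn by (auto simp: R_def intro!: mult_nonneg_nonneg add_nonneg_nonneg)
    moreover have "majorant s r B A1 A2 A3 A4 (Suc n) = R n * majorant s r B A1 A2 A3 A4 n"
      by (simp add: majorant_Suc R_def)
    ultimately show "norm (majorant s r B A1 A2 A3 A4 (Suc n)) \<le> e * norm (majorant s r B A1 A2 A3 A4 n)"
      using m0 N[OF \<open>N \<le> n\<close>] by (simp add: mult_right_mono)
  qed
qed

lemma summable_on_int_of_summable_nat:
  fixes f :: "nat \<Rightarrow> real"
  assumes "\<And>n. 0 \<le> f n" "summable f"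
  shows "(\<lambda>k::int. f (nat \<bar>k\<bar>)) summable_on UNIV"
proof -
  have f: "f summable_on UNIV"
    using assms by (simp add: summable_on_UNIV_nonneg_real_iff)
  have "(\<lambda>k::int. f (nat \<bar>k\<bar>)) summable_on {0..}"
    using f by (subst summable_on_reindex_bij_witness[of _ int nat UNIV f]) auto
  moreover have "(\<lambda>k::int. f (nat \<bar>k\<bar>)) summable_on {..0}"
    using f by (subst summable_on_reindex_bij_witness[of _ "\<lambda>n. - int n" "\<lambda>k. nat (- k)" UNIV f]) auto
  ultimately have "(\<lambda>k::int. f (nat \<bar>k\<bar>)) summable_on ({0..} \<union> {..0})"
    by (rule summable_on_union)
  moreover have "({0..} \<union> {..0}) = (UNIV :: int set)" by auto
  ultimately show ?thesis by simp
qed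

context q_base
begin

lemma norm_node_le:
  assumes "norm \<beta> \<le> B"
  shows "norm (q powi int k * \<beta>) \<le> B * norm q ^ k"
  using assms by (simp add: norm_mult norm_power mult.commute mult_left_mono)

text \<open>
  Iterating the shift formula would divide by the factors \<open>1 + qzt\<close>, which may vanish.  So only the
  factors \<open>(qt/z;q)\<^sub>\<infinity>\<close>, which grow, are treated by recursion; the factors \<open>(-qzt;q)\<^sub>\<infinity>\<close>
  stay bounded for \<open>k \<ge> 0\<close>.
\<close>

lemma wcore_majorant:
  assumes A: "norm a \<le> A1" "norm b \<le> A2" "norm c \<le> A3" "norm d \<le> A4"
    and B: "\<beta> \<noteq> 0" "norm \<beta> \<le> B" "1 / norm \<beta> \<le> B"
  defines "r \<equiv> norm q"
  shows "norm (wcore a b c d q \<beta> (int k)) \<le>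
    exp (2 * r * B * (A1 + A2 + A3 + A4) / (1 - r)) * majorant r r B A1 A2 A3 A4 k"
proof -
  define z where "z = (\<lambda>k. q powi int k * \<beta>)"
  have r: "0 \<le> r" "r < 1" "1 - r > 0" using norm_q by (auto simp: r_def)
  have Bp: "0 \<le> B" using B by (meson norm_ge_zero order_trans)
  have A0: "0 \<le> A1" "0 \<le> A2" "0 \<le> A3" "0 \<le> A4" using A norm_ge_zero order_trans by blast+
  have z0: "z k \<noteq> 0" for k using B by (simp add: z_def)
  have zS: "z (Suc k) = q * z k" for k
    by (simp add: z_def)
  have zn: "norm (z k) \<le> B * r ^ k" for k
    unfolding z_def r_def by (rule norm_node_le[OF B(2)])
  define w where "w = (\<lambda>k. q powi (2 * (int k)\<^sup>2 - int k) * \<beta> powi (4 * int k))"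
  define h where "h = (\<lambda>t k. qpoch_inf (q * t / z k) q)"
  define G where "G = (\<lambda>k. h a k * h b k * h c k * h d k * w k)"
  have hS: "h t (Suc k) * z k = (z k - t) * h t k" for t k
  proof -
    have "h t (Suc k) = (1 - t / z k) * h t k"
      unfolding h_def zS using z0[of k]
      by (subst qpoch_inf_shift[OF norm_q]) (simp add: mult_ac)
    then show ?thesis using z0[of k] by (simp add: field_simps)
  qed
  have wS: "w (Suc k) = q * z k ^ 4 * w k" for k
    using gauss_factor_Suc[OF B(1), of "int k"] unfolding w_def z_def
    by (simp add: add.commute)
  have GS: "G (Suc k) = q * ((z k - a) * (z k - b) * (z k - c) * (z k - d)) * G k" for k
  proof -
    have "G (Suc k) = q * ((h a (Suc k) * z k) * (h b (Suc k) * z k) * (h c (Suc k) * z k)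
        * (h d (Suc k) * z k)) * w k"
      unfolding G_def wS by (simp add: power4_eq_xxxx mult_ac)
    then show ?thesis unfolding hS G_def by (simp add: mult_ac)
  qed
  define e where "e = (\<lambda>A. exp (r * B * A / (1 - r)))"
  have h0: "norm (h t 0) \<le> e A" if "norm t \<le> A" for t A
  proof -
    have "norm (q * t / z 0) \<le> r * B * A"
    proof -
      have "norm (q * t / z 0) = r * (1 / norm \<beta>) * norm t"
        by (simp add: z_def r_def norm_mult norm_divide)
      also have "\<dots> \<le> r * B * A"
        using B r that Bp by (intro mult_mono) auto
      finally show ?thesis .
    qed
    then show ?thesis unfolding h_def r_def e_def by (rule qpoch_inf_norm_le[OF norm_q])
  qed
  have hp: "norm (qpoch_inf (- q * z k * t) q) \<le> e A" if "norm t \<le> A" for t A k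
  proof -
    have "norm (z k) \<le> B"
      using zn[of k] mult_left_mono[OF power_le_one[of r k] Bp] r by simp
    then have "norm (- q * z k * t) \<le> r * B * A"
      unfolding norm_mult using that r Bp by (intro mult_mono) (auto simp: r_def)
    then show ?thesis unfolding r_def e_def by (rule qpoch_inf_norm_le[OF norm_q])
  qed
  have G: "norm (G k) \<le> (e A1 * e A2 * e A3 * e A4) * majorant r r B A1 A2 A3 A4 k" for k
  proof (induction k)
    case 0
    have "norm (G 0) \<le> e A1 * e A2 * e A3 * e A4 * 1"
      unfolding G_def norm_mult
      by (intro mult_mono h0 A) (auto simp: w_def e_def)
    then show ?case by (simp add: majorant_def)
  next
    case (Suc k)
    have d: "norm (z k - t) \<le> A + B * r ^ k" if "norm t \<le> A" for t A
      using norm_triangle_ineq4[of "z k" t] zn[of k] that by linarith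
    have "norm (G (Suc k)) = r * (norm (z k - a) * norm (z k - b) * norm (z k - c) * norm (z k - d))
        * norm (G k)"
      unfolding GS norm_mult r_def ..
    also have "\<dots> \<le> r * ((A1 + B * r ^ k) * (A2 + B * r ^ k) * (A3 + B * r ^ k) * (A4 + B * r ^ k))
        * ((e A1 * e A2 * e A3 * e A4) * majorant r r B A1 A2 A3 A4 k)"
      using r Bp A0 by (intro mult_mono d A Suc.IH mult_nonneg_nonneg add_nonneg_nonneg) auto
    also have "\<dots> = (e A1 * e A2 * e A3 * e A4) * majorant r r B A1 A2 A3 A4 (Suc k)"
      unfolding majorant_Suc by (simp add: mult_ac)
    finally show ?case .
  qed
  have "wcore a b c d q \<beta> (int k) = qpoch_inf (- q * z k * a) q * qpoch_inf (- q * z k * b) q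
      * qpoch_inf (- q * z k * c) q * qpoch_inf (- q * z k * d) q * G k"
    unfolding wcore_def wpair_def G_def h_def w_def z_def by (simp only: mult_ac)
  moreover have "norm (qpoch_inf (- q * z k * a) q * qpoch_inf (- q * z k * b) q
      * qpoch_inf (- q * z k * c) q * qpoch_inf (- q * z k * d) q * G k)
     \<le> e A1 * e A2 * e A3 * e A4 *
     ((e A1 * e A2 * e A3 * e A4) * majorant r r B A1 A2 A3 A4 k)"
    unfolding norm_mult
    by (intro mult_mono hp A G)
       (auto simp: e_def intro!: mult_nonneg_nonneg)
  ultimately have "norm (wcore a b c d q \<beta> (int k)) \<le> e A1 * e A2 * e A3 * e A4 *
     ((e A1 * e A2 * e A3 * e A4) * majorant r r B A1 A2 A3 A4 k)"
    by (simp only:)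
  also have "\<dots> = exp (2 * r * B * (A1 + A2 + A3 + A4) / (1 - r)) * majorant r r B A1 A2 A3 A4 k"
  proof -
    have "e A1 * e A2 * e A3 * e A4 * (e A1 * e A2 * e A3 * e A4)
       = exp (2 * r * B * (A1 + A2 + A3 + A4) / (1 - r))"
      unfolding e_def exp_add[symmetric] using r
      by (simp add: add_divide_distrib[symmetric] algebra_simps)
    then show ?thesis by (metis mult.assoc)
  qed
  finally show ?thesis .
qed

lemma reflected_argument_bounds:
  fixes \<beta> :: complex
  assumes "norm \<beta> \<le> B" "1 / norm \<beta> \<le> B"
  shows "norm (- 1 / \<beta>) \<le> B" "1 / norm (- 1 / \<beta>) \<le> B"
  using assms by (auto simp: norm_divide)

text \<open>
  One summable majorant serves all parameters of bounded modulus and all \<open>\<beta>\<close> in an annulus.  The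
  uniformity in the parameters justifies the limit in which a parameter tends to 0; the uniformity in
  \<open>\<beta>\<close> is what the integral over a period needs.
\<close>

lemma weight_majorant:
  assumes lt: "norm q * (A1 * A2 * A3 * A4) < 1"
    and nn: "0 \<le> A1" "0 \<le> A2" "0 \<le> A3" "0 \<le> A4" "0 \<le> B"
  obtains U :: "int \<Rightarrow> real" where "U summable_on UNIV"
    and "\<And>a b c d \<beta> k. norm a \<le> A1 \<Longrightarrow> norm b \<le> A2 \<Longrightarrow> norm c \<le> A3 \<Longrightarrow> norm d \<le> A4
      \<Longrightarrow> \<beta> \<noteq> 0 \<Longrightarrow> norm \<beta> \<le> B \<Longrightarrow> 1 / norm \<beta> \<le> B \<Longrightarrow> norm (weight a b c d q \<beta> k) \<le> U k"
proof -
  define r where "r = norm q"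
  have r: "0 \<le> r" "r < 1" using norm_q by (auto simp: r_def)
  define M where "M = majorant r r B A1 A2 A3 A4"
  define K where "K = exp (2 * r * B * (A1 + A2 + A3 + A4) / (1 - r))"
  have M0: "0 \<le> M k" for k unfolding M_def by (intro majorant_nonneg r nn)
  define U where "U = (\<lambda>k::int. (1 + B\<^sup>2) * ((1 + B\<^sup>2) * (K * M (nat \<bar>k\<bar>))))"
  have "U summable_on UNIV"
    unfolding U_def
    by (intro summable_on_cmult_right summable_on_int_of_summable_nat M0)
       (unfold M_def, intro majorant_summable r nn lt[folded r_def])
  moreover have "norm (weight a b c d q \<beta> k) \<le> U k"
    if A: "norm a \<le> A1" "norm b \<le> A2" "norm c \<le> A3" "norm d \<le> A4"
      and B: "\<beta> \<noteq> 0" "norm \<beta> \<le> B" "1 / norm \<beta> \<le> B" for a b c d \<beta> k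
  proof -
    have nat: "norm (weight a b c d q \<gamma> (int k)) \<le> (1 + B\<^sup>2) * (K * M k)"
      if G: "\<gamma> \<noteq> 0" "norm \<gamma> \<le> B" "1 / norm \<gamma> \<le> B" for \<gamma> k
    proof -
      have "norm (q powi int k * \<gamma>) \<le> B"
        using norm_node_le[OF G(2), of k] mult_left_mono[OF power_le_one[of r k] nn(5)] r
        by (simp add: r_def)
      then have "norm ((q powi int k * \<gamma>)\<^sup>2) \<le> B\<^sup>2"
        unfolding norm_power by (rule power_mono) simp
      then have "norm (1 + (q powi int k * \<gamma>)\<^sup>2) \<le> 1 + B\<^sup>2"
        using norm_triangle_ineq[of 1 "(q powi int k * \<gamma>)\<^sup>2"] by simp
      then show ?thesis
        unfolding weight_def norm_mult K_def M_def r_def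
        by (intro mult_mono wcore_majorant A G) auto
    qed
    have KM: "0 \<le> (1 + B\<^sup>2) * (K * M n)" for n
      using M0 by (intro mult_nonneg_nonneg) (auto simp: K_def)
    show ?thesis
    proof (cases "k \<ge> 0")
      case True
      then have "norm (weight a b c d q \<beta> k) \<le> (1 + B\<^sup>2) * (K * M (nat \<bar>k\<bar>))"
        using nat[OF B, of "nat k"] by simp
      also have "\<dots> \<le> U k"
        unfolding U_def using KM[of "nat \<bar>k\<bar>"] mult_right_mono[of 1 "1 + B\<^sup>2"] by simp
      finally show ?thesis .
    next
      case False
      define j where "j = nat (- k)"
      have j: "k = - int j" "nat \<bar>k\<bar> = j" using False by (auto simp: j_def)
      have "norm (weight a b c d q \<beta> k) = (norm \<beta>)\<^sup>2 * norm (weight a b c d q (- 1 / \<beta>) (int j))"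
        unfolding j using weight_reflect[OF B(1), of a b c d "int j", symmetric]
        by (simp add: norm_mult norm_power)
      also have "\<dots> \<le> B\<^sup>2 * ((1 + B\<^sup>2) * (K * M j))"
        by (intro mult_mono power_mono B nat reflected_argument_bounds) (use B in auto)
      also have "\<dots> \<le> U k"
        unfolding U_def j(2) using KM[of j] by (intro mult_right_mono) auto
      finally show ?thesis .
    qed
  qed
  ultimately show ?thesis by (rule that)
qed

lemma weight_abs_summable:
  assumes "norm (q * a * b * c * d) < 1" "\<beta> \<noteq> 0"
  shows "(\<lambda>k. norm (weight a b c d q \<beta> k)) summable_on UNIV"
proof -
  have "norm q * (norm a * norm b * norm c * norm d) < 1"
    using assms by (simp add: norm_mult mult_ac)
  then show ?thesis
  proof (rule weight_majorant[where B = "max (norm \<beta>) (1 / norm \<beta>)"])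
    fix U :: "int \<Rightarrow> real"
    assume "U summable_on UNIV" and U: "\<And>a' b' c' d' \<beta>' k. norm a' \<le> norm a \<Longrightarrow> norm b' \<le> norm b
      \<Longrightarrow> norm c' \<le> norm c \<Longrightarrow> norm d' \<le> norm d \<Longrightarrow> \<beta>' \<noteq> 0
      \<Longrightarrow> norm \<beta>' \<le> max (norm \<beta>) (1 / norm \<beta>) \<Longrightarrow> 1 / norm \<beta>' \<le> max (norm \<beta>) (1 / norm \<beta>)
      \<Longrightarrow> norm (weight a' b' c' d' q \<beta>' k) \<le> U k"
    have "norm (weight a b c d q \<beta> k) \<le> U k" for k
      by (rule U) (use assms(2) in auto)
    then show ?thesis
      by (intro summable_on_comparison_test[OF \<open>U summable_on UNIV\<close>]) auto
  qed (auto simp: le_max_iff_disj)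
qed

lemma weight_summable:
  assumes "norm (q * a * b * c * d) < 1" "\<beta> \<noteq> 0"
  shows "weight a b c d q \<beta> summable_on UNIV"
  using abs_summable_summable[OF weight_abs_summable[OF assms]] .

text \<open>
  The factor \<open>1/z\<close> costs \<open>q\<^sup>-\<^sup>k\<close>, so the condition is \<open>|abcd| < 1\<close> instead of \<open>|qabcd| < 1\<close>.
\<close>

lemma weight_flux_summable:
  assumes lt: "norm (a * b * c * d) < 1" and "\<beta> \<noteq> 0"
  shows "weight_flux a b c d q \<beta> summable_on UNIV"
proof -
  define r where "r = norm q"
  have r: "0 \<le> r" "r < 1" "r > 0" using norm_q by (auto simp: r_def)
  define B where "B = max (norm \<beta>) (1 / norm \<beta>)"
  have B: "norm \<beta> \<le> B" "1 / norm \<beta> \<le> B" "0 \<le> B"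
    by (auto simp: B_def le_max_iff_disj)
  define M where "M = majorant 1 r B (norm a) (norm b) (norm c) (norm d)"
  define K where "K = exp (2 * r * B * (norm a + norm b + norm c + norm d) / (1 - r))"
  define L where "L = (1 + B * norm a) * (1 + B * norm b) * (1 + B * norm c) * (1 + B * norm d) * B * K"
  have M0: "0 \<le> M k" for k unfolding M_def by (intro majorant_nonneg r B) auto
  have M: "summable M"
    unfolding M_def using lt by (intro majorant_summable r B) (auto simp: norm_mult)
  have L0: "0 \<le> L" unfolding L_def K_def using B by (intro mult_nonneg_nonneg) auto
  have nat: "norm (weight_flux a b c d q \<gamma> (int k)) \<le> L * M k"
    if G: "\<gamma> \<noteq> 0" "norm \<gamma> \<le> B" "1 / norm \<gamma> \<le> B" for \<gamma> k
  proof -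
    define z where "z = q powi int k * \<gamma>"
    have zB: "norm z \<le> B"
      using norm_node_le[OF G(2), of k] mult_left_mono[OF power_le_one[of r k] B(3)] r
      by (simp add: r_def z_def)
    have t: "norm (1 + z * t) \<le> 1 + B * norm t" for t
      using norm_triangle_ineq[of 1 "z * t"] mult_right_mono[OF zB norm_ge_zero[of t]]
      by (simp add: norm_mult)
    have "norm (1 / z) = 1 / norm \<gamma> * (1 / r ^ k)"
      by (simp add: z_def norm_divide norm_mult norm_power r_def)
    also have "\<dots> \<le> B * (1 / r ^ k)"
      using G r by (intro mult_right_mono) auto
    finally have zi: "norm (1 / z) \<le> B * (1 / r ^ k)" .
    have "weight_flux a b c d q \<gamma> (int k) = (1 + z * a) * (1 + z * b) * (1 + z * c) * (1 + z * d)
       * (1 / z) * wcore a b c d q \<gamma> (int k)"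
      by (simp add: weight_flux_def z_def)
    moreover have "norm ((1 + z * a) * (1 + z * b) * (1 + z * c) * (1 + z * d)
       * (1 / z) * wcore a b c d q \<gamma> (int k)) \<le>
      (1 + B * norm a) * (1 + B * norm b) * (1 + B * norm c) * (1 + B * norm d)
       * (B * (1 / r ^ k)) * (K * majorant r r B (norm a) (norm b) (norm c) (norm d) k)"
      unfolding norm_mult K_def r_def
      by (intro mult_mono t zi[unfolded r_def] wcore_majorant G order_refl)
         (use B(3) in \<open>auto intro!: mult_nonneg_nonneg\<close>)
    ultimately have "norm (weight_flux a b c d q \<gamma> (int k)) \<le>
      (1 + B * norm a) * (1 + B * norm b) * (1 + B * norm c) * (1 + B * norm d)
       * (B * (1 / r ^ k)) * (K * majorant r r B (norm a) (norm b) (norm c) (norm d) k)"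
      by simp
    also have "\<dots> = L * M k"
      unfolding L_def M_def majorant_def using r by (simp add: field_simps)
    finally show ?thesis .
  qed
  have neg: "norm (weight_flux a b c d q \<beta> (- int k)) \<le> B\<^sup>2 * (L * M (Suc k))" for k
  proof -
    have "norm (weight_flux a b c d q \<beta> (- int k)) =
       (norm \<beta>)\<^sup>2 * norm (weight_flux a b c d q (- 1 / \<beta>) (int (Suc k)))"
      unfolding weight_flux_reflect[OF assms(2)] by (simp add: norm_mult norm_power add.commute)
    also have "\<dots> \<le> B\<^sup>2 * (L * M (Suc k))"
      by (intro mult_mono power_mono B nat reflected_argument_bounds) (use assms B in auto)
    finally show ?thesis .
  qed
  define f where "f = (\<lambda>k. L * M k + B\<^sup>2 * (L * M (Suc k)))"
  have f0: "0 \<le> f k" for k unfolding f_def using M0 L0 by (intro add_nonneg_nonneg mult_nonneg_nonneg) auto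
  have "summable f" unfolding f_def
    by (intro summable_add summable_mult M) (subst summable_Suc_iff, rule M)
  then have "(\<lambda>k::int. f (nat \<bar>k\<bar>)) summable_on UNIV"
    by (intro summable_on_int_of_summable_nat f0)
  moreover have "norm (weight_flux a b c d q \<beta> k) \<le> f (nat \<bar>k\<bar>)" for k
  proof (cases "k \<ge> 0")
    case True
    then have "norm (weight_flux a b c d q \<beta> k) \<le> L * M (nat \<bar>k\<bar>)"
      using nat[OF assms(2) B(1,2), of "nat k"] by simp
    moreover have "0 \<le> B\<^sup>2 * (L * M (Suc (nat \<bar>k\<bar>)))"
      using M0 L0 by (intro mult_nonneg_nonneg) auto
    ultimately show ?thesis unfolding f_def by linarith
  next
    case False
    then have "norm (weight_flux a b c d q \<beta> k) \<le> B\<^sup>2 * (L * M (Suc (nat \<bar>k\<bar>)))"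
      using neg[of "nat (- k)"] by simp
    moreover have "0 \<le> L * M (nat \<bar>k\<bar>)"
      using M0 L0 by (intro mult_nonneg_nonneg) auto
    ultimately show ?thesis unfolding f_def by linarith
  qed
  ultimately have "(\<lambda>k. norm (weight_flux a b c d q \<beta> k)) summable_on UNIV"
    by (rule summable_on_comparison_test) auto
  then show ?thesis by (rule abs_summable_summable)
qed

end

section \<open>The total mass of the weight\<close>

lemma infsum_int_eq_suminf:
  fixes f :: "int \<Rightarrow> complex"
  assumes "(\<lambda>k. norm (f k)) summable_on UNIV"
  shows "infsum f UNIV = (\<Sum>n. f (int_decode n))" "summable (\<lambda>n. norm (f (int_decode n)))"
proof -
  have bij: "bij_betw int_decode UNIV UNIV" by (rule bij_int_decode)
  have "(\<lambda>n. norm (f (int_decode n))) summable_on UNIV"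
    using summable_on_reindex_bij_betw[OF bij, of "\<lambda>k. norm (f k)"] assms by simp
  then show *: "summable (\<lambda>n. norm (f (int_decode n)))"
    by (rule summable_on_imp_summable)
  have "((\<lambda>n. f (int_decode n)) has_sum (\<Sum>n. f (int_decode n))) UNIV"
    by (rule norm_summable_imp_has_sum[OF *]) (use * in \<open>auto intro: summable_norm_cancel\<close>)
  then show "infsum f UNIV = (\<Sum>n. f (int_decode n))"
    using infsum_reindex_bij_betw[OF bij, of f] by (simp add: infsumI)
qed

definition mass where
  "mass a b c d q \<beta> = infsum (weight a b c d q \<beta>) UNIV"

lemma mass_swap:
  "mass b a c d q \<beta> = mass a b c d q \<beta>"
  "mass a c b d q \<beta> = mass a b c d q \<beta>"
  "mass a b d c q \<beta> = mass a b c d q \<beta>"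
  unfolding mass_def weight_def[abs_def] wcore_def by (simp_all add: mult_ac)

context q_base
begin

text \<open>
  A bilateral sum of the forward differences of a summable function is 0.
\<close>

lemma first_moment:
  assumes "norm (a * b * c * d) < 1" "\<beta> \<noteq> 0"
  shows "((\<lambda>k. ((1 - a * b * c * d) * (q powi k * \<beta> - 1 / (q powi k * \<beta>))
      - (a + b + c + d + a * b * c + a * b * d + a * c * d + b * c * d)) * weight a b c d q \<beta> k)
      has_sum 0) UNIV"
proof -
  define g where "g = weight_flux a b c d q \<beta>"
  have g: "(g has_sum infsum g UNIV) UNIV"
    unfolding g_def using weight_flux_summable[OF assms] by simp
  have "((\<lambda>k. g (k + 1)) has_sum infsum g UNIV) UNIV"
    using g by (subst has_sum_reindex_bij_witness[of UNIV "\<lambda>k. k - 1" "\<lambda>k. k + 1" UNIV g]) auto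
  then have "((\<lambda>k. g (k + 1) + (- 1) * g k) has_sum (infsum g UNIV + (- 1) * infsum g UNIV)) UNIV"
    by (intro has_sum_add has_sum_cmult_right g)
  then show ?thesis
    unfolding g_def weight_flux_telescopes[OF assms(2), symmetric] by simp
qed

lemma weight_scale_parameter:
  assumes "\<beta> \<noteq> 0"
  shows "weight a b c d q \<beta> k =
    (1 - (q * a)\<^sup>2 + q * a * (q powi k * \<beta> - 1 / (q powi k * \<beta>))) * weight (q * a) b c d q \<beta> k"
proof -
  define z where "z = q powi k * \<beta>"
  have z: "z \<noteq> 0" using assms by (simp add: z_def)
  have "(1 + z * (q * a)) * (1 - q * a / z) = 1 - (q * a)\<^sup>2 + q * a * (z - 1 / z)"
    using z by (simp add: field_simps power2_eq_square)
  then have p: "wpair q a z = (1 - (q * a)\<^sup>2 + q * a * (z - 1 / z)) * wpair q (q * a) z"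
    using wpair_scale_parameter[OF z, of a] by simp
  show ?thesis
    unfolding weight_def wcore_def z_def[symmetric] p by (simp only: mult_ac)
qed

text \<open>
  Passing from \<open>qa\<close> to \<open>a\<close> multiplies the weight by a polynomial of degree one in \<open>z - 1/z\<close>.  The vanishing
  first moment replaces this polynomial by a constant, and
  \<open>(1 - Abcd)(1 - A\<^sup>2) + A(e\<^sub>1 + e\<^sub>3) = (1 + Ab)(1 + Ac)(1 + Ad)\<close> for \<open>A = qa\<close>.
  The convergence conditions match: the moment is needed for the parameter \<open>qa\<close>.
\<close>

lemma mass_scale_parameter:
  assumes "norm (q * a * b * c * d) < 1" "\<beta> \<noteq> 0"
  shows "(1 - q * a * b * c * d) * mass a b c d q \<beta> =
    (1 + q * a * b) * (1 + q * a * c) * (1 + q * a * d) * mass (q * a) b c d q \<beta>"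
proof -
  define A where "A = q * a"
  define e where "e = A + b + c + d + A * b * c + A * b * d + A * c * d + b * c * d"
  define x where "x = (\<lambda>k. q powi k * \<beta> - 1 / (q powi k * \<beta>))"
  define w where "w = weight A b c d q \<beta>"
  have lt: "norm (A * b * c * d) < 1" using assms by (simp add: A_def)
  have "norm (q * A * b * c * d) = norm q * norm (A * b * c * d)" by (simp add: norm_mult)
  also have "\<dots> \<le> 1 * norm (A * b * c * d)" using norm_q by (intro mult_right_mono) auto
  finally have "norm (q * A * b * c * d) < 1" using lt by simp
  then have w: "(w has_sum mass A b c d q \<beta>) UNIV"
    unfolding w_def mass_def using weight_summable assms(2) by (intro has_sum_infsum)
  have "((\<lambda>k. ((1 + A * b) * (1 + A * c) * (1 + A * d)) * w k
      + A * (((1 - A * b * c * d) * x k - e) * w k)) has_sum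
      (((1 + A * b) * (1 + A * c) * (1 + A * d)) * mass A b c d q \<beta> + A * 0)) UNIV"
    unfolding e_def x_def using first_moment[OF lt assms(2)]
    by (intro has_sum_add has_sum_cmult_right w) (simp add: w_def)
  moreover have "((1 + A * b) * (1 + A * c) * (1 + A * d)) * w k
      + A * (((1 - A * b * c * d) * x k - e) * w k) = (1 - A * b * c * d) * weight a b c d q \<beta> k" for k
  proof -
    have "((1 + A * b) * (1 + A * c) * (1 + A * d)) + A * ((1 - A * b * c * d) * x k - e)
      = (1 - A * b * c * d) * (1 - A\<^sup>2 + A * x k)"
      unfolding e_def by (simp add: algebra_simps power2_eq_square)
    then have "((1 + A * b) * (1 + A * c) * (1 + A * d)) * w k
      + A * (((1 - A * b * c * d) * x k - e) * w k) = (1 - A * b * c * d) * (1 - A\<^sup>2 + A * x k) * w k"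
      unfolding mult.assoc[of A _ "w k", symmetric] distrib_right[of _ _ "w k", symmetric] by simp
    also have "\<dots> = (1 - A * b * c * d) * weight a b c d q \<beta> k"
      unfolding weight_scale_parameter[OF assms(2), of a b c d k] A_def[symmetric] w_def x_def
      by (rule mult.assoc)
    finally show ?thesis .
  qed
  ultimately have "((\<lambda>k. (1 - A * b * c * d) * weight a b c d q \<beta> k) has_sum
      ((1 + A * b) * (1 + A * c) * (1 + A * d)) * mass A b c d q \<beta>) UNIV"
    by simp
  moreover have "((\<lambda>k. (1 - A * b * c * d) * weight a b c d q \<beta> k) has_sum
      (1 - A * b * c * d) * mass a b c d q \<beta>) UNIV"
    unfolding mass_def using weight_summable[OF assms]
    by (intro has_sum_cmult_right has_sum_infsum)
  ultimately have "((1 + A * b) * (1 + A * c) * (1 + A * d)) * mass A b c d q \<beta>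
      = (1 - A * b * c * d) * mass a b c d q \<beta>"
    by (rule has_sum_unique)
  then show ?thesis
    unfolding A_def by simp
qed

lemma mass_scale_parameter_power:
  assumes "norm (q * a * b * c * d) < 1" "\<beta> \<noteq> 0"
  shows "qpoch (q * a * b * c * d) q n * mass a b c d q \<beta> =
    qpoch (- q * a * b) q n * qpoch (- q * a * c) q n * qpoch (- q * a * d) q n
      * mass (a * q ^ n) b c d q \<beta>"
proof (induction n)
  case 0
  then show ?case by simp
next
  case (Suc n)
  define A where "A = a * q ^ n"
  have "norm (q * A * b * c * d) = norm q ^ n * norm (q * a * b * c * d)"
    by (simp add: A_def norm_mult norm_power)
  also have "\<dots> \<le> 1 * norm (q * a * b * c * d)"
    using norm_q by (intro mult_right_mono power_le_one) auto
  finally have "norm (q * A * b * c * d) < 1" using assms(1) by simp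
  note step = mass_scale_parameter[OF this assms(2)]
  have "qpoch (q * a * b * c * d) q (Suc n) * mass a b c d q \<beta>
     = qpoch (- q * a * b) q n * qpoch (- q * a * c) q n * qpoch (- q * a * d) q n
       * ((1 - q * A * b * c * d) * mass A b c d q \<beta>)"
    unfolding qpoch_Suc using Suc.IH by (simp add: A_def mult_ac)
  also have "\<dots> = qpoch (- q * a * b) q (Suc n) * qpoch (- q * a * c) q (Suc n)
      * qpoch (- q * a * d) q (Suc n) * mass (q * A) b c d q \<beta>"
    unfolding step qpoch_Suc by (simp add: A_def mult_ac)
  finally show ?case by (simp add: A_def mult_ac)
qed

text \<open>
  Tannery's theorem, with the majorant that is uniform in the parameters.
\<close>

lemma mass_parameter_to_0:
  assumes lt: "norm (q * a * b * c * d) < 1" and "\<beta> \<noteq> 0"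
  shows "(\<lambda>n. mass (a * q ^ n) b c d q \<beta>) \<longlonglongrightarrow> mass 0 b c d q \<beta>"
proof -
  have "norm q * (norm a * norm b * norm c * norm d) < 1"
    using assms by (simp add: norm_mult mult_ac)
  then obtain U where U: "U summable_on (UNIV :: int set)"
    "\<And>a' k. norm a' \<le> norm a \<Longrightarrow> norm (weight a' b c d q \<beta> k) \<le> U k"
  proof (rule weight_majorant[where B = "max (norm \<beta>) (1 / norm \<beta>)"])
    fix U :: "int \<Rightarrow> real"
    assume U: "U summable_on UNIV" "\<And>a' b' c' d' \<beta>' k. norm a' \<le> norm a \<Longrightarrow> norm b' \<le> norm b
      \<Longrightarrow> norm c' \<le> norm c \<Longrightarrow> norm d' \<le> norm d \<Longrightarrow> \<beta>' \<noteq> 0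
      \<Longrightarrow> norm \<beta>' \<le> max (norm \<beta>) (1 / norm \<beta>) \<Longrightarrow> 1 / norm \<beta>' \<le> max (norm \<beta>) (1 / norm \<beta>)
      \<Longrightarrow> norm (weight a' b' c' d' q \<beta>' k) \<le> U k"
    show ?thesis
      by (rule that[OF U(1)]) (rule U(2), use assms(2) in auto)
  qed (auto simp: le_max_iff_disj)
  have small: "norm (a * q ^ n) \<le> norm a" for n
    using norm_q by (simp add: norm_mult norm_power mult_left_le power_le_one)
  have summ: "(\<lambda>k. norm (weight a' b c d q \<beta> k)) summable_on UNIV" if "norm a' \<le> norm a" for a'
    by (rule summable_on_comparison_test[OF U(1)]) (use U(2)[OF that] in auto)
  have sumU: "summable (\<lambda>n. U (int_decode n))"
    using summable_on_reindex_bij_betw[OF bij_int_decode, of U] U(1)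
    by (intro summable_on_imp_summable) simp
  have aq: "(\<lambda>n. a * q ^ n) \<longlonglongrightarrow> 0"
    using norm_q by (auto intro!: tendsto_eq_intros LIMSEQ_power_zero)
  have "(\<lambda>n. \<Sum>i. weight (a * q ^ n) b c d q \<beta> (int_decode i)) \<longlonglongrightarrow>
      (\<Sum>i. weight 0 b c d q \<beta> (int_decode i))"
  proof (rule conjunct2[OF conjunct2[OF tannerys_theorem]])
    show "(\<lambda>n. weight (a * q ^ n) b c d q \<beta> (int_decode i)) \<longlonglongrightarrow> weight 0 b c d q \<beta> (int_decode i)" for i
    proof -
      have "(\<lambda>n. wpair q (a * q ^ n) z) \<longlonglongrightarrow> wpair q 0 z" for z
        unfolding wpair_def divide_inverse using aq by (intro tendsto_intros norm_q)
      then show ?thesis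
        unfolding weight_def wcore_def by (intro tendsto_intros)
    qed
    show "\<forall>\<^sub>F (k, n) in at_top \<times>\<^sub>F sequentially.
       norm (weight (a * q ^ n) b c d q \<beta> (int_decode k)) \<le> U (int_decode k)"
      using U(2)[OF small] by (intro always_eventually) auto
  qed (use sumU in auto)
  then show ?thesis
    unfolding mass_def by (simp add: infsum_int_eq_suminf(1) summ small)
qed

lemma mass_eliminate_parameter:
  assumes lt: "norm (q * a * b * c * d) < 1" and "\<beta> \<noteq> 0"
  shows "qpoch_inf (q * a * b * c * d) q * mass a b c d q \<beta> =
    qpoch_inf (- q * a * b) q * qpoch_inf (- q * a * c) q * qpoch_inf (- q * a * d) q
      * mass 0 b c d q \<beta>"
proof (rule LIMSEQ_unique)
  show "(\<lambda>n. qpoch (q * a * b * c * d) q n * mass a b c d q \<beta>) \<longlonglongrightarrow>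
      qpoch_inf (q * a * b * c * d) q * mass a b c d q \<beta>"
    by (intro tendsto_intros qpoch_LIMSEQ norm_q)
  show "(\<lambda>n. qpoch (q * a * b * c * d) q n * mass a b c d q \<beta>) \<longlonglongrightarrow>
    qpoch_inf (- q * a * b) q * qpoch_inf (- q * a * c) q * qpoch_inf (- q * a * d) q
      * mass 0 b c d q \<beta>"
    unfolding mass_scale_parameter_power[OF assms]
    by (intro tendsto_intros qpoch_LIMSEQ norm_q mass_parameter_to_0 assms)
qed

text \<open>
  Each parameter is sent to 0 in turn.  The products that are collected for \<open>a\<close> contain the remaining
  parameters, and those for \<open>b\<close>, \<open>c\<close>, \<open>d\<close> have a trivial denominator because \<open>a\<close> is already 0.  This
  is Bailey's summation of the very well poised \<open>\<^sub>6\<psi>\<^sub>6\<close>, up to the value at zero parameters.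
\<close>

lemma mass_eq_theta_mass:
  assumes lt: "norm (q * a * b * c * d) < 1" and "\<beta> \<noteq> 0"
  shows "mass a b c d q \<beta> =
    qpoch_inf (- q * a * b) q * qpoch_inf (- q * a * c) q * qpoch_inf (- q * a * d) q
    * qpoch_inf (- q * b * c) q * qpoch_inf (- q * b * d) q * qpoch_inf (- q * c * d) q
    / qpoch_inf (q * a * b * c * d) q * mass 0 0 0 0 q \<beta>"
proof -
  have zero: "norm (q * 0 * x * y * z) < 1" "norm (q * x * 0 * y * z) < 1"
    "norm (q * x * y * 0 * z) < 1" "norm (q * x * y * z * 0) < 1" for x y z :: complex
    by auto
  have "mass 0 b c d q \<beta> = qpoch_inf (- q * b * c) q * qpoch_inf (- q * b * d) q * mass 0 0 c d q \<beta>"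
    using mass_eliminate_parameter[OF zero(2) assms(2), of b c d] by (simp add: mass_swap(1))
  moreover have "mass 0 0 c d q \<beta> = qpoch_inf (- q * c * d) q * mass 0 0 0 d q \<beta>"
    using mass_eliminate_parameter[OF zero(2) assms(2), of c 0 d]
    by (simp add: mass_swap(1)[of c 0] mass_swap(2)[of 0 c 0])
  moreover have "mass 0 0 0 d q \<beta> = mass 0 0 0 0 q \<beta>"
    using mass_eliminate_parameter[OF zero(2) assms(2), of d 0 0]
    by (simp add: mass_swap(1)[of d 0] mass_swap(2)[of 0 d 0] mass_swap(3)[of 0 0 d 0])
  moreover have "qpoch_inf (q * a * b * c * d) q \<noteq> 0"
    by (rule qpoch_inf_nonzero[OF norm_q lt])
  ultimately show ?thesis
    using mass_eliminate_parameter[OF assms] by (simp add: field_simps)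
qed

lemma qpoch_inf_eq_0:
  assumes "y * q ^ j = 1"
  shows "qpoch_inf y q = 0"
  using assms
proof (induction j arbitrary: y)
  case 0
  then show ?case by (simp add: qpoch_inf_1[OF norm_q])
next
  case (Suc j)
  then have "qpoch_inf (y * q) q = 0" by (intro Suc.IH) (simp add: mult_ac)
  then show ?case by (subst qpoch_inf_shift[OF norm_q]) simp
qed

text \<open>
  Jacobi's triple product, since \<open>mass 0 0 0 0\<close> is \<open>\<Sum>\<^sub>j q^(j(j - 1)/2) \<beta>^(2j)\<close>
  summed separately over even and odd \<open>j\<close>.  For the parameters \<open>\<beta>, -1/\<beta>, 0, 0\<close> the weight vanishes at all
  nodes except \<open>k = 0\<close>; so this mass is explicit, and the reduction to zero parameters is solved
  for the theta series.
\<close>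

theorem theta_mass:
  assumes "\<beta> \<noteq> 0"
  shows "mass 0 0 0 0 q \<beta> = qpoch_inf q q * qpoch_inf (- \<beta>\<^sup>2) q * qpoch_inf (- q / \<beta>\<^sup>2) q"
proof -
  (* For k > 0 the pair of the parameter \<beta> vanishes, for k < 0 that of -1/\<beta>. *)
  have van: "weight \<beta> (- 1 / \<beta>) 0 0 q \<beta> k = 0" if "k \<noteq> 0" for k
  proof (cases "k > 0")
    case True
    have "q * \<beta> / (q powi k * \<beta>) * q ^ nat (k - 1) = 1"
    proof -
      have "q powi k = q * q ^ nat (k - 1)"
        using True by (simp add: power_int_def flip: power_Suc) (metis Suc_nat_eq_nat_zadd1 diff_add_cancel zle_diff1_eq add.commute)
      then show ?thesis using assms by simp
    qed
    then have "wpair q \<beta> (q powi k * \<beta>) = 0"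
      unfolding wpair_def by (simp add: qpoch_inf_eq_0)
    then show ?thesis by (simp add: weight_def wcore_def)
  next
    case False
    have "- q * (q powi k * \<beta>) * (- 1 / \<beta>) * q ^ nat (- (k + 1)) = 1"
    proof -
      have "q * q ^ nat (- (k + 1)) = q powi (- k)"
      proof -
        have "nat (- k) = Suc (nat (- (k + 1)))" using False that by auto
        then show ?thesis using False that by (simp add: power_int_def)
      qed
      then show ?thesis using assms by (simp add: power_int_minus field_simps)
    qed
    then have "wpair q (- 1 / \<beta>) (q powi k * \<beta>) = 0"
      unfolding wpair_def by (simp only: qpoch_inf_eq_0 mult_zero_left)
    then show ?thesis by (simp add: weight_def wcore_def)
  qed
  have "mass \<beta> (- 1 / \<beta>) 0 0 q \<beta> = infsum (weight \<beta> (- 1 / \<beta>) 0 0 q \<beta>) {0}"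
    unfolding mass_def by (rule infsum_cong_neutral) (use van in auto)
  also have "\<dots> = (1 + \<beta>\<^sup>2) * (wpair q \<beta> \<beta> * wpair q (- 1 / \<beta>) \<beta>)"
    by (simp add: weight_def wcore_def wpair_def)
  also have "\<dots> = (qpoch_inf q q)\<^sup>2 * ((1 + \<beta>\<^sup>2) * qpoch_inf (- q * \<beta>\<^sup>2) q) * qpoch_inf (- q / \<beta>\<^sup>2) q"
    using assms by (simp add: wpair_def power2_eq_square mult_ac)
  also have "(1 + \<beta>\<^sup>2) * qpoch_inf (- q * \<beta>\<^sup>2) q = qpoch_inf (- \<beta>\<^sup>2) q"
    by (subst (2) qpoch_inf_shift[OF norm_q]) (simp add: mult_ac)
  finally have 1: "mass \<beta> (- 1 / \<beta>) 0 0 q \<beta>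
      = (qpoch_inf q q)\<^sup>2 * qpoch_inf (- \<beta>\<^sup>2) q * qpoch_inf (- q / \<beta>\<^sup>2) q" .
  have "mass \<beta> (- 1 / \<beta>) 0 0 q \<beta> = qpoch_inf q q * mass 0 0 0 0 q \<beta>"
    using mass_eq_theta_mass[of \<beta> "- 1 / \<beta>" 0 0 \<beta>] assms by simp
  moreover have "qpoch_inf q q \<noteq> 0" by (rule qpoch_inf_nonzero[OF norm_q norm_q])
  ultimately show ?thesis
    using 1 by (simp add: power2_eq_square mult.assoc)
qed

end

section \<open>Terminating q-series\<close>

lemma qpoch_q_nonzero:
  assumes "norm q < 1"
  shows "qpoch q q n \<noteq> 0"
proof -
  have "1 - q * q ^ j \<noteq> 0" for j
  proof
    assume "1 - q * q ^ j = 0"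
    then have "norm (q * q ^ j) = 1" by simp
    moreover have "norm (q * q ^ j) \<le> norm q"
      using assms by (simp add: norm_mult norm_power mult_left_le power_le_one)
    ultimately show False using assms by simp
  qed
  then show ?thesis by (simp add: qpoch_def)
qed

lemma qpoch_nonzero:
  assumes "\<And>l. l < n \<Longrightarrow> y * q ^ l \<noteq> 1"
  shows "qpoch y q n \<noteq> 0"
  using assms by (auto simp: qpoch_def)

lemma qpoch_Suc': "qpoch y q (Suc n) = (1 - y) * qpoch (y * q) q n"
  using qpoch_add[of y q 1 n] by (simp add: qpoch_def)

context q_base
begin

definition qbinom_coeff :: "nat \<Rightarrow> nat \<Rightarrow> complex" where
  "qbinom_coeff n i = qpoch (1 / q ^ n) q i / qpoch q q i"

lemma qbinom_coeff_0 [simp]: "qbinom_coeff n 0 = 1"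
  by (simp add: qbinom_coeff_def)

lemma qbinom_coeff_eq_0: "n < i \<Longrightarrow> qbinom_coeff n i = 0"
  by (auto simp: qbinom_coeff_def qpoch_def intro!: bexI[of _ n])

lemma qbinom_coeff_pascal:
  "qbinom_coeff (Suc n) (Suc i) = qbinom_coeff n (Suc i) - qbinom_coeff n i / q ^ Suc n"
proof -
  define P where "P = qpoch (1 / q ^ n) q i"
  define R where "R = qpoch q q i"
  have R: "R \<noteq> 0" "1 - q ^ Suc i \<noteq> 0"
    using qpoch_q_nonzero[OF norm_q, of i] qpoch_q_nonzero[OF norm_q, of "Suc i"]
    by (auto simp: R_def qpoch_Suc)
  have "qpoch (1 / q ^ Suc n) q (Suc i) = (1 - 1 / q ^ Suc n) * P"
    unfolding qpoch_Suc' P_def by simp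
  moreover have "qpoch (1 / q ^ n) q (Suc i) = P * (1 - q ^ i / q ^ n)"
    by (simp add: qpoch_Suc P_def)
  moreover have "qpoch q q (Suc i) = R * (1 - q ^ Suc i)"
    by (simp add: qpoch_Suc R_def)
  moreover have "(1 - 1 / q ^ Suc n) * P / (R * (1 - q ^ Suc i))
     = P * (1 - q ^ i / q ^ n) / (R * (1 - q ^ Suc i)) - P / R / q ^ Suc n"
  proof -
    have "(1 - 1 / q ^ Suc n) = (1 - q ^ i / q ^ n) - (1 - q ^ Suc i) / q ^ Suc n"
      by (simp add: field_simps)
    then show ?thesis using R by (simp add: field_simps)
  qed
  ultimately show ?thesis
    unfolding qbinom_coeff_def P_def[symmetric] R_def[symmetric] by simp
qed

text \<open>
  The coefficients are \<open>(q\<^sup>-\<^sup>n;q)\<^sub>i/(q;q)\<^sub>i\<close>.  At \<open>x = q\<^sup>e\<^sup>+\<^sup>1\<close> with \<open>e < n\<close> one factor on the right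
  vanishes; this is the only terminating summation on which the orthogonality rests.
\<close>

lemma finite_q_binomial:
  "(\<Sum>i\<le>n. qbinom_coeff n i * x ^ i) = (\<Prod>l<n. 1 - x / q ^ Suc l)"
proof (induction n)
  case 0
  then show ?case by simp
next
  case (Suc n)
  have "(\<Sum>i\<le>Suc n. qbinom_coeff (Suc n) i * x ^ i)
     = 1 + (\<Sum>i\<le>n. qbinom_coeff (Suc n) (Suc i) * x ^ Suc i)"
    by (subst sum.atMost_Suc_shift) simp
  also have "\<dots> = 1 + (\<Sum>i\<le>n. qbinom_coeff n (Suc i) * x ^ Suc i)
       - x / q ^ Suc n * (\<Sum>i\<le>n. qbinom_coeff n i * x ^ i)"
    unfolding qbinom_coeff_pascal left_diff_distrib sum_subtractf sum_distrib_left
    by (simp add: mult_ac)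
  also have "1 + (\<Sum>i\<le>n. qbinom_coeff n (Suc i) * x ^ Suc i) = (\<Sum>i\<le>Suc n. qbinom_coeff n i * x ^ i)"
    by (subst sum.atMost_Suc_shift) simp
  also have "\<dots> = (\<Sum>i\<le>n. qbinom_coeff n i * x ^ i)"
    by (simp add: qbinom_coeff_eq_0)
  finally show ?case
    unfolding Suc.IH by (simp add: algebra_simps)
qed

definition qbinom_functional :: "nat \<Rightarrow> (complex \<Rightarrow> complex) \<Rightarrow> complex" where
  "qbinom_functional n f = (\<Sum>i\<le>n. qbinom_coeff n i * q ^ i * f (q ^ i))"

lemma qbinom_functional_poly_eq_0:
  assumes "degree p < n"
  shows "qbinom_functional n (poly p) = 0"
proof -
  have z: "(\<Sum>i\<le>n. qbinom_coeff n i * q ^ i * (q ^ i) ^ e) = 0" if "e < n" for e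
  proof -
    have "(\<Sum>i\<le>n. qbinom_coeff n i * q ^ i * (q ^ i) ^ e)
       = (\<Sum>i\<le>n. qbinom_coeff n i * (q ^ Suc e) ^ i)"
      by (intro sum.cong) (simp_all add: power_mult_distrib mult_ac flip: power_mult)
    also have "\<dots> = 0"
      unfolding finite_q_binomial using that by (auto intro!: bexI[of _ e])
    finally show ?thesis .
  qed
  have "qbinom_functional n (poly p) =
     (\<Sum>i\<le>n. \<Sum>e\<le>degree p. coeff p e * (qbinom_coeff n i * q ^ i * (q ^ i) ^ e))"
    unfolding qbinom_functional_def poly_altdef sum_distrib_left by (simp add: mult_ac)
  also have "\<dots> = (\<Sum>e\<le>degree p. coeff p e * (\<Sum>i\<le>n. qbinom_coeff n i * q ^ i * (q ^ i) ^ e))"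
    by (subst sum.swap) (simp add: sum_distrib_left)
  also have "\<dots> = 0"
    using assms z by (intro sum.neutral) auto
  finally show ?thesis .
qed

text \<open>
  Modulo \<open>1 - Vu\<close> the polynomials \<open>p\<close> and \<open>Q\<close> are proportional, with the factor \<open>p(1/V)/Q(1/V)\<close>, and the functional
  kills the polynomial part of the quotient.  The choice of \<open>Q\<close> with the roots \<open>q, ..., q\<^sup>n\<close> leaves only
  the term \<open>i = 0\<close>.
\<close>

lemma qbinom_functional_partial_fraction:
  assumes deg: "degree p \<le> n" and V0: "V \<noteq> 0" and V: "\<And>i. i \<le> n \<Longrightarrow> V * q ^ i \<noteq> 1"
  shows "qbinom_functional n (\<lambda>u. poly p u / (1 - V * u)) =
    poly p (1 / V) * V ^ n * qpoch q q n / qpoch V q (Suc n)"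
proof -
  define Q where "Q = (\<Prod>l<n. [: q ^ Suc l, -1 :])"
  define S where "S = (\<lambda>r. qbinom_functional n (\<lambda>u. poly r u / (1 - V * u)))"
  have degQ: "degree Q \<le> n"
  proof -
    have "degree Q \<le> (\<Sum>l<n. degree [: q ^ Suc l, -1 :])"
      unfolding Q_def using degree_prod_sum_le[of "{..<n}" "\<lambda>l. [: q ^ Suc l, -1 :]"] by simp
    then show ?thesis by simp
  qed
  have Q: "poly Q u = (\<Prod>l<n. q ^ Suc l - u)" for u
    by (simp add: Q_def poly_prod)
  have Q1: "poly Q 1 = (- 1) ^ n * qpoch q q n"
  proof -
    have "(- 1) ^ n * qpoch q q n = (\<Prod>l<n. (- 1) * (1 - q * q ^ l))"
      unfolding qpoch_def prod.distrib by simp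
    then show ?thesis unfolding Q by simp
  qed
  have QV: "poly Q (1 / V) = (- 1 / V) ^ n * qpoch (V * q) q n"
  proof -
    have "(- 1 / V) ^ n * qpoch (V * q) q n = (\<Prod>l<n. (- 1 / V) * (1 - V * q * q ^ l))"
      unfolding qpoch_def prod.distrib by simp
    also have "\<dots> = poly Q (1 / V)"
      unfolding Q using V0 by (intro prod.cong) (auto simp: field_simps)
    finally show ?thesis ..
  qed
  have SQ: "S Q = poly Q 1 / (1 - V)"
  proof -
    have "S Q = (\<Sum>i\<le>n. if i = 0 then poly Q 1 / (1 - V) else 0)"
      unfolding S_def qbinom_functional_def
    proof (rule sum.cong, rule refl)
      fix i assume i: "i \<in> {..n}"
      have "poly Q (q ^ i) = 0" if "i \<noteq> 0"
        unfolding Q using i that by (auto intro!: bexI[of _ "i - 1"] simp flip: power_Suc)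
      then show "qbinom_coeff n i * q ^ i * (poly Q (q ^ i) / (1 - V * q ^ i)) =
          (if i = 0 then poly Q 1 / (1 - V) else 0)" by auto
    qed
    then show ?thesis by simp
  qed
  have lin: "S (smult x p1 - smult y p2) = x * S p1 - y * S p2" for x y p1 p2
    unfolding S_def qbinom_functional_def sum_distrib_left sum_subtractf[symmetric]
    by (intro sum.cong) (auto simp: diff_divide_distrib algebra_simps)
  define R where "R = smult (poly p (1 / V)) Q - smult (poly Q (1 / V)) p"
  have "S R = 0"
  proof -
    have "poly R (1 / V) = 0" by (simp add: R_def)
    then obtain T where T: "R = [: - (1 / V), 1 :] * T"
      by (auto simp: poly_eq_0_iff_dvd elim: dvdE)
    show ?thesis
    proof (cases "T = 0")
      case True
      then show ?thesis by (simp add: T S_def qbinom_functional_def)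
    next
      case False
      have "degree R \<le> n"
        unfolding R_def by (intro degree_diff_le order_trans[OF degree_smult_le] deg degQ)
      moreover have "degree R = Suc (degree T)"
        unfolding T using False by (subst degree_mult_eq) auto
      ultimately have "degree (smult (- (1 / V)) T) < n" using V0 by simp
      then have 0: "qbinom_functional n (poly (smult (- (1 / V)) T)) = 0"
        by (rule qbinom_functional_poly_eq_0)
      have "poly R (q ^ i) / (1 - V * q ^ i) = poly (smult (- (1 / V)) T) (q ^ i)"
        if "i \<le> n" for i
        using V[OF that] V0 by (simp add: T divide_simps) (simp add: algebra_simps)
      then have "S R = qbinom_functional n (poly (smult (- (1 / V)) T))"
        unfolding S_def qbinom_functional_def by (intro sum.cong refl) (simp del: poly_smult)
      then show ?thesis using 0 by simp
    qed
  qed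
  then have "poly Q (1 / V) * S p = poly p (1 / V) * S Q"
    unfolding R_def lin by simp
  then have e: "(- 1 / V) ^ n * (qpoch (V * q) q n * S p)
      = (- 1) ^ n * (poly p (1 / V) * qpoch q q n / (1 - V))"
    unfolding SQ Q1 QV by (simp add: mult_ac)
  have "V * q * q ^ l \<noteq> 1" if "l < n" for l
    using V[of "Suc l"] that by (simp add: mult_ac)
  then have VS: "1 - V \<noteq> 0" "qpoch (V * q) q n \<noteq> 0"
    using V[of 0] by (auto intro!: qpoch_nonzero)
  have "(- 1) ^ n = V ^ n * (- 1 / V) ^ n"
    using V0 by (simp flip: power_mult_distrib)
  then have "(- 1) ^ n * (qpoch (V * q) q n * S p)
      = V ^ n * ((- 1 / V) ^ n * (qpoch (V * q) q n * S p))"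
    by (simp only: mult.assoc)
  also have "\<dots> = (- 1) ^ n * (V ^ n * (poly p (1 / V) * qpoch q q n / (1 - V)))"
    unfolding e by (simp only: mult_ac)
  finally have "(- 1) ^ n * (qpoch (V * q) q n * S p)
      = (- 1) ^ n * (V ^ n * (poly p (1 / V) * qpoch q q n / (1 - V)))" .
  moreover have "(- 1 :: complex) ^ n \<noteq> 0" by simp
  ultimately have "qpoch (V * q) q n * S p = V ^ n * (poly p (1 / V) * qpoch q q n / (1 - V))"
    using mult_left_cancel by blast
  then have "S p = V ^ n * (poly p (1 / V) * qpoch q q n / (1 - V)) / qpoch (V * q) q n"
    using VS by (simp add: field_simps)
  then show ?thesis
    unfolding S_def qpoch_Suc' by (simp add: mult_ac)
qed

lemma qpoch_as_poly:
  obtains p where "degree p \<le> n" and "\<And>u. poly p u = qpoch (y * u) q n"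
proof
  define p where "p = (\<Prod>l<n. [: 1, - (y * q ^ l) :])"
  have "degree p \<le> (\<Sum>l<n. degree [: 1, - (y * q ^ l) :])"
    unfolding p_def using degree_prod_sum_le[of "{..<n}" "\<lambda>l. [: 1, - (y * q ^ l) :]"] by simp
  also have "\<dots> \<le> (\<Sum>l<n. 1)" by (intro sum_mono) auto
  finally show "degree p \<le> n" by simp
  show "poly p u = qpoch (y * u) q n" for u
    by (simp add: p_def poly_prod qpoch_def mult_ac)
qed

text \<open>
  The quotient of shifted factorials is a polynomial in \<open>q\<^sup>i\<close> of degree \<open>n - 1 - j\<close>, so that together with
  \<open>(Xq\<^sup>i;q)\<^sub>j\<close> the degree is \<open>n - 1\<close>.  In this polynomial form, which is the balanced
  \<open>\<^sub>3\<phi>\<^sub>2\<close> sum, zeros of \<open>(X;q)\<^sub>n\<close> do no harm.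
\<close>

lemma terminating_sum_eq_0:
  assumes "j < n" and Y: "\<And>l. l < 2 * n \<Longrightarrow> Y * q ^ l \<noteq> 1"
  shows "(\<Sum>i\<le>n. qbinom_coeff n i * q ^ i *
      (qpoch (X * q ^ i) q j * qpoch (Y * q ^ (n - 1)) q i / qpoch Y q (i + j))) = 0"
proof -
  obtain p1 where p1: "degree p1 \<le> j" "\<And>u. poly p1 u = qpoch (X * u) q j"
    using qpoch_as_poly by blast
  obtain p2 where p2: "degree p2 \<le> n - 1 - j" "\<And>u. poly p2 u = qpoch (Y * q ^ j * u) q (n - 1 - j)"
    using qpoch_as_poly by blast
  have "degree (p1 * p2) \<le> degree p1 + degree p2" by (rule degree_mult_le)
  then have "degree (p1 * p2) < n" using p1 p2 assms(1) by linarith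
  then have 0: "qbinom_functional n (poly (p1 * p2)) = 0"
    by (rule qbinom_functional_poly_eq_0)
  have "qpoch (Y * q ^ (n - 1)) q i / qpoch Y q (i + j) = poly p2 (q ^ i) / qpoch Y q (n - 1)"
    if "i \<le> n" for i
  proof -
    have "qpoch Y q (n - 1) * qpoch (Y * q ^ (n - 1)) q i = qpoch Y q (n - 1 + i)"
      by (simp add: qpoch_add)
    also have "n - 1 + i = (i + j) + (n - 1 - j)" using assms(1) by simp
    also have "qpoch Y q \<dots> = qpoch Y q (i + j) * poly p2 (q ^ i)"
      unfolding p2 qpoch_add[of Y q "i + j"] by (simp add: power_add mult_ac)
    finally have *: "qpoch Y q (n - 1) * qpoch (Y * q ^ (n - 1)) q i = qpoch Y q (i + j) * poly p2 (q ^ i)" .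
    have "qpoch Y q (n - 1) \<noteq> 0" "qpoch Y q (i + j) \<noteq> 0"
      using that assms(1) by (auto intro!: qpoch_nonzero Y)
    then show ?thesis using * by (simp add: field_simps)
  qed
  then have "(\<Sum>i\<le>n. qbinom_coeff n i * q ^ i *
      (qpoch (X * q ^ i) q j * qpoch (Y * q ^ (n - 1)) q i / qpoch Y q (i + j)))
    = (\<Sum>i\<le>n. qbinom_coeff n i * q ^ i * poly (p1 * p2) (q ^ i) / qpoch Y q (n - 1))"
    by (intro sum.cong refl) (simp add: p1 flip: times_divide_eq_right)
  also have "\<dots> = 0"
    using 0 unfolding qbinom_functional_def sum_divide_distrib[symmetric] by simp
  finally show ?thesis .
qed

text \<open>
  For \<open>j = n\<close> the quotient has one pole left, \<open>(1 - V)/(1 - Vq\<^sup>i)\<close>.  The parameter \<open>V\<close> stands for \<open>Yq\<^sup>n\<^sup>-\<^sup>1\<close>; it is given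
  implicitly in order to include \<open>n = 0\<close>.
\<close>

lemma terminating_sum_diagonal:
  assumes "V * q = Y * q ^ n" "Y \<noteq> 0" "V \<noteq> 1" and Y: "\<And>l. l < 2 * n \<Longrightarrow> Y * q ^ l \<noteq> 1"
  shows "(\<Sum>i\<le>n. qbinom_coeff n i * q ^ i *
      (qpoch (X * q ^ i) q n * qpoch V q i / qpoch Y q (i + n)))
    = (\<Prod>l<n. V - X * q ^ l) * qpoch q q n / qpoch Y q (2 * n)"
proof -
  have V0: "V \<noteq> 0" using assms by auto
  have V: "V * q ^ i \<noteq> 1" if "i \<le> n" for i
  proof (cases i)
    case 0
    then show ?thesis using assms by simp
  next
    case (Suc l)
    have "V * q ^ i = Y * q ^ (n + l)"
      using assms(1) unfolding Suc by (simp add: power_add mult_ac)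
    then show ?thesis using Y[of "n + l"] that Suc by simp
  qed
  obtain p where p: "degree p \<le> n" "\<And>u. poly p u = qpoch (X * u) q n"
    using qpoch_as_poly by blast
  have Yn: "qpoch Y q n \<noteq> 0" by (auto intro!: qpoch_nonzero Y)
  have ratio: "qpoch V q i / qpoch Y q (i + n) = (1 - V) / qpoch Y q n / (1 - V * q ^ i)" if "i \<le> n" for i
  proof -
    have "qpoch Y q (i + n) = qpoch Y q n * qpoch (V * q) q i"
      unfolding assms(1) by (subst add.commute) (rule qpoch_add)
    moreover have "qpoch Y q (i + n) \<noteq> 0" using that by (auto intro!: qpoch_nonzero Y)
    ultimately have nz: "qpoch (V * q) q i \<noteq> 0" by auto
    have "qpoch V q i * (1 - V * q ^ i) = (1 - V) * qpoch (V * q) q i"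
      using qpoch_Suc[of V q i] qpoch_Suc'[of V q i] by simp
    then have "qpoch V q i / qpoch (V * q) q i = (1 - V) / (1 - V * q ^ i)"
      using nz V[OF that] by (subst frac_eq_eq) auto
    then have "qpoch V q i / qpoch (V * q) q i / qpoch Y q n = (1 - V) / (1 - V * q ^ i) / qpoch Y q n"
      by (simp only:)
    then show ?thesis
      unfolding \<open>qpoch Y q (i + n) = qpoch Y q n * qpoch (V * q) q i\<close> by (simp add: mult.commute)
  qed
  have "(\<Sum>i\<le>n. qbinom_coeff n i * q ^ i *
      (qpoch (X * q ^ i) q n * qpoch V q i / qpoch Y q (i + n)))
    = (\<Sum>i\<le>n. (1 - V) / qpoch Y q n * (qbinom_coeff n i * q ^ i * (poly p (q ^ i) / (1 - V * q ^ i))))"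
    by (intro sum.cong refl) (simp add: p ratio flip: times_divide_eq_right, simp add: mult_ac)
  also have "\<dots> = (1 - V) / qpoch Y q n * qbinom_functional n (\<lambda>u. poly p u / (1 - V * u))"
    by (simp add: qbinom_functional_def sum_distrib_left)
  also have "\<dots> = (1 - V) / qpoch Y q n * (poly p (1 / V) * V ^ n * qpoch q q n / qpoch V q (Suc n))"
    by (subst qbinom_functional_partial_fraction[OF p(1) V0 V]) auto
  also have "\<dots> = poly p (1 / V) * V ^ n * qpoch q q n / (qpoch Y q n * qpoch (V * q) q n)"
    unfolding qpoch_Suc' using assms(3) by simp
  also have "qpoch Y q n * qpoch (V * q) q n = qpoch Y q (2 * n)"
    unfolding assms(1) mult_2 by (rule qpoch_add[symmetric])
  also have "poly p (1 / V) * V ^ n = (\<Prod>l<n. V - X * q ^ l)"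
  proof -
    have "poly p (1 / V) * V ^ n = (\<Prod>l<n. (1 - X * (1 / V) * q ^ l) * V)"
      unfolding p qpoch_def prod.distrib by simp
    also have "\<dots> = (\<Prod>l<n. V - X * q ^ l)"
      using V0 by (intro prod.cong) (auto simp: field_simps)
    finally show ?thesis .
  qed
  finally show ?thesis .
qed

end

section \<open>Moments in the factorial bases\<close>

text \<open>
  A polynomial of degree \<open>k\<close> in \<open>z - 1/z\<close>.  It is the natural basis here because multiplication by it only
  replaces \<open>t\<close> by \<open>t q\<^sup>-\<^sup>k\<close> in the weight, up to a constant (\<open>basis_scale\<close> below).
\<close>

definition factorial_basis :: "complex \<Rightarrow> complex \<Rightarrow> complex \<Rightarrow> nat \<Rightarrow> complex" where
  "factorial_basis q t z k = qpoch (z / t) q k * qpoch (- 1 / (t * z)) q k"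

lemma factorial_basis_0 [simp]: "factorial_basis q t z 0 = 1"
  by (simp add: factorial_basis_def)

lemma factorial_basis_Suc:
  assumes "t \<noteq> 0" "z \<noteq> 0"
  shows "factorial_basis q t z (Suc k) =
    (1 - (q ^ k / t)\<^sup>2 - q ^ k / t * (z - 1 / z)) * factorial_basis q t z k"
proof -
  have "(1 - z / t * q ^ k) * (1 - (- 1 / (t * z)) * q ^ k) = 1 - (q ^ k / t)\<^sup>2 - q ^ k / t * (z - 1 / z)"
    using assms by (simp add: field_simps power2_eq_square)
  note eq = this
  show ?thesis
    unfolding factorial_basis_def qpoch_Suc eq[symmetric] by (simp only: mult_ac)
qed

context q_base
begin

text \<open>
  Both bases are triangular over the powers of \<open>z - 1/z\<close>.  Only the leading coefficient matters later, since
  the lower terms are orthogonal to the polynomial of degree \<open>k\<close>.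
\<close>

lemma factorial_basis_change:
  assumes "a \<noteq> 0" "b \<noteq> 0"
  shows "\<exists>e. (\<forall>z. z \<noteq> 0 \<longrightarrow> factorial_basis q a z k = (\<Sum>j\<le>k. e j * factorial_basis q b z j))
      \<and> e k = (b / a) ^ k"
proof (induction k)
  case 0
  show ?case by (intro exI[of _ "\<lambda>_. 1"]) simp
next
  case (Suc k)
  then obtain e where e: "\<And>z. z \<noteq> 0 \<Longrightarrow> factorial_basis q a z k = (\<Sum>j\<le>k. e j * factorial_basis q b z j)"
    and ek: "e k = (b / a) ^ k" by blast
  (* The new factor is affine in z - 1/z, and so is the ratio of consecutive elements of the basis of b; comparing slopes gives B. *)
  define B where "B = (\<lambda>j. q ^ k / a * (b / q ^ j))"
  define A where "A = (\<lambda>j. (1 - (q ^ k / a)\<^sup>2) - B j * (1 - (q ^ j / b)\<^sup>2))"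
  define e' where "e' = (\<lambda>j. (if j \<le> k then e j * A j else 0) + (case j of 0 \<Rightarrow> 0 | Suc i \<Rightarrow> e i * B i))"
  have "factorial_basis q a z (Suc k) = (\<Sum>j\<le>Suc k. e' j * factorial_basis q b z j)" if z: "z \<noteq> 0" for z
  proof -
    define x where "x = z - 1 / z"
    define f where "f = factorial_basis q b z"
    have fS: "f (Suc j) = (1 - (q ^ j / b)\<^sup>2 - q ^ j / b * x) * f j" for j
      unfolding f_def x_def by (rule factorial_basis_Suc[OF assms(2) z])
    have st: "(1 - (q ^ k / a)\<^sup>2 - q ^ k / a * x) * f j = A j * f j + B j * f (Suc j)" for j
    proof -
      have "B j * (q ^ j / b) = q ^ k / a" unfolding B_def using assms by simp
      then have "q ^ k / a * x = B j * (q ^ j / b * x)" by (metis mult.assoc)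
      then show ?thesis unfolding fS A_def by (simp add: algebra_simps)
    qed
    have "factorial_basis q a z (Suc k) = (\<Sum>j\<le>k. e j * ((1 - (q ^ k / a)\<^sup>2 - q ^ k / a * x) * f j))"
      unfolding factorial_basis_Suc[OF assms(1) z] e[OF z] x_def f_def sum_distrib_left
      by (simp add: mult_ac)
    also have "\<dots> = (\<Sum>j\<le>k. e j * A j * f j) + (\<Sum>j\<le>k. e j * B j * f (Suc j))"
      unfolding st sum.distrib[symmetric] by (simp add: algebra_simps)
    also have "(\<Sum>j\<le>k. e j * A j * f j) = (\<Sum>j\<le>Suc k. (if j \<le> k then e j * A j else 0) * f j)"
      by simp
    also have "(\<Sum>j\<le>k. e j * B j * f (Suc j)) = (\<Sum>j\<le>Suc k. (case j of 0 \<Rightarrow> 0 | Suc i \<Rightarrow> e i * B i) * f j)"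
      by (subst sum.atMost_Suc_shift) simp
    finally show ?thesis
      unfolding e'_def f_def sum.distrib[symmetric] distrib_right[symmetric] .
  qed
  moreover have "e' (Suc k) = (b / a) ^ Suc k"
    by (simp add: e'_def ek B_def)
  ultimately show ?case by blast
qed

lemma factorial_basis_change_sum:
  assumes "a \<noteq> 0" "b \<noteq> 0"
  shows "\<exists>e. (\<forall>z. z \<noteq> 0 \<longrightarrow> (\<Sum>k\<le>m. c k * factorial_basis q a z k) = (\<Sum>j\<le>m. e j * factorial_basis q b z j))
      \<and> e m = c m * (b / a) ^ m"
proof (induction m)
  case 0
  show ?case by (intro exI[of _ c]) simp
next
  case (Suc m)
  then obtain e where e: "\<And>z. z \<noteq> 0 \<Longrightarrow>
      (\<Sum>k\<le>m. c k * factorial_basis q a z k) = (\<Sum>j\<le>m. e j * factorial_basis q b z j)" by blast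
  obtain g where g: "\<And>z. z \<noteq> 0 \<Longrightarrow>
      factorial_basis q a z (Suc m) = (\<Sum>j\<le>Suc m. g j * factorial_basis q b z j)"
      "g (Suc m) = (b / a) ^ Suc m"
    using factorial_basis_change[OF assms, of "Suc m"] by blast
  define h where "h = (\<lambda>j. (if j \<le> m then e j else 0) + c (Suc m) * g j)"
  have "(\<Sum>k\<le>Suc m. c k * factorial_basis q a z k) = (\<Sum>j\<le>Suc m. h j * factorial_basis q b z j)"
    if "z \<noteq> 0" for z
  proof -
    have "(\<Sum>k\<le>Suc m. c k * factorial_basis q a z k) =
       (\<Sum>j\<le>m. e j * factorial_basis q b z j) + c (Suc m) * (\<Sum>j\<le>Suc m. g j * factorial_basis q b z j)"
      using e[OF that] g(1)[OF that] by simp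
    also have "(\<Sum>j\<le>m. e j * factorial_basis q b z j) =
       (\<Sum>j\<le>Suc m. (if j \<le> m then e j else 0) * factorial_basis q b z j)" by simp
    finally show ?thesis
      unfolding h_def sum_distrib_left sum.distrib[symmetric] distrib_right by (simp add: mult_ac)
  qed
  moreover have "h (Suc m) = c (Suc m) * (b / a) ^ Suc m" by (simp add: h_def g)
  ultimately show ?case by blast
qed

definition basis_scale :: "complex \<Rightarrow> nat \<Rightarrow> complex" where
  "basis_scale t k = (\<Prod>i<k. - ((q ^ i / t)\<^sup>2))"

lemma factorial_basis_weight:
  assumes "a \<noteq> 0" "\<beta> \<noteq> 0"
  shows "factorial_basis q a (q powi k * \<beta>) i * weight a b c d q \<beta> k
     = basis_scale a i * weight (a / q ^ i) b c d q \<beta> k"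
proof (induction i)
  case 0
  then show ?case by (simp add: basis_scale_def)
next
  case (Suc i)
  define z where "z = q powi k * \<beta>"
  define x where "x = z - 1 / z"
  have z: "z \<noteq> 0" using assms by (simp add: z_def)
  define A where "A = a / q ^ i"
  have A: "A \<noteq> 0" "q ^ i / a = 1 / A" "q * (a / q ^ Suc i) = A" using assms by (auto simp: A_def)
  have "factorial_basis q a z (Suc i) = (1 - (1 / A)\<^sup>2 - 1 / A * x) * factorial_basis q a z i"
    unfolding factorial_basis_Suc[OF assms(1) z] A(2) x_def ..
  then have "factorial_basis q a z (Suc i) * weight a b c d q \<beta> k
     = (1 - (1 / A)\<^sup>2 - 1 / A * x) * (basis_scale a i * weight A b c d q \<beta> k)"
    using Suc.IH[folded z_def A_def] by (simp only: mult.assoc)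
  also have "1 - (1 / A)\<^sup>2 - 1 / A * x = - ((1 / A)\<^sup>2) * (1 - A\<^sup>2 + A * x)"
    using A(1) by (simp add: field_simps power2_eq_square)
  also have "\<dots> * (basis_scale a i * weight A b c d q \<beta> k)
     = basis_scale a i * - ((1 / A)\<^sup>2) * ((1 - A\<^sup>2 + A * x) * weight A b c d q \<beta> k)"
    by (simp only: mult_ac)
  also have "(1 - A\<^sup>2 + A * x) * weight A b c d q \<beta> k = weight (a / q ^ Suc i) b c d q \<beta> k"
    using weight_scale_parameter[OF assms(2), of "a / q ^ Suc i" b c d k]
    unfolding A(3) x_def z_def by simp
  finally show ?case by (simp add: basis_scale_def A(2) z_def)
qed

lemma factorial_basis_product_weight:
  assumes "a \<noteq> 0" "b \<noteq> 0" "\<beta> \<noteq> 0"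
  shows "factorial_basis q a (q powi k * \<beta>) i * factorial_basis q b (q powi k * \<beta>) j
       * weight a b c d q \<beta> k
     = basis_scale a i * basis_scale b j * weight (a / q ^ i) (b / q ^ j) c d q \<beta> k"
proof -
  have sw: "weight y x c d q \<beta> k = weight x y c d q \<beta> k" for x y
    unfolding weight_def wcore_def by (simp add: mult_ac)
  have "factorial_basis q a (q powi k * \<beta>) i * factorial_basis q b (q powi k * \<beta>) j
       * weight a b c d q \<beta> k
     = factorial_basis q b (q powi k * \<beta>) j * (factorial_basis q a (q powi k * \<beta>) i * weight a b c d q \<beta> k)"
    by (simp only: mult_ac)
  also have "\<dots> = basis_scale a i * (factorial_basis q b (q powi k * \<beta>) j * weight b (a / q ^ i) c d q \<beta> k)"
    unfolding factorial_basis_weight[OF assms(1,3)] sw[of "a / q ^ i" b] by (simp only: mult_ac)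
  finally show ?thesis
    unfolding factorial_basis_weight[OF assms(2,3)] sw[of "a / q ^ i"] by (simp only: mult_ac)
qed

text \<open>
  The moment of \<open>factorial_basis q a z i * factorial_basis q b z j\<close> divided by the total mass.
\<close>

definition moment_ratio where
  "moment_ratio a b c d i j =
     qpoch (- 1 / (a * b)) q (i + j) * qpoch (- 1 / (a * c)) q i * qpoch (- 1 / (a * d)) q i
       * qpoch (- 1 / (b * c)) q j * qpoch (- 1 / (b * d)) q j / qpoch (1 / (a * b * c * d)) q (i + j)"

lemma moment_step:
  assumes nz: "a \<noteq> 0" "b \<noteq> 0" "c \<noteq> 0" "d \<noteq> 0" "\<beta> \<noteq> 0"
    and lt: "norm (a / q ^ i * B * c * d) < 1" and B: "B = b / q ^ j"
  shows "basis_scale a (Suc i) * mass (a / q ^ Suc i) B c d q \<beta> =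
     (1 + q ^ (i + j) / (a * b)) * (1 + q ^ i / (a * c)) * (1 + q ^ i / (a * d))
       / (1 - q ^ (i + j) / (a * b * c * d)) * (basis_scale a i * mass (a / q ^ i) B c d q \<beta>)"
proof -
  define A where "A = a / q ^ i"
  have nA: "A \<noteq> 0" "B \<noteq> 0" using nz B by (auto simp: A_def)
  have qA: "q * (a / q ^ Suc i) = A" by (simp add: A_def)
  have inv: "q ^ (i + j) / (a * b) = 1 / (A * B)" "q ^ i / (a * t) = 1 / (A * t)"
    "q ^ (i + j) / (a * b * c * d) = 1 / (A * B * c * d)" for t
    using nz by (auto simp: A_def B power_add)
  have "A * B * c * d \<noteq> 1"
  proof
    assume "A * B * c * d = 1"
    then have "norm (A * B * c * d) = 1" by simp
    then show False using lt by (simp add: A_def)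
  qed
  then have n1: "1 - A * B * c * d \<noteq> 0" "1 - 1 / (A * B * c * d) \<noteq> 0"
    using nA nz by (auto simp: field_simps)
  have "norm (q * (a / q ^ Suc i) * B * c * d) < 1" unfolding qA using lt by (simp add: A_def)
  from mass_scale_parameter[OF this nz(5)]
  have "(1 - A * B * c * d) * mass (a / q ^ Suc i) B c d q \<beta> =
    (1 + A * B) * (1 + A * c) * (1 + A * d) * mass A B c d q \<beta>"
    unfolding qA .
  then have m: "mass (a / q ^ Suc i) B c d q \<beta> =
    (1 + A * B) * (1 + A * c) * (1 + A * d) / (1 - A * B * c * d) * mass A B c d q \<beta>"
    using n1 by (simp add: field_simps)
  have "- ((1 / A)\<^sup>2) * ((1 + A * B) * (1 + A * c) * (1 + A * d) / (1 - A * B * c * d))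
     = (1 + 1 / (A * B)) * (1 + 1 / (A * c)) * (1 + 1 / (A * d)) / (1 - 1 / (A * B * c * d))"
  proof -
    have e1: "(1 + 1 / (A * B)) * (1 + 1 / (A * c)) * (1 + 1 / (A * d))
       = (1 + A * B) * (1 + A * c) * (1 + A * d) / (A ^ 3 * B * c * d)"
      using nA nz by (simp add: field_simps power3_eq_cube)
    have e2: "1 - 1 / (A * B * c * d) = - (1 - A * B * c * d) / (A * B * c * d)"
      using nA nz by (simp add: field_simps)
    have "- ((1 / A)\<^sup>2) * (x / p) = x / (A ^ 3 * B * c * d) / (- p / (A * B * c * d))"
      if "p \<noteq> 0" for x p
      using nA nz that by (simp add: power3_eq_cube power2_eq_square)
    then show ?thesis unfolding e1 e2 using n1(1) by blast
  qed
  note ratio = this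
  have "basis_scale a (Suc i) = basis_scale a i * - ((1 / A)\<^sup>2)"
    by (simp add: basis_scale_def A_def)
  then have "basis_scale a (Suc i) * mass (a / q ^ Suc i) B c d q \<beta> =
     - ((1 / A)\<^sup>2) * ((1 + A * B) * (1 + A * c) * (1 + A * d) / (1 - A * B * c * d))
       * (basis_scale a i * mass A B c d q \<beta>)"
    unfolding m by (simp only: mult_ac)
  then show ?thesis
    unfolding ratio inv A_def[symmetric] .
qed

text \<open>
  The parameters \<open>a q\<^sup>-\<^sup>i\<close> and \<open>b q\<^sup>-\<^sup>j\<close> are reached step by step from \<open>a\<close> and \<open>b\<close>; the hypothesis is exactly
  the convergence condition for the last parameters.
\<close>

lemma mixed_mass:
  assumes nz: "a \<noteq> 0" "b \<noteq> 0" "c \<noteq> 0" "d \<noteq> 0" "\<beta> \<noteq> 0"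
  assumes "norm q * norm (a * b * c * d) < norm q ^ (i + j)"
  shows "basis_scale a i * basis_scale b j * mass (a / q ^ i) (b / q ^ j) c d q \<beta>
     = moment_ratio a b c d i j * mass a b c d q \<beta>"
proof -
  have zero: "basis_scale b j * mass a (b / q ^ j) c d q \<beta> = moment_ratio a b c d 0 j * mass a b c d q \<beta>"
    if "norm q * norm (a * b * c * d) < norm q ^ j" for j
    using that
  proof (induction j)
    case 0
    then show ?case by (simp add: basis_scale_def moment_ratio_def)
  next
    case (Suc j)
    have lt: "norm (b / q ^ j * a * c * d) < 1"
      using Suc.prems by (simp add: norm_mult norm_divide norm_power field_simps)
    have "norm q * norm (a * b * c * d) < norm q ^ j"
      using Suc.prems norm_q mult_left_le_one_le[of "norm (a * b * c * d)" "norm q"] by simp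
    note IH = Suc.IH[OF this]
    have "basis_scale b (Suc j) * mass a (b / q ^ Suc j) c d q \<beta>
       = (1 + q ^ (j + 0) / (b * a)) * (1 + q ^ j / (b * c)) * (1 + q ^ j / (b * d))
       / (1 - q ^ (j + 0) / (b * a * c * d)) * (basis_scale b j * mass a (b / q ^ j) c d q \<beta>)"
      using moment_step[OF nz(2,1,3,4,5) lt, of 0] by (simp add: mass_swap(1)[of a])
    then show ?case
      unfolding IH moment_ratio_def
      by (simp add: qpoch_Suc mult_ac)
  qed
  show ?thesis
    using assms(6)
  proof (induction i)
    case 0
    then show ?case using zero[of j] by (simp add: basis_scale_def)
  next
    case (Suc i)
    have lt: "norm (a / q ^ i * (b / q ^ j) * c * d) < 1"
      using Suc.prems by (simp add: norm_mult norm_divide norm_power field_simps power_add)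
    have "norm q * norm (a * b * c * d) < norm q ^ (i + j)"
      using Suc.prems norm_q mult_left_le_one_le[of "norm (a * b * c * d)" "norm q"] by simp
    note IH = Suc.IH[OF this]
    have "basis_scale a (Suc i) * basis_scale b j * mass (a / q ^ Suc i) (b / q ^ j) c d q \<beta>
      = basis_scale b j * (basis_scale a (Suc i) * mass (a / q ^ Suc i) (b / q ^ j) c d q \<beta>)"
      by (simp only: mult_ac)
    also have "\<dots> = (1 + q ^ (i + j) / (a * b)) * (1 + q ^ i / (a * c)) * (1 + q ^ i / (a * d))
       / (1 - q ^ (i + j) / (a * b * c * d))
       * (basis_scale a i * basis_scale b j * mass (a / q ^ i) (b / q ^ j) c d q \<beta>)"
      unfolding moment_step[OF nz lt refl] by (simp only: mult_ac)
    also have "\<dots> = moment_ratio a b c d (Suc i) j * mass a b c d q \<beta>"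
      unfolding IH moment_ratio_def by (simp add: qpoch_Suc mult_ac)
    finally show ?case .
  qed
qed

lemma factorial_moment:
  assumes nz: "a \<noteq> 0" "b \<noteq> 0" "c \<noteq> 0" "d \<noteq> 0" "\<beta> \<noteq> 0"
  assumes lt: "norm q * norm (a * b * c * d) < norm q ^ (i + j)"
  shows "((\<lambda>k. factorial_basis q a (q powi k * \<beta>) i * factorial_basis q b (q powi k * \<beta>) j
       * weight a b c d q \<beta> k) has_sum moment_ratio a b c d i j * mass a b c d q \<beta>) UNIV"
proof -
  have "norm (q * (a / q ^ i) * (b / q ^ j) * c * d) < 1"
    using lt by (simp add: norm_mult norm_divide norm_power field_simps power_add)
  then have "(weight (a / q ^ i) (b / q ^ j) c d q \<beta> has_sum mass (a / q ^ i) (b / q ^ j) c d q \<beta>) UNIV"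
    unfolding mass_def by (intro has_sum_infsum weight_summable nz)
  then show ?thesis
    unfolding factorial_basis_product_weight[OF nz(1,2,5)] mixed_mass[OF assms, symmetric]
    by (rule has_sum_cmult_right)
qed

end

section \<open>Orthogonality on a bilateral lattice\<close>

lemma has_sum_finite_sum:
  fixes f :: "'i \<Rightarrow> 'x \<Rightarrow> complex"
  assumes "finite A" "\<And>i. i \<in> A \<Longrightarrow> (f i has_sum s i) B"
  shows "((\<lambda>x. \<Sum>i\<in>A. f i x) has_sum (\<Sum>i\<in>A. s i)) B"
  using assms by (induction A rule: finite_induct) (auto intro!: has_sum_add)

context q_base
begin

definition aw_prefactor where
  "aw_prefactor a b c d n = q powi (- 3 * int (n choose 2)) * (- (a\<^sup>2 * b * c * d)) ^ n"

definition aw_coeff where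
  "aw_coeff a b c d n k = qbinom_coeff n k * q ^ k * qpoch (q powi (int n - 1) / (a * b * c * d)) q k *
     (qpoch (- 1 / (a * b) * q ^ k) q (n - k) * qpoch (- 1 / (a * c) * q ^ k) q (n - k)
       * qpoch (- 1 / (a * d) * q ^ k) q (n - k))"

lemma qinv_askey_wilson_factorial_expansion:
  assumes "a \<noteq> 0" "b \<noteq> 0" "c \<noteq> 0" "d \<noteq> 0" "z \<noteq> 0"
  shows "qinv_askey_wilson n z a b c d q =
    (\<Sum>k\<le>n. aw_prefactor a b c d n * aw_coeff a b c d n k * factorial_basis q a z k)"
proof -
  have "qpoch (q powi - int n) q k / qpoch q q k = qbinom_coeff n k" for k
    by (simp add: qbinom_coeff_def power_int_minus divide_inverse)
  then have "qpochs [q powi (- int n), q powi (int n - 1) / (a * b * c * d), z / a, - 1 / (a * z)] q k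
             / qpoch q q k * q ^ k
             * qpochs [- (q ^ k) / (a * b), - (q ^ k) / (a * c), - (q ^ k) / (a * d)] q (n - k)
     = aw_coeff a b c d n k * factorial_basis q a z k" for k
    unfolding aw_coeff_def factorial_basis_def qpochs_def by (simp flip: \<open>\<And>k. _ k = _\<close>)
  then show ?thesis
    unfolding qinv_askey_wilson_explicit[OF q_nonzero assms] aw_prefactor_def[symmetric]
    by (simp add: sum_distrib_left mult_ac)
qed

text \<open>
  Mixed bases: the polynomial is expanded with respect to \<open>a\<close> and tested against the basis of \<open>b\<close>, because
  then the factors with \<open>ac\<close> and \<open>ad\<close> complement those of the moment to constants, and only factors
  with \<open>ab\<close> and \<open>abcd\<close> remain in the sum over \<open>k\<close>.
\<close>

lemma aw_coeff_moment_ratio: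
  assumes "k \<le> n"
  shows "aw_coeff a b c d n k * moment_ratio a b c d k j =
    qpoch (- 1 / (a * b)) q n * qpoch (- 1 / (a * c)) q n * qpoch (- 1 / (a * d)) q n
      * qpoch (- 1 / (b * c)) q j * qpoch (- 1 / (b * d)) q j *
    (qbinom_coeff n k * q ^ k * (qpoch (- 1 / (a * b) * q ^ k) q j
      * qpoch (q powi (int n - 1) / (a * b * c * d)) q k / qpoch (1 / (a * b * c * d)) q (k + j)))"
proof -
  have s: "qpoch y q k * qpoch (y * q ^ k) q (n - k) = qpoch y q n" for y
    using qpoch_add[of y q k "n - k"] assms by simp
  have "aw_coeff a b c d n k * moment_ratio a b c d k j =
    (qpoch (- 1 / (a * b)) q k * qpoch (- 1 / (a * b) * q ^ k) q (n - k))
    * (qpoch (- 1 / (a * c)) q k * qpoch (- 1 / (a * c) * q ^ k) q (n - k))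
    * (qpoch (- 1 / (a * d)) q k * qpoch (- 1 / (a * d) * q ^ k) q (n - k))
      * qpoch (- 1 / (b * c)) q j * qpoch (- 1 / (b * d)) q j *
    (qbinom_coeff n k * q ^ k * (qpoch (- 1 / (a * b) * q ^ k) q j
      * qpoch (q powi (int n - 1) / (a * b * c * d)) q k / qpoch (1 / (a * b * c * d)) q (k + j)))"
    unfolding aw_coeff_def moment_ratio_def qpoch_add[of "- 1 / (a * b)" q k j]
    by (simp only: mult_ac times_divide_eq_left times_divide_eq_right)
  then show ?thesis unfolding s .
qed

text \<open>
  The convergence condition keeps \<open>1/(abcd)\<close> so large that no denominator in the norm can vanish.
\<close>

lemma convergence_imp_generic:
  assumes nz: "a \<noteq> 0" "b \<noteq> 0" "c \<noteq> 0" "d \<noteq> 0"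
    and lt: "norm q * norm (a * b * c * d) < norm q ^ (2 * n)"
  shows "l < 2 * n \<Longrightarrow> 1 / (a * b * c * d) * q ^ l \<noteq> 1"
    and "q powi (int n - 1) / (a * b * c * d) \<noteq> 1"
    and "l < n \<Longrightarrow> 1 / (q * a * b * c * d) * q ^ l \<noteq> 1"
proof -
  define e where "e = a * b * c * d"
  have e: "e \<noteq> 0" "norm q * norm e < norm q ^ (2 * n)" using assms by (auto simp: e_def)
  have key: "q ^ l \<noteq> q * e" if "l \<le> 2 * n" for l
  proof
    assume "q ^ l = q * e"
    then have "norm q ^ l < norm q ^ (2 * n)" using e by (simp flip: norm_power norm_mult)
    moreover have "norm q ^ (2 * n) \<le> norm q ^ l"
      using that norm_q by (intro power_decreasing) auto
    ultimately show False by simp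
  qed
  show "1 / (a * b * c * d) * q ^ l \<noteq> 1" if "l < 2 * n"
    using key[of "Suc l"] that e(1) unfolding e_def[symmetric] by auto
  show "q powi (int n - 1) / (a * b * c * d) \<noteq> 1"
  proof -
    have "q powi (int n - 1) * q = q ^ n"
      by (simp add: power_int_diff)
    then show ?thesis using key[of n] e(1) unfolding e_def[symmetric] by (auto simp: mult.commute)
  qed
  show "1 / (q * a * b * c * d) * q ^ l \<noteq> 1" if "l < n"
  proof -
    have "1 / (q * a * b * c * d) * q ^ l = q ^ l / (q * e)" by (simp add: e_def mult.assoc)
    then show ?thesis using key[of l] that e by auto
  qed
qed

lemma aw_dual_moment:
  assumes nz: "a \<noteq> 0" "b \<noteq> 0" "c \<noteq> 0" "d \<noteq> 0" "\<beta> \<noteq> 0"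
    and lt: "norm q * norm (a * b * c * d) < norm q ^ (2 * n)" and "j \<le> n"
  shows "((\<lambda>k. qinv_askey_wilson n (q powi k * \<beta>) a b c d q * factorial_basis q b (q powi k * \<beta>) j
       * weight a b c d q \<beta> k) has_sum
       aw_prefactor a b c d n * (\<Sum>i\<le>n. aw_coeff a b c d n i * moment_ratio a b c d i j)
         * mass a b c d q \<beta>) UNIV"
proof -
  have "((\<lambda>k. aw_prefactor a b c d n * aw_coeff a b c d n i *
       (factorial_basis q a (q powi k * \<beta>) i * factorial_basis q b (q powi k * \<beta>) j
       * weight a b c d q \<beta> k)) has_sum
     aw_prefactor a b c d n * aw_coeff a b c d n i * (moment_ratio a b c d i j * mass a b c d q \<beta>)) UNIV"
    if "i \<le> n" for i
  proof (intro has_sum_cmult_right factorial_moment nz)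
    have "norm q ^ (2 * n) \<le> norm q ^ (i + j)"
      using that assms(7) norm_q by (intro power_decreasing) auto
    then show "norm q * norm (a * b * c * d) < norm q ^ (i + j)" using lt by linarith
  qed
  then have "((\<lambda>k. \<Sum>i\<le>n. aw_prefactor a b c d n * aw_coeff a b c d n i *
       (factorial_basis q a (q powi k * \<beta>) i * factorial_basis q b (q powi k * \<beta>) j
       * weight a b c d q \<beta> k)) has_sum
     (\<Sum>i\<le>n. aw_prefactor a b c d n * aw_coeff a b c d n i * (moment_ratio a b c d i j * mass a b c d q \<beta>))) UNIV"
    by (intro has_sum_finite_sum) auto
  moreover have "(\<Sum>i\<le>n. aw_prefactor a b c d n * aw_coeff a b c d n i *
       (factorial_basis q a (q powi k * \<beta>) i * factorial_basis q b (q powi k * \<beta>) j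
       * weight a b c d q \<beta> k)) =
     qinv_askey_wilson n (q powi k * \<beta>) a b c d q * factorial_basis q b (q powi k * \<beta>) j
       * weight a b c d q \<beta> k" for k
  proof -
    have "q powi k * \<beta> \<noteq> 0" using nz by simp
    from qinv_askey_wilson_factorial_expansion[OF nz(1-4) this, of n]
    show ?thesis by (simp only: sum_distrib_right) (simp only: mult_ac)
  qed
  moreover have "(\<Sum>i\<le>n. aw_prefactor a b c d n * aw_coeff a b c d n i
       * (moment_ratio a b c d i j * mass a b c d q \<beta>))
     = aw_prefactor a b c d n * (\<Sum>i\<le>n. aw_coeff a b c d n i * moment_ratio a b c d i j)
         * mass a b c d q \<beta>"
    by (simp only: sum_distrib_left sum_distrib_right mult.assoc)
  ultimately show ?thesis by (simp only:)
qed

lemma aw_dual_moment_eq_0: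
  assumes nz: "a \<noteq> 0" "b \<noteq> 0" "c \<noteq> 0" "d \<noteq> 0"
    and lt: "norm q * norm (a * b * c * d) < norm q ^ (2 * n)" and "j < n"
  shows "(\<Sum>i\<le>n. aw_coeff a b c d n i * moment_ratio a b c d i j) = 0"
proof -
  have V: "q powi (int n - 1) / (a * b * c * d) = 1 / (a * b * c * d) * q ^ (n - 1)"
  proof -
    have "int n - 1 = int (n - 1)" using assms(6) by simp
    then have "q powi (int n - 1) = q ^ (n - 1)" by (simp only: power_int_of_nat)
    then show ?thesis by (simp only: times_divide_eq_left mult_1_left)
  qed
  have "(\<Sum>i\<le>n. aw_coeff a b c d n i * moment_ratio a b c d i j) =
    qpoch (- 1 / (a * b)) q n * qpoch (- 1 / (a * c)) q n * qpoch (- 1 / (a * d)) q n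
      * qpoch (- 1 / (b * c)) q j * qpoch (- 1 / (b * d)) q j *
    (\<Sum>i\<le>n. qbinom_coeff n i * q ^ i * (qpoch (- 1 / (a * b) * q ^ i) q j
      * qpoch (1 / (a * b * c * d) * q ^ (n - 1)) q i / qpoch (1 / (a * b * c * d)) q (i + j)))"
    unfolding sum_distrib_left V[symmetric] by (intro sum.cong refl aw_coeff_moment_ratio) auto
  then show ?thesis
    by (simp only: terminating_sum_eq_0[OF assms(6) convergence_imp_generic(1)[OF nz lt]] mult_zero_right)
qed

lemma prod_power_choose_2: "(\<Prod>l<n. q ^ l) = q ^ (n choose 2)"
  by (induction n) (simp_all add: numeral_2_eq_2 power_add)

lemma aw_dual_moment_diagonal:
  assumes nz: "a \<noteq> 0" "b \<noteq> 0" "c \<noteq> 0" "d \<noteq> 0"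
    and lt: "norm q * norm (a * b * c * d) < norm q ^ (2 * n)"
  shows "(\<Sum>i\<le>n. aw_coeff a b c d n i * moment_ratio a b c d i n) =
    qpochs [q, - 1 / (a * b), - 1 / (a * c), - 1 / (a * d),
               - 1 / (b * c), - 1 / (b * d), - 1 / (c * d)] q n
      * q ^ (n choose 2) / (a * b) ^ n / qpoch (1 / (a * b * c * d)) q (2 * n)"
proof -
  define Y where "Y = 1 / (a * b * c * d)"
  define V where "V = q powi (int n - 1) / (a * b * c * d)"
  define X where "X = - 1 / (a * b)"
  have VY: "V * q = Y * q ^ n"
    unfolding V_def Y_def by (simp add: power_int_diff)
  have p: "(\<Prod>l<n. V - X * q ^ l) = q ^ (n choose 2) / (a * b) ^ n * qpoch (- 1 / (c * d)) q n"
  proof -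
    have "(\<Prod>l<n. V - X * q ^ l) = (\<Prod>l<n. q ^ l / (a * b) * (1 - (- 1 / (c * d)) * q ^ (n - Suc l)))"
    proof (intro prod.cong refl)
      fix l assume l: "l \<in> {..<n}"
      have "V = q ^ l * q ^ (n - Suc l) / (a * b * c * d)"
      proof -
        have "int n - 1 = int (l + (n - Suc l))" using l by simp
        then show ?thesis unfolding V_def power_add[symmetric] by (simp only: power_int_of_nat)
      qed
      then show "V - X * q ^ l = q ^ l / (a * b) * (1 - (- 1 / (c * d)) * q ^ (n - Suc l))"
        unfolding X_def using nz by (simp add: field_simps)
    qed
    also have "\<dots> = (\<Prod>l<n. q ^ l) / (\<Prod>l<n. a * b) * (\<Prod>l<n. 1 - (- 1 / (c * d)) * q ^ (n - Suc l))"
      by (simp only: prod.distrib prod_dividef)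
    also have "(\<Prod>l<n. 1 - (- 1 / (c * d)) * q ^ (n - Suc l)) = qpoch (- 1 / (c * d)) q n"
      unfolding qpoch_def by (rule prod.nat_diff_reindex)
    finally show ?thesis by (simp add: prod_power_choose_2)
  qed
  have "(\<Sum>i\<le>n. aw_coeff a b c d n i * moment_ratio a b c d i n) =
    qpoch (- 1 / (a * b)) q n * qpoch (- 1 / (a * c)) q n * qpoch (- 1 / (a * d)) q n
      * qpoch (- 1 / (b * c)) q n * qpoch (- 1 / (b * d)) q n *
    (\<Sum>i\<le>n. qbinom_coeff n i * q ^ i * (qpoch (X * q ^ i) q n
      * qpoch V q i / qpoch Y q (i + n)))"
    unfolding sum_distrib_left X_def V_def Y_def by (intro sum.cong refl aw_coeff_moment_ratio) auto
  also have "(\<Sum>i\<le>n. qbinom_coeff n i * q ^ i * (qpoch (X * q ^ i) q n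
      * qpoch V q i / qpoch Y q (i + n)))
    = (\<Prod>l<n. V - X * q ^ l) * qpoch q q n / qpoch Y q (2 * n)"
    by (rule terminating_sum_diagonal[OF VY])
       (use convergence_imp_generic[OF nz lt] nz in \<open>auto simp: Y_def V_def\<close>)
  finally show ?thesis
    unfolding p qpochs_def Y_def by (simp add: mult_ac)
qed

lemma aw_leading_coeff:
  "aw_coeff a b c d n n * q ^ (n choose 2) = (- 1) ^ n * qpoch (q powi (int n - 1) / (a * b * c * d)) q n"
proof -
  have "qbinom_coeff n n * q ^ n * q ^ (n choose 2) = (- 1) ^ n"
  proof (induction n)
    case 0
    then show ?case by (simp add: numeral_2_eq_2)
  next
    case (Suc n)
    have "qbinom_coeff (Suc n) (Suc n) * q ^ Suc n * q ^ (Suc n choose 2)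
       = - (qbinom_coeff n n * q ^ n * q ^ (n choose 2))"
      unfolding qbinom_coeff_pascal by (simp add: qbinom_coeff_eq_0 numeral_2_eq_2 power_add)
    then show ?case unfolding Suc.IH by simp
  qed
  then show ?thesis unfolding aw_coeff_def by (simp add: mult_ac)
qed

text \<open>
  The left-hand side is the leading coefficient of the second polynomial in the basis of \<open>b\<close>, times the
  diagonal moment of the first one.
\<close>

lemma hnorm_eq_dual_moment:
  assumes nz: "a \<noteq> 0" "b \<noteq> 0" "c \<noteq> 0" "d \<noteq> 0"
    and lt: "norm q * norm (a * b * c * d) < norm q ^ (2 * n)"
  shows "aw_prefactor a b c d n * aw_coeff a b c d n n * (b / a) ^ n *
    (aw_prefactor a b c d n * (\<Sum>i\<le>n. aw_coeff a b c d n i * moment_ratio a b c d i n)) = hnorm n a b c d q"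
proof -
  define L where "L = qpochs [q, - 1 / (a * b), - 1 / (a * c), - 1 / (a * d),
               - 1 / (b * c), - 1 / (b * d), - 1 / (c * d)] q n"
  define Y2 where "Y2 = qpoch (1 / (a * b * c * d)) q (2 * n)"
  define Z where "Z = qpoch (1 / (q * a * b * c * d)) q n"
  define V where "V = qpoch (q powi (int n - 1) / (a * b * c * d)) q n"
  define C where "C = q ^ (n choose 2)"
  have Z0: "Z \<noteq> 0" unfolding Z_def by (intro qpoch_nonzero convergence_imp_generic(3)[OF nz lt])
  have ZV: "qpoch (1 / (q * a * b * c * d)) q (2 * n) = Z * V"
  proof -
    have "1 / (q * a * b * c * d) * q ^ n = q powi (int n - 1) / (a * b * c * d)"
      using nz by (simp add: power_int_diff field_simps)
    then show ?thesis unfolding mult_2 qpoch_add Z_def V_def by simp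
  qed
  have pw: "(- (a\<^sup>2 * b * c * d)) ^ n * (- (a\<^sup>2 * b * c * d)) ^ n * (- 1) ^ n * (b / a) ^ n / (a * b) ^ n
      = (- (a\<^sup>2 * b\<^sup>2 * c\<^sup>2 * d\<^sup>2)) ^ n"
    unfolding power_mult_distrib[symmetric] power_divide[symmetric]
    by (rule arg_cong[where f = "\<lambda>x. x ^ n"]) (use nz in \<open>simp add: power2_eq_square\<close>)
  have q6: "q powi (- 3 * int (n choose 2)) * q powi (- 3 * int (n choose 2)) = q powi (- 6 * int (n choose 2))"
    by (simp flip: power_int_add)
  have C0: "C \<noteq> 0" by (simp add: C_def)
  have lead: "aw_coeff a b c d n n * C = (- 1) ^ n * V"
    unfolding C_def V_def by (rule aw_leading_coeff)
  have "aw_prefactor a b c d n * aw_coeff a b c d n n * (b / a) ^ n *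
    (aw_prefactor a b c d n * (L * C / (a * b) ^ n / Y2))
    = aw_prefactor a b c d n * (aw_coeff a b c d n n * C) * (b / a) ^ n *
      aw_prefactor a b c d n * L / (a * b) ^ n / Y2"
    by (simp add: mult_ac)
  also have "\<dots> = (q powi (- 3 * int (n choose 2)) * q powi (- 3 * int (n choose 2)))
     * ((- (a\<^sup>2 * b * c * d)) ^ n * (- (a\<^sup>2 * b * c * d)) ^ n * (- 1) ^ n * (b / a) ^ n / (a * b) ^ n)
     * L * V / Y2"
    unfolding lead aw_prefactor_def
    by (simp only: mult_ac times_divide_eq_left times_divide_eq_right divide_divide_eq_left)
  also have "\<dots> = hnorm n a b c d q"
    unfolding q6 pw hnorm_def ZV L_def[symmetric] Y2_def[symmetric] Z_def[symmetric]
    using Z0 by simp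
  finally show ?thesis
    unfolding aw_dual_moment_diagonal[OF assms] L_def Y2_def C_def .
qed

lemma Psi_summand_eq_weight:
  assumes "\<beta> \<noteq> 0"
  shows "Psi_summand m n a b c d q \<beta> k =
    qinv_askey_wilson n (q powi k * \<beta>) a b c d q * qinv_askey_wilson m (q powi k * \<beta>) a b c d q
      * weight a b c d q \<beta> k"
proof -
  have "qpochs_inf [- (q powi (k + 1)) * \<beta> * t, q powi (1 - k) * t / \<beta>] q = wpair q t (q powi k * \<beta>)" for t
    using assms by (simp add: qpochs_inf_def wpair_def power_int_add power_int_diff mult_ac)
  moreover have "q powi (2 * k) = (q powi k)\<^sup>2" by (rule power_int_double)
  ultimately show ?thesis
    unfolding Psi_summand_def weight_def wcore_def
    by (simp add: power_mult_distrib mult_ac)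
qed

lemma Psi_summand_swap: "Psi_summand m n a b c d q \<beta> k = Psi_summand n m a b c d q \<beta> k"
  unfolding Psi_summand_def by (simp add: mult_ac)

text \<open>
  By symmetry \<open>m \<le> n\<close>; the polynomial of degree \<open>m\<close> is expanded in the basis of \<open>b\<close>, and all moments
  of the other one below \<open>n\<close> vanish.
\<close>

theorem Psi_has_sum:
  assumes nz: "a \<noteq> 0" "b \<noteq> 0" "c \<noteq> 0" "d \<noteq> 0" "\<beta> \<noteq> 0"
    and lt: "norm q * norm (a * b * c * d) < norm q ^ (2 * N)" and "n \<le> N" "m \<le> N"
  shows "(Psi_summand m n a b c d q \<beta> has_sum
     hnorm n a b c d q * (if m = n then 1 else 0) * mass a b c d q \<beta>) UNIV"
proof -
  have ordered: "(Psi_summand m n a b c d q \<beta> has_sum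
     hnorm n a b c d q * (if m = n then 1 else 0) * mass a b c d q \<beta>) UNIV"
    if "m \<le> n" "n \<le> N" for m n
  proof -
    have "norm q ^ (2 * N) \<le> norm q ^ (2 * n)"
      using that norm_q by (intro power_decreasing) auto
    then have ltn: "norm q * norm (a * b * c * d) < norm q ^ (2 * n)" using lt by linarith
    define D where "D = (\<lambda>j. aw_prefactor a b c d n * (\<Sum>i\<le>n. aw_coeff a b c d n i * moment_ratio a b c d i j))"
    obtain e where e: "\<And>z. z \<noteq> 0 \<Longrightarrow> qinv_askey_wilson m z a b c d q = (\<Sum>j\<le>m. e j * factorial_basis q b z j)"
      and em: "e m = aw_prefactor a b c d m * aw_coeff a b c d m m * (b / a) ^ m"
      using factorial_basis_change_sum[OF nz(1,2), where m = m and c = "\<lambda>k. aw_prefactor a b c d m * aw_coeff a b c d m k"]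
        qinv_askey_wilson_factorial_expansion[OF nz(1,2,3,4)] by auto
    have "((\<lambda>k. \<Sum>j\<le>m. e j * (qinv_askey_wilson n (q powi k * \<beta>) a b c d q
        * factorial_basis q b (q powi k * \<beta>) j * weight a b c d q \<beta> k)) has_sum
        (\<Sum>j\<le>m. e j * (D j * mass a b c d q \<beta>))) UNIV"
      unfolding D_def using that
      by (intro has_sum_finite_sum has_sum_cmult_right aw_dual_moment nz ltn) auto
    moreover have "(\<Sum>j\<le>m. e j * (qinv_askey_wilson n (q powi k * \<beta>) a b c d q
        * factorial_basis q b (q powi k * \<beta>) j * weight a b c d q \<beta> k))
        = Psi_summand m n a b c d q \<beta> k" for k
      unfolding Psi_summand_eq_weight[OF nz(5)] using nz
      by (subst e) (auto simp only: sum_distrib_left sum_distrib_right mult_ac simp_thms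
            mult_eq_0_iff power_int_eq_0_iff q_nonzero)
    moreover have "(\<Sum>j\<le>m. e j * (D j * mass a b c d q \<beta>))
        = hnorm n a b c d q * (if m = n then 1 else 0) * mass a b c d q \<beta>"
    proof -
      have D0: "D j = 0" if "j < n" for j
        unfolding D_def using aw_dual_moment_eq_0[OF nz(1-4) ltn that] by simp
      have "(\<Sum>j\<le>m. e j * (D j * mass a b c d q \<beta>)) = (\<Sum>j\<le>m. if j = n then e j * D j * mass a b c d q \<beta> else 0)"
        using that D0 by (intro sum.cong) auto
      also have "\<dots> = (if m = n then e n * D n * mass a b c d q \<beta> else 0)"
        using that by auto
      also have "\<dots> = hnorm n a b c d q * (if m = n then 1 else 0) * mass a b c d q \<beta>"
        using hnorm_eq_dual_moment[OF nz(1-4) ltn] em unfolding D_def by auto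
      finally show ?thesis .
    qed
    ultimately show ?thesis by simp
  qed
  show ?thesis
  proof (cases "m \<le> n")
    case True
    then show ?thesis using ordered assms by blast
  next
    case False
    have "Psi_summand m n a b c d q \<beta> = Psi_summand n m a b c d q \<beta>"
      by (rule ext) (rule Psi_summand_swap)
    then show ?thesis using ordered[of n m] False assms by simp
  qed
qed

end

section \<open>The complex Gaussian integral\<close>

text \<open>
  The segment from \<open>n\<close> to \<open>wn + v\<close> has length \<open>O(n)\<close> and lies, up to a bounded shift, in the sector
  \<open>|Im z| < Re z\<close> at a distance proportional to \<open>n\<close> from its boundary; there the integrand \<open>exp (-z\<^sup>2)\<close> decays
  like a Gaussian.
\<close>

lemma gaussian_primitive_asymptotic:
  fixes \<Phi> :: "complex \<Rightarrow> complex"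
  assumes \<Phi>: "\<And>z. (\<Phi> has_field_derivative exp (- (z\<^sup>2))) (at z)"
    and w: "\<bar>Im w\<bar> < Re w"
  shows "(\<lambda>n. \<Phi> (w * of_nat n + v) - \<Phi> (of_nat n)) \<longlonglongrightarrow> 0"
proof -
  define \<delta> where "\<delta> = min 1 (Re w - \<bar>Im w\<bar>)"
  have \<delta>: "\<delta> > 0" "\<delta> \<le> 1" "\<delta> \<le> Re w - \<bar>Im w\<bar>" using w by (auto simp: \<delta>_def)
  define V where "V = norm v"
  define W where "W = norm (w - 1)"
  have V0: "V \<ge> 0" by (simp add: V_def)
  have bound: "norm (\<Phi> (w * of_nat n + v) - \<Phi> (of_nat n)) \<le>
      exp (- ((real n * \<delta> - 2 * V)\<^sup>2)) * (real n * W + V)" if n: "real n * \<delta> > 2 * V" for n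
  proof -
    define S where "S = closed_segment (complex_of_real (real n)) (w * of_nat n + v)"
    have "norm (\<Phi> (w * of_nat n + v) - \<Phi> (of_nat n)) \<le>
       exp (- ((real n * \<delta> - 2 * V)\<^sup>2)) * norm ((w * of_nat n + v) - of_nat n)"
    proof (rule field_differentiable_bound[where S = S and f' = "\<lambda>z. exp (- (z\<^sup>2))"])
      show "convex S" by (simp add: S_def)
      show "(\<Phi> has_field_derivative exp (- (z\<^sup>2))) (at z within S)" for z
        using \<Phi> by (rule has_field_derivative_at_within)
      show "w * of_nat n + v \<in> S" "of_nat n \<in> S" by (auto simp: S_def)
      fix z assume "z \<in> S"
      then obtain t where t: "0 \<le> t" "t \<le> 1"
        and z: "z = (1 - t) *\<^sub>R complex_of_real (real n) + t *\<^sub>R (w * of_nat n + v)"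
        by (auto simp: S_def closed_segment_def)
      have Rez: "Re z = real n * ((1 - t) + t * Re w) + t * Re v"
        by (simp add: z algebra_simps)
      have Imz: "Im z = real n * (t * Im w) + t * Im v"
        by (simp add: z algebra_simps)
      have tv: "\<bar>t * Re v\<bar> \<le> V" "\<bar>t * Im v\<bar> \<le> V"
        using abs_Re_le_cmod[of v] abs_Im_le_cmod[of v] t
          mult_left_le_one_le[of "\<bar>Re v\<bar>" t] mult_left_le_one_le[of "\<bar>Im v\<bar>" t]
        by (auto simp: V_def abs_mult)
      (* The sector is convex and contains 1 and w, which bounds the distance from its boundary along the segment. *)
      have cone: "\<delta> \<le> (1 - t) + t * (Re w - \<bar>Im w\<bar>)"
      proof -
        have "(1 - t) * \<delta> + t * \<delta> \<le> (1 - t) * 1 + t * (Re w - \<bar>Im w\<bar>)"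
          using t \<delta> by (intro add_mono mult_left_mono) auto
        then show ?thesis by (simp add: algebra_simps)
      qed
      have "\<bar>Im z\<bar> \<le> real n * (t * \<bar>Im w\<bar>) + V"
        using abs_triangle_ineq[of "real n * (t * Im w)" "t * Im v"] tv t
        by (simp add: Imz abs_mult)
      moreover have "real n * \<delta> \<le> real n * ((1 - t) + t * (Re w - \<bar>Im w\<bar>))"
        using cone by (intro mult_left_mono) auto
      moreover have "\<dots> = real n * ((1 - t) + t * Re w) - real n * (t * \<bar>Im w\<bar>)"
        by (simp add: algebra_simps)
      moreover have "Re z \<ge> real n * ((1 - t) + t * Re w) - V"
        using tv(1) unfolding Rez by linarith
      ultimately have d: "real n * \<delta> - 2 * V \<le> Re z - \<bar>Im z\<bar>"
        by linarith
      then have p: "Re z + \<bar>Im z\<bar> \<ge> real n * \<delta> - 2 * V" by linarith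
      have "(real n * \<delta> - 2 * V)\<^sup>2 \<le> (Re z - \<bar>Im z\<bar>) * (Re z + \<bar>Im z\<bar>)"
        unfolding power2_eq_square using d p n by (intro mult_mono) auto
      also have "\<dots> = Re (z\<^sup>2)"
        by (simp add: power2_eq_square algebra_simps)
      finally show "norm (exp (- (z\<^sup>2))) \<le> exp (- ((real n * \<delta> - 2 * V)\<^sup>2))"
        by simp
    qed
    also have "norm ((w * of_nat n + v) - of_nat n) \<le> real n * W + V"
    proof -
      have e: "(w * of_nat n + v) - of_nat n = of_nat n * (w - 1) + v" by (simp add: algebra_simps)
      show ?thesis unfolding e
        using norm_triangle_ineq[of "of_nat n * (w - 1)" v] by (simp add: norm_mult V_def W_def)
    qed
    finally show ?thesis by simp
  qed
  have lim: "(\<lambda>n. exp (- ((real n * \<delta> - 2 * V)\<^sup>2)) * (real n * W + V)) \<longlonglongrightarrow> 0"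
    using \<delta>(1) by real_asymp
  have "\<forall>\<^sub>F n in sequentially. real n * \<delta> > 2 * V"
    using \<delta>(1) by real_asymp
  then have "\<forall>\<^sub>F n in sequentially. norm (\<Phi> (w * of_nat n + v) - \<Phi> (of_nat n)) \<le>
      exp (- ((real n * \<delta> - 2 * V)\<^sup>2)) * (real n * W + V)"
    by eventually_elim (rule bound)
  then show ?thesis using lim by (rule Lim_null_comparison)
qed

lemma integral_symmetric_interval_LIMSEQ:
  fixes f :: "real \<Rightarrow> complex"
  assumes f: "integrable lborel f"
  shows "(\<lambda>n. LINT x:{- real n..real n}|lborel. f x) \<longlonglongrightarrow> (LINT x|lborel. f x)"
  unfolding set_lebesgue_integral_def
proof (rule integral_dominated_convergence[where w = "\<lambda>x. norm (f x)"])
  show "AE x in lborel. (\<lambda>n. indicat_real {- real n..real n} x *\<^sub>R f x) \<longlonglongrightarrow> f x"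
  proof (rule AE_I2)
    fix x :: real
    obtain N where N: "\<bar>x\<bar> \<le> real N" using real_arch_simple by blast
    have "\<forall>\<^sub>F n in sequentially. indicat_real {- real n..real n} x *\<^sub>R f x = f x"
      unfolding eventually_sequentially
      by (rule exI[of _ N]) (use N in \<open>auto simp: indicator_def abs_le_iff intro: order_trans\<close>)
    then show "(\<lambda>n. indicat_real {- real n..real n} x *\<^sub>R f x) \<longlonglongrightarrow> f x"
      by (rule tendsto_eventually)
  qed
qed (use f in \<open>auto simp: indicator_def borel_measurable_integrable\<close>)

lemma integrable_complex_gaussian:
  assumes "Re s > 0"
  shows "integrable lborel (\<lambda>x. exp (- s * (of_real x)\<^sup>2 + B * of_real x))"
proof -
  define \<sigma> where "\<sigma> = Re s"
  define b where "b = Re B"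
  have s: "\<sigma> > 0" using assms by (simp add: \<sigma>_def)
  define C where "C = exp (b\<^sup>2 / (4 * \<sigma>)) * sqrt (2 * pi * (1 / sqrt (2 * \<sigma>))\<^sup>2)"
  have "integrable lborel (\<lambda>x. C * normal_density (b / (2 * \<sigma>)) (1 / sqrt (2 * \<sigma>)) x)"
    using s by (intro integrable_mult_right integrable_normal_density) auto
  moreover have "norm (exp (- s * (of_real x)\<^sup>2 + B * of_real x)) = C * normal_density (b / (2 * \<sigma>)) (1 / sqrt (2 * \<sigma>)) x" for x
  proof -
    have "norm (exp (- s * (of_real x)\<^sup>2 + B * of_real x)) = exp (- \<sigma> * x\<^sup>2 + b * x)"
      by (simp add: \<sigma>_def b_def flip: of_real_power)
    also have "- \<sigma> * x\<^sup>2 + b * x = b\<^sup>2 / (4 * \<sigma>) + (- ((x - b / (2 * \<sigma>))\<^sup>2 / (2 * (1 / sqrt (2 * \<sigma>))\<^sup>2)))"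
      using s by (simp add: power_divide power2_diff field_simps) (simp add: power2_eq_square)
    finally show ?thesis
      using s unfolding exp_add C_def normal_density_def by simp
  qed
  ultimately have "integrable lborel (\<lambda>x. norm (exp (- s * (of_real x)\<^sup>2 + B * of_real x)))"
    by simp
  then show ?thesis
    by (subst (asm) integrable_norm_iff)
       (auto intro!: borel_measurable_continuous_onI continuous_intros)
qed

text \<open>
  Rotation of the contour.  After completing the square, the truncated integral is, up to a constant factor, a difference of
  values of a primitive of \<open>exp (-z\<^sup>2)\<close> at the end points \<open>\<plusminus>wn + v\<close> with \<open>w = \<surd>s\<close>, and these may be replaced by
  \<open>\<plusminus>n\<close>.  The principal root is the one that lies in the sector \<open>|Im w| < Re w\<close>.
\<close>

lemma integral_complex_gaussian:
  assumes s: "Re s > 0"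
  shows "(LINT x|lborel. exp (- s * (of_real x)\<^sup>2 + B * of_real x)) =
    complex_of_real (sqrt pi) / csqrt s * exp (B\<^sup>2 / (4 * s))"
proof -
  have "(\<lambda>z::complex. exp (- (z\<^sup>2))) holomorphic_on UNIV" by (intro holomorphic_intros)
  then have "\<exists>\<Phi>::complex \<Rightarrow> complex. \<forall>z. (\<Phi> has_field_derivative exp (- (z\<^sup>2))) (at z)"
  proof (rule holomorphic_convex_primitive'[OF convex_UNIV open_UNIV])
    fix g :: "complex \<Rightarrow> complex"
    assume "\<And>z. z \<in> UNIV \<Longrightarrow> (g has_field_derivative exp (- (z\<^sup>2))) (at z within UNIV)"
    then show ?thesis by (intro exI[of _ g]) simp
  qed
  then obtain \<Phi> :: "complex \<Rightarrow> complex" where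
    \<Phi>: "\<And>z. (\<Phi> has_field_derivative exp (- (z\<^sup>2))) (at z)" by auto
  define w where "w = csqrt s"
  have w2: "w\<^sup>2 = s" by (simp add: w_def)
  have s0: "s \<noteq> 0" using s by auto
  have w0: "w \<noteq> 0" using s0 by (simp add: w_def)
  have w: "\<bar>Im w\<bar> < Re w"
  proof -
    have "Re (w\<^sup>2) > 0" using s w2 by simp
    then have "(Im w)\<^sup>2 < (Re w)\<^sup>2" by (simp add: power2_eq_square)
    moreover have "Re w \<ge> 0" unfolding w_def using csqrt_principal[of s] by auto
    ultimately show ?thesis using abs_square_less_1 power2_less_imp_less[of "\<bar>Im w\<bar>" "Re w"] by simp
  qed
  have FTC: "(LINT x:{- real n..real n}|lborel. w' * exp (- ((w' * of_real x + v')\<^sup>2)))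
      = \<Phi> (w' * of_nat n + v') - \<Phi> (- w' * of_nat n + v')" for n w' v'
  proof -
    have "(LINT x|lborel. indicator {- real n..real n} x *\<^sub>R (w' * exp (- ((w' * of_real x + v')\<^sup>2))))
      = \<Phi> (w' * of_real (real n) + v') - \<Phi> (w' * of_real (- real n) + v')"
    proof (rule integral_FTC_Icc)
      fix x :: real
      have "((\<lambda>z. \<Phi> (w' * z + v')) has_field_derivative exp (- ((w' * of_real x + v')\<^sup>2)) * (w' * 1 + 0))
          (at (of_real x))"
        by (rule DERIV_chain2[OF \<Phi>]) (auto intro!: derivative_eq_intros)
      then have "((\<lambda>x. \<Phi> (w' * of_real x + v')) has_vector_derivative exp (- ((w' * of_real x + v')\<^sup>2)) * w') (at x)"
        using has_vector_derivative_real_field by fastforce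
      then show "((\<lambda>x. \<Phi> (w' * of_real x + v')) has_vector_derivative w' * exp (- ((w' * of_real x + v')\<^sup>2)))
          (at x within {- real n..real n})"
        by (simp add: has_vector_derivative_at_within mult.commute)
    qed (auto intro!: continuous_intros)
    then show ?thesis
      by (simp only: set_lebesgue_integral_def of_real_minus of_real_of_nat_eq mult_minus_right mult_minus_left)
  qed
  define D where "D = (\<lambda>w v n. \<Phi> (w * of_nat n + v) - \<Phi> (- w * of_nat n + v))"
  have real_case: "D 1 0 \<longlonglongrightarrow> complex_of_real (sqrt pi)"
  proof -
    have i: "integrable lborel (\<lambda>x. exp (- (complex_of_real x)\<^sup>2))"
      using integrable_complex_gaussian[of 1 0] by simp
    have "(LINT x|lborel. exp (- (complex_of_real x)\<^sup>2)) = complex_of_real (sqrt pi)"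
    proof -
      have "(LINT x|lborel. exp (- (complex_of_real x)\<^sup>2)) = (LINT x|lborel. complex_of_real (exp (- x\<^sup>2)))"
        by (simp flip: of_real_power exp_of_real of_real_minus)
      also have "\<dots> = complex_of_real (LINT x|lborel. exp (- x\<^sup>2))"
        by (rule integral_complex_of_real)
      also have "(LINT x|lborel. exp (- x\<^sup>2)) = (LINT x|lborel. sqrt pi * normal_density 0 (1 / sqrt 2) x)"
        by (simp add: normal_density_def power_divide)
      also have "\<dots> = sqrt pi"
        by simp
      finally show ?thesis .
    qed
    then show ?thesis
      using integral_symmetric_interval_LIMSEQ[OF i] FTC[of _ 1 0] by (simp add: D_def)
  qed
  define v where "v = - B / (2 * w)"
  have "D w v \<longlonglongrightarrow> complex_of_real (sqrt pi)"
  proof -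
    have 1: "(\<lambda>n. \<Phi> (w * of_nat n + v) - \<Phi> (of_nat n)) \<longlonglongrightarrow> 0"
      by (rule gaussian_primitive_asymptotic[OF \<Phi> w])
    have "((\<lambda>z. - \<Phi> (- z)) has_field_derivative exp (- (z\<^sup>2))) (at z)" for z
    proof -
      have "((\<lambda>z. \<Phi> (- z)) has_field_derivative exp (- ((- z)\<^sup>2)) * (- 1)) (at z)"
        by (rule DERIV_chain2[OF \<Phi>]) (auto intro!: derivative_eq_intros)
      from DERIV_minus[OF this] show ?thesis by simp
    qed
    then have 2: "(\<lambda>n. - \<Phi> (- (w * of_nat n + (- v))) - (- \<Phi> (- (of_nat n)))) \<longlonglongrightarrow> 0"
      by (rule gaussian_primitive_asymptotic[OF _ w])
    have "(\<lambda>n. (\<Phi> (w * of_nat n + v) - \<Phi> (of_nat n)) + (- \<Phi> (- (w * of_nat n + (- v))) - (- \<Phi> (- (of_nat n))))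
       + D 1 0 n) \<longlonglongrightarrow> 0 + 0 + complex_of_real (sqrt pi)"
      by (intro tendsto_add 1 2 real_case)
    then show ?thesis by (simp add: D_def)
  qed
  then have "(\<lambda>n. exp (B\<^sup>2 / (4 * s)) / w * D w v n) \<longlonglongrightarrow> exp (B\<^sup>2 / (4 * s)) / w * complex_of_real (sqrt pi)"
    by (rule tendsto_mult_left)
  moreover have "exp (B\<^sup>2 / (4 * s)) / w * D w v n =
     (LINT x:{- real n..real n}|lborel. exp (- s * (of_real x)\<^sup>2 + B * of_real x))" for n
  proof -
    have e: "exp (- s * (of_real x)\<^sup>2 + B * of_real x) =
        exp (B\<^sup>2 / (4 * s)) / w * (w * exp (- ((w * of_real x + v)\<^sup>2)))" for x
    proof -
      have "2 * w * v = - B" using w0 by (simp add: v_def)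
      moreover have "v\<^sup>2 = B\<^sup>2 / (4 * s)" by (simp add: v_def power_divide power_mult_distrib w2)
      moreover have "(w * of_real x + v)\<^sup>2 = w\<^sup>2 * (of_real x)\<^sup>2 + 2 * w * v * of_real x + v\<^sup>2"
        by (simp add: power2_eq_square algebra_simps)
      ultimately have "- s * (of_real x)\<^sup>2 + B * of_real x = B\<^sup>2 / (4 * s) + (- ((w * of_real x + v)\<^sup>2))"
        by (simp add: w2)
      then have "exp (- s * (of_real x)\<^sup>2 + B * of_real x) =
          exp (B\<^sup>2 / (4 * s)) * exp (- ((w * of_real x + v)\<^sup>2))"
        by (simp only: exp_add)
      then show ?thesis using w0 by simp
    qed
    show ?thesis
      unfolding e D_def FTC[symmetric] by (simp only: set_integral_mult_right)
  qed
  ultimately have "(\<lambda>n. LINT x:{- real n..real n}|lborel. exp (- s * (of_real x)\<^sup>2 + B * of_real x))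
      \<longlonglongrightarrow> exp (B\<^sup>2 / (4 * s)) / w * complex_of_real (sqrt pi)" by simp
  with integral_symmetric_interval_LIMSEQ[OF integrable_complex_gaussian[OF s]]
  have "(LINT x|lborel. exp (- s * (of_real x)\<^sup>2 + B * of_real x)) =
      exp (B\<^sup>2 / (4 * s)) / w * complex_of_real (sqrt pi)"
    by (rule LIMSEQ_unique)
  then show ?thesis by (simp add: w_def mult.commute)
qed

section \<open>Unfolding an integral over the line\<close>

text \<open>
  The integral of such a function over the line may be cut into unit pieces.  The class is closed
  under linear combinations, so it suffices to deal with weights without polynomial factors.
\<close>

definition periodizable :: "(real \<Rightarrow> complex) \<Rightarrow> bool" where
  "periodizable F \<longleftrightarrow> F \<in> borel_measurable borel \<and>
     (\<exists>U::int \<Rightarrow> real. U summable_on UNIV \<and> (\<forall>x\<in>{0..1}. \<forall>k. norm (F (x + of_int k)) \<le> U k))"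

lemma periodizable_cmult:
  assumes "periodizable F"
  shows "periodizable (\<lambda>x. c * F x)"
proof -
  obtain U where "U summable_on UNIV" "\<forall>x\<in>{0..1}. \<forall>k::int. norm (F (x + of_int k)) \<le> U k"
    using assms by (auto simp: periodizable_def)
  then have "(\<lambda>k. norm c * U k) summable_on UNIV"
    "\<forall>x\<in>{0..1}. \<forall>k::int. norm (c * F (x + of_int k)) \<le> norm c * U k"
    by (auto intro!: summable_on_cmult_right mult_left_mono simp: norm_mult)
  then show ?thesis using assms by (auto simp: periodizable_def)
qed

lemma periodizable_sum:
  assumes "finite I" "\<And>i. i \<in> I \<Longrightarrow> periodizable (F i)"
  shows "periodizable (\<lambda>x. \<Sum>i\<in>I. F i x)"
  using assms
proof (induction I rule: finite_induct)
  case empty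
  then show ?case by (auto simp: periodizable_def intro!: exI[of _ "\<lambda>_. 0"])
next
  case (insert i I)
  then have "periodizable (F i)" "periodizable (\<lambda>x. \<Sum>i\<in>I. F i x)" by auto
  then obtain U V where "U summable_on UNIV" "V summable_on UNIV"
    "\<forall>x\<in>{0..1}. \<forall>k::int. norm (F i (x + of_int k)) \<le> U k"
    "\<forall>x\<in>{0..1}. \<forall>k::int. norm (\<Sum>i\<in>I. F i (x + of_int k)) \<le> V k"
    and meas: "F i \<in> borel_measurable borel" "(\<lambda>x. \<Sum>i\<in>I. F i x) \<in> borel_measurable borel"
    unfolding periodizable_def by blast
  then have "(\<lambda>k. U k + V k) summable_on UNIV"
    "\<forall>x\<in>{0..1}. \<forall>k::int. norm (F i (x + of_int k) + (\<Sum>i\<in>I. F i (x + of_int k))) \<le> U k + V k"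
    by (auto intro!: summable_on_add norm_triangle_le add_mono)
  moreover have "(\<lambda>x. F i x + (\<Sum>i\<in>I. F i x)) \<in> borel_measurable borel"
    using meas by (rule borel_measurable_add)
  ultimately show ?case using insert by (auto simp: periodizable_def)
qed

text \<open>
  Sum and integral are interchanged twice: for the pieces on \<open>[k, k + 1)\<close>, whose sum is \<open>F\<close>, and for their
  translates to \<open>[0, 1]\<close>.  The two kinds of pieces agree up to the end point 1, a null set.
\<close>

lemma periodizable_unfold:
  assumes "periodizable F"
  shows "integrable lborel F"
    and "set_integrable lborel {0..1} (\<lambda>x. \<Sum>\<^sub>\<infinity>k::int. F (x + of_int k))"
    and "(LINT x|lborel. F x) = (LINT x:{0..1}|lborel. \<Sum>\<^sub>\<infinity>k::int. F (x + of_int k))"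
proof -
  obtain U where U: "U summable_on UNIV" "\<And>x k. x \<in> {0..1} \<Longrightarrow> norm (F (x + of_int k)) \<le> U k"
    and F [measurable]: "F \<in> borel_measurable borel"
    using assms by (auto simp: periodizable_def)
  define \<kappa> where "\<kappa> = (\<lambda>n. real_of_int (int_decode n))"
  define h where "h = (\<lambda>n x. indicat_real {0..1} x *\<^sub>R F (x + \<kappa> n))"
  define f where "f = (\<lambda>n x. indicat_real {\<kappa> n..<\<kappa> n + 1} x *\<^sub>R F x)"
  have sumU: "summable (\<lambda>n. U (int_decode n))"
    using summable_on_reindex_bij_betw[OF bij_int_decode, of U] U(1)
    by (intro summable_on_imp_summable) simp
  have hb: "norm (h n x) \<le> indicat_real {0..1} x * U (int_decode n)" for n x
    using U(2)[of x "int_decode n"] by (auto simp: h_def \<kappa>_def indicator_def)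
  have ih: "integrable lborel (h n)" for n
    unfolding h_def
    by (rule integrableI_bounded_set_indicator[where B = "U (int_decode n)"])
       (use U(2) in \<open>auto simp: \<kappa>_def\<close>)
  have nh: "(LINT x|lborel. norm (h n x)) \<le> U (int_decode n)" for n
  proof -
    have "(LINT x|lborel. norm (h n x)) \<le> (LINT x|lborel. indicat_real {0..1::real} x * U (int_decode n))"
    proof (rule Bochner_Integration.integral_mono)
      show "integrable lborel (\<lambda>x. norm (h n x))" by (rule integrable_norm[OF ih])
    qed (use hb in auto)
    then show ?thesis by simp
  qed
  have shift: "AE x in lborel. f n (\<kappa> n + 1 * x) = h n x" for n
  proof -
    have "AE x in lborel. x \<noteq> (1::real)" by (rule AE_lborel_singleton)
    then show ?thesis
      by eventually_elim (auto simp: f_def h_def indicator_def add.commute)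
  qed
  have f_meas [measurable]: "f n \<in> borel_measurable borel" "h n \<in> borel_measurable borel" for n
    unfolding f_def h_def by measurable
  have if': "integrable lborel (f n)" for n
  proof -
    have "integrable lborel (\<lambda>x. f n (\<kappa> n + 1 * x))"
      using integrable_cong_AE[OF _ _ shift[of n]] ih[of n] by simp
    then show ?thesis by (subst (asm) lborel_integrable_real_affine_iff) auto
  qed
  have int_eq: "(LINT x|lborel. f n x) = (LINT x|lborel. h n x)" for n
  proof -
    have "(LINT x|lborel. f n x) = (LINT x|lborel. f n (\<kappa> n + 1 * x))"
      by (subst lborel_integral_real_affine[where c = 1 and t = "\<kappa> n"]) auto
    also have "\<dots> = (LINT x|lborel. h n x)"
      by (rule integral_cong_AE) (use shift in auto)
    finally show ?thesis .
  qed
  have nf: "(LINT x|lborel. norm (f n x)) \<le> U (int_decode n)" for n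
  proof -
    have "(LINT x|lborel. norm (f n x)) = (LINT x|lborel. norm (f n (\<kappa> n + 1 * x)))"
      by (subst lborel_integral_real_affine[where c = 1 and t = "\<kappa> n"]) auto
    also have "\<dots> = (LINT x|lborel. norm (h n x))"
      by (rule integral_cong_AE) (use shift[of n] in auto)
    finally show ?thesis using nh[of n] by simp
  qed
  have f_eq: "f n x = (if n = int_encode \<lfloor>x\<rfloor> then F x else 0)" for n x
  proof (cases "n = int_encode \<lfloor>x\<rfloor>")
    case True
    then have "\<kappa> n \<le> x" "x < \<kappa> n + 1" by (simp_all add: \<kappa>_def)
    then show ?thesis using True by (simp add: f_def)
  next
    case False
    then have "\<lfloor>x\<rfloor> \<noteq> int_decode n" by (metis int_decode_inverse)
    then have "\<not> (\<kappa> n \<le> x \<and> x < \<kappa> n + 1)" by (auto simp: \<kappa>_def floor_eq_iff)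
    then show ?thesis using False by (auto simp: f_def indicator_def)
  qed
  have f_sums: "(\<lambda>n. f n x) sums F x" for x
    unfolding f_eq by (rule sums_single)
  have fabs: "summable (\<lambda>n. norm (f n x))" for x
    unfolding f_eq by (rule summable_finite[of "{int_encode \<lfloor>x\<rfloor>}"]) auto
  have habs: "summable (\<lambda>n. norm (h n x))" for x
  proof (rule summable_comparison_test'[OF sumU, of 0])
    fix n
    have "0 \<le> U (int_decode n)" using order_trans[OF norm_ge_zero U(2)[of 0]] by simp
    then show "norm (norm (h n x)) \<le> U (int_decode n)"
      using hb[of n x] by (cases "x \<in> {0..1}") auto
  qed
  have sf: "summable (\<lambda>n. LINT x|lborel. norm (f n x))"
    by (rule summable_comparison_test'[OF sumU, of 0]) (use nf in auto)
  have sh: "summable (\<lambda>n. LINT x|lborel. norm (h n x))"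
    by (rule summable_comparison_test'[OF sumU, of 0]) (use nh in auto)
  have F_eq: "F = (\<lambda>x. \<Sum>n. f n x)" using f_sums by (auto simp: sums_iff)
  show "integrable lborel F"
    unfolding F_eq by (intro integrable_suminf if' AE_I2 fabs sf)
  have h_eq: "(\<Sum>n. h n x) = indicat_real {0..1} x *\<^sub>R (\<Sum>\<^sub>\<infinity>k::int. F (x + of_int k))" for x
  proof (cases "x \<in> {0..1}")
    case True
    have "(\<lambda>k::int. norm (F (x + of_int k))) summable_on UNIV"
      by (rule summable_on_comparison_test[OF U(1)]) (use U(2)[OF True] in auto)
    from infsum_int_eq_suminf(1)[OF this] show ?thesis
      using True by (simp add: h_def \<kappa>_def)
  next
    case False
    then show ?thesis by (simp add: h_def)
  qed
  have "integrable lborel (\<lambda>x. \<Sum>n. h n x)" by (intro integrable_suminf ih AE_I2 habs sh)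
  then show "set_integrable lborel {0..1} (\<lambda>x. \<Sum>\<^sub>\<infinity>k::int. F (x + of_int k))"
    unfolding set_integrable_def h_eq .
  have "(LINT x|lborel. F x) = (\<Sum>n. LINT x|lborel. f n x)"
    by (subst F_eq) (intro integral_suminf if' AE_I2 fabs sf)
  also have "\<dots> = (LINT x|lborel. (\<Sum>n. h n x))"
    unfolding int_eq by (intro integral_suminf[symmetric] ih AE_I2 habs sh)
  finally show "(LINT x|lborel. F x) = (LINT x:{0..1}|lborel. \<Sum>\<^sub>\<infinity>k::int. F (x + of_int k))"
    unfolding h_eq set_lebesgue_integral_def .
qed

section \<open>The weight on the real line\<close>

definition gauss_density :: "complex \<Rightarrow> complex \<Rightarrow> real \<Rightarrow> complex" where
  "gauss_density q \<alpha> x = q powr (2 * (of_real x)\<^sup>2 - of_real x) * \<alpha> powr (4 * of_real x)"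

context q_base
begin

lemma powr_shift_int:
  fixes y :: complex
  assumes "y \<noteq> 0"
  shows "y powr (w + of_int k) = y powr w * y powi k"
proof -
  have "y powi k = exp (of_int k * ln y)"
    using assms exp_power_int[of "ln y" k] by simp
  then show ?thesis
    using assms by (simp add: powr_def distrib_right exp_add)
qed

lemma node_shift:
  "q powr of_real (x + of_int k) * \<alpha> = q powi k * (q powr of_real x * \<alpha>)"
  using powr_shift_int[of q "of_real x" k] by (simp add: mult_ac)

text \<open>
  The Gaussian in \<open>x\<close> is the source of the factor \<open>q^(2k\<^sup>2 - k) \<beta>^(4k)\<close> in the bilateral sum, with \<open>\<beta> = q\<^sup>x \<alpha>\<close>.
\<close>

lemma gauss_density_shift:
  assumes "\<alpha> \<noteq> 0"
  shows "gauss_density q \<alpha> (x + of_int k) =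
    q powi (2 * k\<^sup>2 - k) * (q powr of_real x * \<alpha>) powi (4 * k) * gauss_density q \<alpha> x"
proof -
  define X where "X = complex_of_real x"
  have e: "2 * (X + of_int k)\<^sup>2 - (X + of_int k) = 2 * X\<^sup>2 - X + of_int (4 * k) * X + of_int (2 * k\<^sup>2 - k)"
    by (simp add: power2_eq_square algebra_simps)
  have "q powr (2 * (X + of_int k)\<^sup>2 - (X + of_int k))
     = q powr (2 * X\<^sup>2 - X) * q powr (of_int (4 * k) * X) * q powi (2 * k\<^sup>2 - k)"
    unfolding e powr_shift_int[OF q_nonzero] by (simp only: powr_add)
  moreover have "q powr (of_int (4 * k) * X) = (q powr X) powi (4 * k)"
    by (simp only: powr_def q_nonzero if_False exp_power_int mult.assoc)
  moreover have "\<alpha> powr (4 * (X + of_int k)) = \<alpha> powr (4 * X) * \<alpha> powi (4 * k)"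
  proof -
    have "4 * (X + of_int k) = 4 * X + of_int (4 * k)" by simp
    then show ?thesis using powr_shift_int[OF assms] by metis
  qed
  ultimately show ?thesis
    unfolding gauss_density_def of_real_add of_real_of_int_eq X_def[symmetric] power_int_mult_distrib
    by (simp only: mult_ac)
qed

definition weight_line where
  "weight_line a b c d \<alpha> x = weight a b c d q (q powr of_real x * \<alpha>) 0 * gauss_density q \<alpha> x"

lemma weight_line_shift:
  assumes "\<alpha> \<noteq> 0"
  shows "weight_line a b c d \<alpha> (x + of_int k) =
    weight a b c d q (q powr of_real x * \<alpha>) k * gauss_density q \<alpha> x"
  unfolding weight_line_def gauss_density_shift[OF assms] weight_def wcore_def node_shift
  by (simp add: mult_ac)

lemma Psi_integrand_eq_weight_line:
  assumes "\<alpha> \<noteq> 0"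
  shows "Psi_integrand m n a b c d q \<alpha> x =
    qinv_askey_wilson n (q powr of_real x * \<alpha>) a b c d q *
    qinv_askey_wilson m (q powr of_real x * \<alpha>) a b c d q * weight_line a b c d \<alpha> x"
proof -
  define z where "z = q powr of_real x * \<alpha>"
  have z: "z \<noteq> 0" using assms by (simp add: z_def)
  have q1: "q powr (of_real x + 1) = q * q powr of_real x"
    using powr_shift_int[of q "of_real x" 1] by simp
  have q2: "q powr (1 - of_real x) = q / q powr of_real x"
    by (simp add: powr_diff)
  have q3: "q powr (2 * of_real x) = (q powr of_real x)\<^sup>2"
    by (simp add: power2_eq_square flip: powr_add)
  have "qpochs_inf [- (q powr (of_real x + 1)) * \<alpha> * t, q powr (1 - of_real x) * t / \<alpha>] q = wpair q t z" for t
    unfolding q1 q2 using assms by (simp add: qpochs_inf_def wpair_def z_def mult_ac)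
  then show ?thesis
    unfolding Psi_integrand_def weight_line_def weight_def wcore_def gauss_density_def q3 z_def[symmetric]
    by (simp add: power_mult_distrib mult_ac) (simp add: z_def power_mult_distrib mult_ac)
qed

lemma Psi_integrand_shift:
  assumes "\<alpha> \<noteq> 0"
  shows "Psi_integrand m n a b c d q \<alpha> (x + of_int k) =
    Psi_summand m n a b c d q (q powr of_real x * \<alpha>) k * gauss_density q \<alpha> x"
proof -
  have "q powr of_real x * \<alpha> \<noteq> 0" using assms by simp
  then show ?thesis
    unfolding Psi_integrand_eq_weight_line[OF assms] weight_line_shift[OF assms] node_shift
    by (subst Psi_summand_eq_weight) (simp_all add: mult_ac)
qed

lemma continuous_on_gauss_density:
  assumes "\<alpha> \<noteq> 0"
  shows "continuous_on S (gauss_density q \<alpha>)"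
  unfolding gauss_density_def[abs_def] powr_def using assms by (auto intro!: continuous_intros)

lemma continuous_on_node:
  "continuous_on S (\<lambda>x. q powr of_real x * \<alpha>)"
  unfolding powr_def by (auto intro!: continuous_intros)

lemma periodizable_weight_line:
  assumes lt: "norm (q * a * b * c * d) < 1" and \<alpha>: "\<alpha> \<noteq> 0"
  shows "periodizable (weight_line a b c d \<alpha>)"
proof -
  have nz: "q powr of_real x * \<alpha> \<noteq> 0" for x using \<alpha> by simp
  have wp: "continuous_on UNIV (\<lambda>x. wpair q t (q powr of_real x * \<alpha>))" for t
    unfolding wpair_def
    by (intro continuous_on_qpoch_inf norm_q continuous_on_mult continuous_on_divide
        continuous_on_const continuous_on_node) (use nz in blast)
  have "weight_line a b c d \<alpha> = (\<lambda>x. (1 + (q powr of_real x * \<alpha>)\<^sup>2) *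
      (wpair q a (q powr of_real x * \<alpha>) * wpair q b (q powr of_real x * \<alpha>) *
       wpair q c (q powr of_real x * \<alpha>) * wpair q d (q powr of_real x * \<alpha>)) * gauss_density q \<alpha> x)"
    unfolding weight_line_def[abs_def] weight_def wcore_def by simp
  moreover have "continuous_on UNIV \<dots>"
    by (intro continuous_on_mult continuous_on_add continuous_on_power continuous_on_const wp
        continuous_on_node continuous_on_gauss_density \<alpha>)
  ultimately have "continuous_on UNIV (weight_line a b c d \<alpha>)"
    by simp
  then have meas: "weight_line a b c d \<alpha> \<in> borel_measurable borel"
    by (rule borel_measurable_continuous_onI)
  have "bounded (gauss_density q \<alpha> ` {0..1})"
    by (intro compact_imp_bounded compact_continuous_image continuous_on_gauss_density \<alpha>) auto
  then obtain R where R: "\<And>x. x \<in> {0..1} \<Longrightarrow> norm (gauss_density q \<alpha> x) \<le> R"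
    unfolding bounded_iff by blast
  have "bounded ((\<lambda>x. q powr of_real x * \<alpha>) ` {0..1})"
    by (intro compact_imp_bounded compact_continuous_image continuous_on_node) auto
  then obtain B1 where B1: "\<And>x. x \<in> {0..1} \<Longrightarrow> norm (q powr of_real x * \<alpha>) \<le> B1"
    unfolding bounded_iff by blast
  have "bounded ((\<lambda>x. 1 / (q powr of_real x * \<alpha>)) ` {0..1})"
    using nz by (intro compact_imp_bounded compact_continuous_image continuous_on_divide
      continuous_on_node continuous_on_const) auto
  then obtain B2 where B2: "\<And>x. x \<in> {0..1} \<Longrightarrow> norm (1 / (q powr of_real x * \<alpha>)) \<le> B2"
    unfolding bounded_iff by blast
  define B where "B = max B1 B2"
  have B: "norm (q powr of_real x * \<alpha>) \<le> B" "1 / norm (q powr of_real x * \<alpha>) \<le> B" if "x \<in> {0..1}" for x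
    using B1[OF that] B2[OF that] by (auto simp: B_def le_max_iff_disj norm_divide)
  have B0: "0 \<le> B" using order_trans[OF norm_ge_zero B(1)[of 0]] by simp
  have "norm q * (norm a * norm b * norm c * norm d) < 1"
    using lt by (simp add: norm_mult mult_ac)
  then show ?thesis
  proof (rule weight_majorant[where B = B])
    fix U :: "int \<Rightarrow> real"
    assume U: "U summable_on UNIV" "\<And>a' b' c' d' \<beta> k. norm a' \<le> norm a \<Longrightarrow> norm b' \<le> norm b
      \<Longrightarrow> norm c' \<le> norm c \<Longrightarrow> norm d' \<le> norm d \<Longrightarrow> \<beta> \<noteq> 0
      \<Longrightarrow> norm \<beta> \<le> B \<Longrightarrow> 1 / norm \<beta> \<le> B \<Longrightarrow> norm (weight a' b' c' d' q \<beta> k) \<le> U k"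
    have "norm (weight_line a b c d \<alpha> (x + of_int k)) \<le> U k * R" if "x \<in> {0..1}" for x k
    proof -
      have w: "norm (weight a b c d q (q powr of_real x * \<alpha>) k) \<le> U k"
        by (rule U(2)) (use nz B[OF that] in auto)
      then have "0 \<le> U k" using norm_ge_zero order_trans by blast
      then show ?thesis
        unfolding weight_line_shift[OF \<alpha>] norm_mult using w R[OF that] by (intro mult_mono) auto
    qed
    moreover have "(\<lambda>k. U k * R) summable_on UNIV"
      by (intro summable_on_cmult_left U)
    ultimately show ?thesis
      using meas unfolding periodizable_def by blast
  qed (use B0 in auto)
qed

text \<open>
  Multiplied by factorials in the two bases, the weight becomes a weight with the parameters
  \<open>a q\<^sup>-\<^sup>i\<close> and \<open>b q\<^sup>-\<^sup>j\<close>, and \<open>i + j \<le> 2N\<close> keeps these in the range of convergence.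
\<close>

lemma periodizable_Psi_integrand:
  assumes nz: "a \<noteq> 0" "b \<noteq> 0" "c \<noteq> 0" "d \<noteq> 0" "\<alpha> \<noteq> 0"
    and lt: "norm q * norm (a * b * c * d) < norm q ^ (2 * N)" and "n \<le> N" "m \<le> N"
  shows "periodizable (Psi_integrand m n a b c d q \<alpha>)"
proof -
  define e where "e = (\<lambda>i. aw_prefactor a b c d n * aw_coeff a b c d n i)"
  have e: "qinv_askey_wilson n z a b c d q = (\<Sum>i\<le>n. e i * factorial_basis q a z i)" if "z \<noteq> 0" for z
    unfolding e_def by (rule qinv_askey_wilson_factorial_expansion[OF nz(1-4) that])
  obtain g where g: "\<And>z. z \<noteq> 0 \<Longrightarrow> qinv_askey_wilson m z a b c d q = (\<Sum>j\<le>m. g j * factorial_basis q b z j)"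
    using factorial_basis_change_sum[OF nz(1,2), where m = m and c = "\<lambda>k. aw_prefactor a b c d m * aw_coeff a b c d m k"]
      qinv_askey_wilson_factorial_expansion[OF nz(1,2,3,4)] by auto
  have "Psi_integrand m n a b c d q \<alpha> x = (\<Sum>i\<le>n. \<Sum>j\<le>m. (e i * g j * (basis_scale a i * basis_scale b j)) *
      weight_line (a / q ^ i) (b / q ^ j) c d \<alpha> x)" for x
  proof -
    define z where "z = q powr of_real x * \<alpha>"
    have z: "z \<noteq> 0" using nz by (simp add: z_def)
    have p: "basis_scale a i * basis_scale b j * weight_line (a / q ^ i) (b / q ^ j) c d \<alpha> x
      = factorial_basis q a z i * factorial_basis q b z j * weight_line a b c d \<alpha> x" for i j
      using factorial_basis_product_weight[OF nz(1,2) z, of 0 i j c d]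
      unfolding weight_line_def z_def[symmetric] by (simp only: mult_ac power_int_0_right mult_1_left)
    have "Psi_integrand m n a b c d q \<alpha> x = (\<Sum>i\<le>n. \<Sum>j\<le>m. e i * g j *
      (factorial_basis q a z i * factorial_basis q b z j * weight_line a b c d \<alpha> x))"
      unfolding Psi_integrand_eq_weight_line[OF nz(5)] z_def[symmetric] e[OF z] g[OF z]
      unfolding sum_product unfolding sum_distrib_right by (simp only: mult_ac)
    then show ?thesis unfolding p[symmetric] by (simp only: mult.assoc)
  qed
  moreover have "periodizable (\<lambda>x. \<Sum>i\<le>n. \<Sum>j\<le>m. (e i * g j * (basis_scale a i * basis_scale b j)) *
      weight_line (a / q ^ i) (b / q ^ j) c d \<alpha> x)"
  proof (intro periodizable_sum periodizable_cmult periodizable_weight_line nz finite_atMost)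
    fix i j assume "i \<in> {..n}" "j \<in> {..m}"
    then have "norm q ^ (2 * N) \<le> norm q ^ (i + j)"
      using assms(7,8) norm_q by (intro power_decreasing) auto
    then have "norm q * norm (a * b * c * d) < norm q ^ (i + j)" using lt by linarith
    then show "norm (q * (a / q ^ i) * (b / q ^ j) * c * d) < 1"
      by (simp add: norm_mult norm_divide norm_power field_simps power_add)
  qed
  ultimately show ?thesis
    by (metis (no_types, lifting) ext)
qed

section \<open>The integral of the theta function\<close>

lemma csqrt_of_real_mult:
  assumes "0 < r" "Re z > 0"
  shows "csqrt (of_real r * z) = of_real (sqrt r) * csqrt z"
proof (rule csqrt_unique)
  show "(of_real (sqrt r) * csqrt z)\<^sup>2 = of_real r * z"
    using assms by (simp add: power_mult_distrib flip: of_real_power)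
  have "Re (csqrt z) > 0 \<or> Re (csqrt z) = 0 \<and> 0 \<le> Im (csqrt z)"
    by (rule csqrt_principal)
  then show "0 < Re (of_real (sqrt r) * csqrt z) \<or>
      Re (of_real (sqrt r) * csqrt z) = 0 \<and> 0 \<le> Im (of_real (sqrt r) * csqrt z)"
    using assms by auto
qed

text \<open>
  The exponent is \<open>-2Lx\<^sup>2 + (L + 4 log \<alpha>)x\<close> with \<open>L = -log q\<close>, and \<open>Re L > 0\<close>.
\<close>

lemma gauss_density_integral:
  assumes \<alpha>: "\<alpha> \<noteq> 0"
  shows "integrable lborel (gauss_density q \<alpha>)"
    and "2 * (LINT x|lborel. gauss_density q \<alpha> x) =
      complex_of_real (sqrt (2 * pi)) * \<alpha> * exp (2 * (ln \<alpha>)\<^sup>2 / (- ln q))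
        / (q powr (1 / 8) * csqrt (- ln q))"
proof -
  define L where "L = - ln q"
  define A where "A = ln \<alpha>"
  have L: "Re L > 0"
    using norm_q by (simp add: L_def Re_Ln)
  then have L0: "L \<noteq> 0" by auto
  have qp: "q powr y = exp (- L * y)" for y
    by (simp add: powr_def L_def mult.commute)
  have ap: "\<alpha> powr y = exp (A * y)" for y
    using \<alpha> by (simp add: powr_def A_def mult.commute)
  have s: "Re (2 * L) > 0" using L by simp
  define B where "B = L + 4 * A"
  have g: "gauss_density q \<alpha> = (\<lambda>x. exp (- (2 * L) * (of_real x)\<^sup>2 + B * of_real x))"
    unfolding gauss_density_def[abs_def] qp ap exp_add[symmetric] B_def
    by (simp add: algebra_simps)
  show "integrable lborel (gauss_density q \<alpha>)"
    unfolding g by (rule integrable_complex_gaussian[OF s])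
  have r2: "csqrt (2 * L) = complex_of_real (sqrt 2) * csqrt L"
    using csqrt_of_real_mult[of 2 L] L by simp
  have c: "csqrt L \<noteq> 0" using L0 by simp
  have "B\<^sup>2 / (4 * (2 * L)) = L / 8 + A + 2 * A\<^sup>2 / L"
    using L0 by (simp add: B_def field_simps power2_eq_square)
  then have e: "exp (B\<^sup>2 / (4 * (2 * L))) = exp (L / 8) * \<alpha> * exp (2 * A\<^sup>2 / L)"
    using \<alpha> by (simp add: exp_add A_def)
  have q8: "exp (L / 8) = 1 / q powr (1 / 8)"
    unfolding qp by (simp add: exp_minus field_simps)
  have "2 * (complex_of_real (sqrt pi) / csqrt (2 * L)) = complex_of_real (sqrt (2 * pi)) / csqrt L"
  proof -
    define r where "r = complex_of_real (sqrt 2)"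
    have r: "r \<noteq> 0" "2 = r * r"
      by (simp_all add: r_def flip: of_real_mult)
    have "2 * (complex_of_real (sqrt pi) / csqrt (2 * L)) =
       r * r * (complex_of_real (sqrt pi) / (r * csqrt L))"
      unfolding r2 r_def[symmetric] by (simp only: r(2))
    also have "\<dots> = r * complex_of_real (sqrt pi) / csqrt L"
      using r(1) by simp
    finally have "2 * (complex_of_real (sqrt pi) / csqrt (2 * L)) =
      complex_of_real (sqrt 2) * complex_of_real (sqrt pi) / csqrt L"
      unfolding r_def .
    then show ?thesis by (simp add: real_sqrt_mult)
  qed
  then have "2 * (LINT x|lborel. gauss_density q \<alpha> x) =
      complex_of_real (sqrt (2 * pi)) / csqrt L * (1 / q powr (1 / 8) * \<alpha> * exp (2 * A\<^sup>2 / L))"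
    unfolding g integral_complex_gaussian[OF s] e q8 by (simp only: mult.assoc[symmetric])
  then show "2 * (LINT x|lborel. gauss_density q \<alpha> x) =
      complex_of_real (sqrt (2 * pi)) * \<alpha> * exp (2 * (ln \<alpha>)\<^sup>2 / (- ln q))
        / (q powr (1 / 8) * csqrt (- ln q))"
    unfolding L_def A_def by (simp add: mult_ac)
qed

text \<open>
  The unfolding is used backwards, with zero parameters: the integrand on the line is then
  \<open>(1 + q\<^sup>2\<^sup>x \<alpha>\<^sup>2)\<close> times a Gaussian density, and the second term is the density shifted by \<open>1/2\<close>.
\<close>

lemma theta_mass_integral:
  assumes \<alpha>: "\<alpha> \<noteq> 0"
  shows "(LINT x:{0..1}|lborel. mass 0 0 0 0 q (q powr of_real x * \<alpha>) * gauss_density q \<alpha> x) =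
      complex_of_real (sqrt (2 * pi)) * \<alpha> * exp (2 * (ln \<alpha>)\<^sup>2 / (- ln q))
        / (q powr (1 / 8) * csqrt (- ln q))"
proof -
  have p: "periodizable (weight_line 0 0 0 0 \<alpha>)"
    using \<alpha> by (intro periodizable_weight_line) auto
  have split: "weight_line 0 0 0 0 \<alpha> x = gauss_density q \<alpha> x + gauss_density q \<alpha> (1 / 2 + 1 * x)" for x
  proof -
    define X where "X = complex_of_real x"
    have e1: "2 * (1 / 2 + X)\<^sup>2 - (1 / 2 + X) = 2 * X + (2 * X\<^sup>2 - X)"
      by (simp add: power2_eq_square algebra_simps)
    have "\<alpha> powr 2 = \<alpha>\<^sup>2"
      using powr_shift_int[OF \<alpha>, of 0 2] \<alpha> by simp
    then have e2: "\<alpha> powr (4 * (1 / 2 + X)) = \<alpha>\<^sup>2 * \<alpha> powr (4 * X)"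
      by (simp add: distrib_left powr_add)
    have e3: "q powr (2 * X) = (q powr X)\<^sup>2"
      by (simp add: power2_eq_square flip: powr_add)
    have "gauss_density q \<alpha> (1 / 2 + 1 * x) = (q powr X * \<alpha>)\<^sup>2 * gauss_density q \<alpha> x"
    proof -
      have "complex_of_real (1 / 2 + 1 * x) = 1 / 2 + X" by (simp add: X_def)
      then show ?thesis
        unfolding gauss_density_def X_def[symmetric]
        by (simp only: e1 e2) (unfold powr_add e3 power_mult_distrib, simp only: mult_ac)
    qed
    then show ?thesis
      by (simp add: weight_line_def weight_def wcore_def wpair_def X_def distrib_right)
  qed
  have "(LINT x:{0..1}|lborel. mass 0 0 0 0 q (q powr of_real x * \<alpha>) * gauss_density q \<alpha> x)
     = (LINT x|lborel. weight_line 0 0 0 0 \<alpha> x)"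
    unfolding periodizable_unfold(3)[OF p] weight_line_shift[OF \<alpha>] mass_def
    by (simp only: infsum_cmult_left')
  also have "\<dots> = (LINT x|lborel. gauss_density q \<alpha> x + gauss_density q \<alpha> (1 / 2 + 1 * x))"
    unfolding split ..
  also have "(LINT x|lborel. gauss_density q \<alpha> x + gauss_density q \<alpha> (1 / 2 + 1 * x))
     = (LINT x|lborel. gauss_density q \<alpha> x) + (LINT x|lborel. gauss_density q \<alpha> (1 / 2 + 1 * x))"
    using gauss_density_integral(1)[OF \<alpha>]
    by (intro Bochner_Integration.integral_add lborel_integrable_real_affine) auto
  also have "(LINT x|lborel. gauss_density q \<alpha> (1 / 2 + 1 * x)) = (LINT x|lborel. gauss_density q \<alpha> x)"
    by (subst (2) lborel_integral_real_affine[where c = 1 and t = "1 / 2"]) auto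
  finally show ?thesis
    using gauss_density_integral(2)[OF \<alpha>] by simp
qed

end

section \<open>The orthogonality relations\<close>

theorem theorem4p4:
  fixes n m N :: nat and q \<alpha> a b c d :: complex
  assumes "0 < norm q" and "norm q < 1"
    and "\<alpha> \<noteq> 0" and "a \<noteq> 0" and "b \<noteq> 0" and "c \<noteq> 0" and "d \<noteq> 0"
    and "n \<le> N" and "m \<le> N"
    and "norm (a * b * c * d) < norm q powi (2 * int N - 1)"
  shows "(\<forall>\<beta>. \<beta> \<noteq> 0 \<longrightarrow> Psi_summand m n a b c d q \<beta> summable_on UNIV)
    \<and> Psi m n a b c d q \<alpha> =
        qpochs_inf [q, - (\<alpha>\<^sup>2), - q / \<alpha>\<^sup>2, - q * a * b, - q * a * c, - q * a * d,
                    - q * b * c, - q * b * d, - q * c * d] q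
        / qpoch_inf (q * a * b * c * d) q
        * hnorm n a b c d q * (if m = n then 1 else 0)
    \<and> integrable lborel (Psi_integrand m n a b c d q \<alpha>)
    \<and> set_integrable lborel {0..1}
        (\<lambda>x::real. Psi m n a b c d q (q powr of_real x * \<alpha>)
           * q powr (2 * (of_real x)\<^sup>2 - of_real x) * \<alpha> powr (4 * of_real x))
    \<and> (LINT x|lborel. Psi_integrand m n a b c d q \<alpha> x) =
        (LINT x:{0..1}|lborel. Psi m n a b c d q (q powr of_real x * \<alpha>)
           * q powr (2 * (of_real x)\<^sup>2 - of_real x) * \<alpha> powr (4 * of_real x))
    \<and> (LINT x:{0..1}|lborel. Psi m n a b c d q (q powr of_real x * \<alpha>)
           * q powr (2 * (of_real x)\<^sup>2 - of_real x) * \<alpha> powr (4 * of_real x)) =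
        complex_of_real (sqrt (2 * pi)) * \<alpha> * exp (2 * (ln \<alpha>)\<^sup>2 / (- ln q))
        * qpochs_inf [- q * a * b, - q * a * c, - q * a * d,
                      - q * b * c, - q * b * d, - q * c * d] q
        / (q powr (1 / 8) * csqrt (- ln q) * qpoch_inf (q * a * b * c * d) q)
        * hnorm n a b c d q * (if m = n then 1 else 0)"
proof -
  interpret q_base q by standard (use assms in auto)
  note nz = \<open>a \<noteq> 0\<close> \<open>b \<noteq> 0\<close> \<open>c \<noteq> 0\<close> \<open>d \<noteq> 0\<close>
  have ltN: "norm q * norm (a * b * c * d) < norm q ^ (2 * N)"
  proof -
    have "norm q * norm q powi (2 * int N - 1) = norm q ^ (2 * N)"
      using assms(1) power_int_of_nat[of "norm q" "2 * N"] by (simp add: power_int_diff)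
    then show ?thesis
      using mult_strict_left_mono[OF assms(10,1)] by simp
  qed
  have lt1: "norm (q * a * b * c * d) < 1"
  proof -
    have "norm (q * a * b * c * d) = norm q * norm (a * b * c * d)" by (simp add: norm_mult)
    also have "\<dots> < norm q ^ (2 * N)" by (rule ltN)
    also have "\<dots> \<le> 1" using norm_q by (intro power_le_one) auto
    finally show ?thesis .
  qed
  define H where "H = hnorm n a b c d q * (if m = n then 1 else 0)"
  define K where "K = qpoch_inf (- q * a * b) q * qpoch_inf (- q * a * c) q * qpoch_inf (- q * a * d) q
    * qpoch_inf (- q * b * c) q * qpoch_inf (- q * b * d) q * qpoch_inf (- q * c * d) q"
  define E where "E = qpoch_inf (q * a * b * c * d) q"
  have hs: "(Psi_summand m n a b c d q \<beta> has_sum H * mass a b c d q \<beta>) UNIV" if "\<beta> \<noteq> 0" for \<beta>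
    unfolding H_def by (rule Psi_has_sum[OF nz that ltN assms(8,9)])
  have Psi: "Psi m n a b c d q \<beta> = H * (K / E * mass 0 0 0 0 q \<beta>)" if "\<beta> \<noteq> 0" for \<beta>
    unfolding Psi_def infsumI[OF hs[OF that]] mass_eq_theta_mass[OF lt1 that] K_def E_def ..
  have summ: "\<forall>\<beta>. \<beta> \<noteq> 0 \<longrightarrow> Psi_summand m n a b c d q \<beta> summable_on UNIV"
    using hs by (auto simp: summable_on_def)
  have sum_eq: "Psi m n a b c d q \<alpha> =
        qpochs_inf [q, - (\<alpha>\<^sup>2), - q / \<alpha>\<^sup>2, - q * a * b, - q * a * c, - q * a * d,
                    - q * b * c, - q * b * d, - q * c * d] q
        / qpoch_inf (q * a * b * c * d) q
        * hnorm n a b c d q * (if m = n then 1 else 0)"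
    unfolding Psi[OF assms(3)] theta_mass[OF assms(3)] H_def K_def E_def qpochs_inf_def
    by (simp add: mult_ac)
  have per: "periodizable (Psi_integrand m n a b c d q \<alpha>)"
    by (rule periodizable_Psi_integrand[OF nz assms(3) ltN assms(8,9)])
  have unf: "(\<Sum>\<^sub>\<infinity>k::int. Psi_integrand m n a b c d q \<alpha> (x + of_int k)) =
     Psi m n a b c d q (q powr of_real x * \<alpha>) * q powr (2 * (of_real x)\<^sup>2 - of_real x) * \<alpha> powr (4 * of_real x)" for x
    unfolding Psi_integrand_shift[OF assms(3)] infsum_cmult_left' Psi_def gauss_density_def
    by (rule mult.assoc[symmetric])
  have final: "(LINT x:{0..1}|lborel. Psi m n a b c d q (q powr of_real x * \<alpha>)
           * q powr (2 * (of_real x)\<^sup>2 - of_real x) * \<alpha> powr (4 * of_real x)) =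
     complex_of_real (sqrt (2 * pi)) * \<alpha> * exp (2 * (ln \<alpha>)\<^sup>2 / (- ln q))
        * qpochs_inf [- q * a * b, - q * a * c, - q * a * d,
                      - q * b * c, - q * b * d, - q * c * d] q
        / (q powr (1 / 8) * csqrt (- ln q) * qpoch_inf (q * a * b * c * d) q)
        * hnorm n a b c d q * (if m = n then 1 else 0)"
  proof -
    have "Psi m n a b c d q (q powr of_real x * \<alpha>)
           * q powr (2 * (of_real x)\<^sup>2 - of_real x) * \<alpha> powr (4 * of_real x)
       = H * (K / E) * (mass 0 0 0 0 q (q powr of_real x * \<alpha>) * gauss_density q \<alpha> x)" for x
      using assms(3) by (subst Psi) (simp_all add: gauss_density_def)
    then have "(LINT x:{0..1}|lborel. Psi m n a b c d q (q powr of_real x * \<alpha>)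
           * q powr (2 * (of_real x)\<^sup>2 - of_real x) * \<alpha> powr (4 * of_real x)) =
       H * (K / E) * (complex_of_real (sqrt (2 * pi)) * \<alpha> * exp (2 * (ln \<alpha>)\<^sup>2 / (- ln q))
        / (q powr (1 / 8) * csqrt (- ln q)))"
      by (simp only: set_integral_mult_right theta_mass_integral[OF assms(3)])
    then show ?thesis
      unfolding H_def K_def E_def qpochs_inf_def by (simp add: mult_ac)
  qed
  show ?thesis
    using summ sum_eq periodizable_unfold[OF per, unfolded unf] final by blast
qed

end
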